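(* Let $\psi$ be a second-order sentence in the language with one unary function symbol $f$ and one individual constant $c$. If $\mathsf{WKL}^*_0$ proves that $\langle \mathbb{N}, S, 0\rangle \models \psi$, then over $\mathsf{RCA}^*_0$ the statement "for every structure $\langle A, f, c\rangle$, if $\langle A,f,c\rangle \models \psi$, then there exists a bijection between $\mathbb{N}$ and $A$" implies $\mathsf{RCA}_0$ (i.e. $\mathsf{RCA}^*_0$ together with that statement proves every axiom of $\mathsf{RCA}_0$).
   Context: Theories. All theories are in the language of second-order arithmetic (number variables and unary set variables). $\Sigma^0_n$, $\Delta^0_0$ etc. denote classes of formulas with first-order quantifiers only but arbitrary set parameters. $\mathsf{RCA}_0$ consists of the usual finite list of basic arithmetical axioms, $\Delta^0_1$ comprehension and $\Sigma^0_1$ induction. $\mathsf{RCA}^*_0$ is $\mathsf{RCA}_0$ with $\Sigma^0_1$ induction replaced by induction for $\Delta^0_0$ formulas together with the axiom $\exp$ stating totality of exponentiation (equivalently, $\Delta^0_0$ induction in the language with exponentiation). WKL is the axiom "every infinite binary tree has an infinite branch", and $\mathsf{WKL}^*_0$ is $\mathsf{RCA}^*_0$ plus WKL. Structures and satisfaction inside these theories. $\mathbb{N}$ is the set of all numbers (defined by $x=x$), and $S$ is the successor function. A structure $\langle A,f,c\rangle$ is given by a set $A\subseteq\mathbb{N}$, a function $f\colon A\to A$ (its graph, coded as a set of pairs) and $c\in A$. Bijections are likewise functions coded by sets. Second-order logic allows quantification over relations of any arity and is interpreted by the standard (full) semantics: in $\langle A,f,c\rangle\models\psi$, first-order quantifiers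 range over elements of $A$, and a second-order quantifier over $k$-ary relations ranges over all sets (of the theory) that code $k$-ary relations on $A$. Thus for a fixed $\psi$, $\langle A,f,c\rangle\models\psi$ is a formula of second-order arithmetic. *)

theory Defs
  imports Main
begin

section \<open>The language of second-order arithmetic\<close>

text \<open>
  Bound variables are de Bruijn indices, with one index space for number variables and
  another one for set variables.
\<close>

datatype tm = Var nat | Zero | One | Add tm tm | Mul tm tm

datatype fm =
    Falsum
  | Eq tm tm
  | Less tm tm
  | Mem tm nat
  | Imp fm fm
  | AllN fm
  | AllS fm

abbreviation Neg :: "fm \<Rightarrow> fm" where "Neg p \<equiv> Imp p Falsum"
abbreviation Or :: "fm \<Rightarrow> fm \<Rightarrow> fm" where "Or p q \<equiv> Imp (Neg p) q"
abbreviation And :: "fm \<Rightarrow> fm \<Rightarrow> fm" where "And p q \<equiv> Neg (Imp p (Neg q))"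
abbreviation Iff :: "fm \<Rightarrow> fm \<Rightarrow> fm" where "Iff p q \<equiv> And (Imp p q) (Imp q p)"
abbreviation ExN :: "fm \<Rightarrow> fm" where "ExN p \<equiv> Neg (AllN (Neg p))"
abbreviation ExS :: "fm \<Rightarrow> fm" where "ExS p \<equiv> Neg (AllS (Neg p))"

primrec tsubst :: "(nat \<Rightarrow> tm) \<Rightarrow> tm \<Rightarrow> tm" where
  "tsubst \<sigma> (Var i) = \<sigma> i"
| "tsubst \<sigma> Zero = Zero"
| "tsubst \<sigma> One = One"
| "tsubst \<sigma> (Add s t) = Add (tsubst \<sigma> s) (tsubst \<sigma> t)"
| "tsubst \<sigma> (Mul s t) = Mul (tsubst \<sigma> s) (tsubst \<sigma> t)"

definition tlift :: "tm \<Rightarrow> tm" where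
  "tlift = tsubst (\<lambda>i. Var (Suc i))"

primrec substN :: "(nat \<Rightarrow> tm) \<Rightarrow> fm \<Rightarrow> fm" where
  "substN \<sigma> Falsum = Falsum"
| "substN \<sigma> (Eq s t) = Eq (tsubst \<sigma> s) (tsubst \<sigma> t)"
| "substN \<sigma> (Less s t) = Less (tsubst \<sigma> s) (tsubst \<sigma> t)"
| "substN \<sigma> (Mem t X) = Mem (tsubst \<sigma> t) X"
| "substN \<sigma> (Imp p q) = Imp (substN \<sigma> p) (substN \<sigma> q)"
| "substN \<sigma> (AllN p) = AllN (substN (case_nat (Var 0) (\<lambda>i. tlift (\<sigma> i))) p)"
| "substN \<sigma> (AllS p) = AllS (substN \<sigma> p)"

text \<open>The only set terms are set variables, so substituting for them is renaming.\<close>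

primrec substS :: "(nat \<Rightarrow> nat) \<Rightarrow> fm \<Rightarrow> fm" where
  "substS \<rho> Falsum = Falsum"
| "substS \<rho> (Eq s t) = Eq s t"
| "substS \<rho> (Less s t) = Less s t"
| "substS \<rho> (Mem t X) = Mem t (\<rho> X)"
| "substS \<rho> (Imp p q) = Imp (substS \<rho> p) (substS \<rho> q)"
| "substS \<rho> (AllN p) = AllN (substS \<rho> p)"
| "substS \<rho> (AllS p) = AllS (substS (case_nat 0 (\<lambda>i. Suc (\<rho> i))) p)"

definition liftN :: "fm \<Rightarrow> fm" where
  "liftN = substN (\<lambda>i. Var (Suc i))"

definition liftS :: "fm \<Rightarrow> fm" where
  "liftS = substS Suc"

definition instN :: "tm \<Rightarrow> fm \<Rightarrow> fm" where
  "instN t = substN (case_nat t Var)"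

definition instS :: "nat \<Rightarrow> fm \<Rightarrow> fm" where
  "instS X = substS (case_nat X (\<lambda>i. i))"

text \<open>Least strict upper bounds of the free number and set indices, and universal closure.\<close>

primrec tbound :: "tm \<Rightarrow> nat" where
  "tbound (Var i) = Suc i"
| "tbound Zero = 0"
| "tbound One = 0"
| "tbound (Add s t) = max (tbound s) (tbound t)"
| "tbound (Mul s t) = max (tbound s) (tbound t)"

primrec boundN :: "fm \<Rightarrow> nat" where
  "boundN Falsum = 0"
| "boundN (Eq s t) = max (tbound s) (tbound t)"
| "boundN (Less s t) = max (tbound s) (tbound t)"
| "boundN (Mem t X) = tbound t"
| "boundN (Imp p q) = max (boundN p) (boundN q)"
| "boundN (AllN p) = boundN p - 1"
| "boundN (AllS p) = boundN p"

primrec boundS :: "fm \<Rightarrow> nat" where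
  "boundS Falsum = 0"
| "boundS (Eq s t) = 0"
| "boundS (Less s t) = 0"
| "boundS (Mem t X) = Suc X"
| "boundS (Imp p q) = max (boundS p) (boundS q)"
| "boundS (AllN p) = boundS p"
| "boundS (AllS p) = boundS p - 1"

definition ucl :: "fm \<Rightarrow> fm" where
  "ucl p = (AllN ^^ boundN p) ((AllS ^^ boundS p) p)"


section \<open>Provability\<close>

text \<open>Natural deduction for classical two-sorted first-order logic with equality of numbers.\<close>

inductive proves :: "fm set \<Rightarrow> fm \<Rightarrow> bool" (infix "\<turnstile>" 50) where
  Assm: "p \<in> \<Gamma> \<Longrightarrow> \<Gamma> \<turnstile> p"
| ImpI: "insert p \<Gamma> \<turnstile> q \<Longrightarrow> \<Gamma> \<turnstile> Imp p q"
| ImpE: "\<Gamma> \<turnstile> Imp p q \<Longrightarrow> \<Gamma> \<turnstile> p \<Longrightarrow> \<Gamma> \<turnstile> q"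
| Contr: "insert (Neg p) \<Gamma> \<turnstile> Falsum \<Longrightarrow> \<Gamma> \<turnstile> p"
| AllNI: "liftN ` \<Gamma> \<turnstile> p \<Longrightarrow> \<Gamma> \<turnstile> AllN p"
| AllNE: "\<Gamma> \<turnstile> AllN p \<Longrightarrow> \<Gamma> \<turnstile> instN t p"
| AllSI: "liftS ` \<Gamma> \<turnstile> p \<Longrightarrow> \<Gamma> \<turnstile> AllS p"
| AllSE: "\<Gamma> \<turnstile> AllS p \<Longrightarrow> \<Gamma> \<turnstile> instS X p"
| EqRefl: "\<Gamma> \<turnstile> Eq t t"
| EqSubst: "\<Gamma> \<turnstile> Eq s t \<Longrightarrow> \<Gamma> \<turnstile> instN s p \<Longrightarrow> \<Gamma> \<turnstile> instN t p"


section \<open>The theories\<close>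

inductive delta0 :: "fm \<Rightarrow> bool" where
  "delta0 Falsum"
| "delta0 (Eq s t)"
| "delta0 (Less s t)"
| "delta0 (Mem t X)"
| "delta0 p \<Longrightarrow> delta0 q \<Longrightarrow> delta0 (Imp p q)"
| "delta0 p \<Longrightarrow> delta0 (AllN (Imp (Less (Var 0) (tlift t)) p))"

definition sigma1 :: "fm \<Rightarrow> bool" where
  "sigma1 p \<longleftrightarrow> (\<exists>q. delta0 q \<and> p = ExN q)"

definition pi1 :: "fm \<Rightarrow> bool" where
  "pi1 p \<longleftrightarrow> (\<exists>q. delta0 q \<and> p = AllN q)"

definition basic_axioms :: "fm set" where
  "basic_axioms = ucl ` {
     Neg (Eq (Add (Var 0) One) Zero),
     Imp (Eq (Add (Var 0) One) (Add (Var 1) One)) (Eq (Var 0) (Var 1)),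
     Eq (Add (Var 0) Zero) (Var 0),
     Eq (Add (Var 0) (Add (Var 1) One)) (Add (Add (Var 0) (Var 1)) One),
     Eq (Mul (Var 0) Zero) Zero,
     Eq (Mul (Var 0) (Add (Var 1) One)) (Add (Mul (Var 0) (Var 1)) (Var 0)),
     Neg (Less (Var 0) Zero),
     Iff (Less (Var 0) (Add (Var 1) One)) (Or (Less (Var 0) (Var 1)) (Eq (Var 0) (Var 1)))}"

text \<open>The induction variable is number index 0; all other free variables are parameters.\<close>

definition ind_axiom :: "fm \<Rightarrow> fm" where
  "ind_axiom p =
     Imp (instN Zero p)
       (Imp (AllN (Imp p (substN (case_nat (Add (Var 0) One) (\<lambda>i. Var (Suc i))) p)))
         (AllN p))"

definition induction :: "(fm \<Rightarrow> bool) \<Rightarrow> fm set" where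
  "induction C = {ucl (ind_axiom p) | p. C p}"

definition delta1_comprehension :: "fm set" where
  "delta1_comprehension =
     {ucl (Imp (AllN (Iff p q)) (ExS (AllN (Iff (Mem (Var 0) 0) (liftS p))))) | p q.
        sigma1 p \<and> pi1 q}"

text \<open>
  \<open>Beta a b i r\<close> says that \<open>r\<close> is the remainder of \<open>a\<close> modulo \<open>1 + (i + 1) * b\<close>
  (Goedel's beta function), and \<open>Power x y z\<close> says that \<open>z\<close> is the last entry of a sequence
  \<open>1, x, x * x, \<dots>\<close> of length \<open>y + 1\<close> coded by means of it.
\<close>

definition Beta :: "tm \<Rightarrow> tm \<Rightarrow> tm \<Rightarrow> tm \<Rightarrow> fm" where
  "Beta a b i r =
     (let m = Add One (Mul (Add i One) b) in
      And (Less r m)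
        (ExN (And (Less (Var 0) (tlift (Add a One)))
          (Eq (tlift a) (Add (Mul (Var 0) (tlift m)) (tlift r))))))"

definition Power :: "tm \<Rightarrow> tm \<Rightarrow> tm \<Rightarrow> fm" where
  "Power x y z =
     (let x2 = tlift (tlift x); y2 = tlift (tlift y); z2 = tlift (tlift z);
          x4 = tlift (tlift x2) in
      ExN (ExN (And (Beta (Var 1) (Var 0) Zero One)
        (And
          (AllN (Imp (Less (Var 0) (tlift y2))
            (ExN (And (Less (Var 0) (Add (Var 3) One))
              (And (Beta (Var 3) (Var 2) (Var 1) (Var 0))
                   (Beta (Var 3) (Var 2) (Add (Var 1) One) (Mul (Var 0) x4)))))))
          (Beta (Var 1) (Var 0) y2 z2)))))"

definition exp_axiom :: fm where
  "exp_axiom = AllN (AllN (ExN (Power (Var 2) (Var 1) (Var 0))))"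

text \<open>
  A finite binary sequence is coded by the number whose binary expansion is that sequence
  preceded by a digit 1. So the empty sequence is 1, the one-step extensions of a sequence
  \<open>n\<close> are \<open>2 * n\<close> and \<open>2 * n + 1\<close>, and exactly the positive numbers are codes.
  An infinite branch \<open>B\<close> is given as the set of its finite initial segments.
\<close>

definition child0 :: "tm \<Rightarrow> tm" where
  "child0 t = Mul (Add One One) t"

definition child1 :: "tm \<Rightarrow> tm" where
  "child1 t = Add (child0 t) One"

definition Binary_tree :: "nat \<Rightarrow> fm" where
  "Binary_tree T =
     And (AllN (Imp (Mem (Var 0) T) (Less Zero (Var 0))))
         (AllN (Imp (Less Zero (Var 0))
           (Imp (Or (Mem (child0 (Var 0)) T) (Mem (child1 (Var 0)) T)) (Mem (Var 0) T))))"

definition Infinite :: "nat \<Rightarrow> fm" where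
  "Infinite X = AllN (ExN (And (Less (Var 1) (Var 0)) (Mem (Var 0) X)))"

definition Branch :: "nat \<Rightarrow> nat \<Rightarrow> fm" where
  "Branch B T =
     And (AllN (Imp (Mem (Var 0) B) (Mem (Var 0) T)))
       (And (Binary_tree B)
         (And (Mem One B)
           (AllN (Imp (Mem (Var 0) B)
             (Iff (Mem (child0 (Var 0)) B) (Neg (Mem (child1 (Var 0)) B)))))))"

definition wkl_axiom :: fm where
  "wkl_axiom = AllS (Imp (And (Binary_tree 0) (Infinite 0)) (ExS (Branch 0 1)))"

definition RCA0 :: "fm set" where
  "RCA0 = basic_axioms \<union> delta1_comprehension \<union> induction sigma1"

definition RCA0_star :: "fm set" where
  "RCA0_star = basic_axioms \<union> delta1_comprehension \<union> induction delta0 \<union> {exp_axiom}"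

definition WKL0_star :: "fm set" where
  "WKL0_star = RCA0_star \<union> {wkl_axiom}"


section \<open>Second-order sentences over one unary function and one constant\<close>

text \<open>
  Again de Bruijn indices: one index space for individual variables, one for relation
  variables of all arities. The arity is given at the quantifier.
\<close>

datatype so_tm = SVar nat | Const | App so_tm

datatype so_fm =
    SFalsum
  | SEq so_tm so_tm
  | SRel nat "so_tm list"
  | SImp so_fm so_fm
  | SAll so_fm
  | SAllR nat so_fm

primrec so_tm_wf :: "nat \<Rightarrow> so_tm \<Rightarrow> bool" where
  "so_tm_wf n (SVar i) \<longleftrightarrow> i < n"
| "so_tm_wf n Const \<longleftrightarrow> True"
| "so_tm_wf n (App s) \<longleftrightarrow> so_tm_wf n s"

primrec so_wf :: "nat \<Rightarrow> nat list \<Rightarrow> so_fm \<Rightarrow> bool" where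
  "so_wf n ks SFalsum \<longleftrightarrow> True"
| "so_wf n ks (SEq s t) \<longleftrightarrow> so_tm_wf n s \<and> so_tm_wf n t"
| "so_wf n ks (SRel i ts) \<longleftrightarrow>
     i < length ks \<and> length ts = ks ! i \<and> (\<forall>t \<in> set ts. so_tm_wf n t)"
| "so_wf n ks (SImp p q) \<longleftrightarrow> so_wf n ks p \<and> so_wf n ks q"
| "so_wf n ks (SAll p) \<longleftrightarrow> so_wf (Suc n) ks p"
| "so_wf n ks (SAllR k p) \<longleftrightarrow> 0 < k \<and> so_wf n (k # ks) p"

definition so_sentence :: "so_fm \<Rightarrow> bool" where
  "so_sentence p \<longleftrightarrow> so_wf 0 [] p"


section \<open>Structures and satisfaction inside second-order arithmetic\<close>

text \<open>The injective pairing \<open>(x, y) \<mapsto> (x + y)\<^sup>2 + x\<close>, iterated to code tuples.\<close>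

definition pair :: "tm \<Rightarrow> tm \<Rightarrow> tm" where
  "pair s t = Add (Mul (Add s t) (Add s t)) s"

fun tuple :: "tm list \<Rightarrow> tm" where
  "tuple [] = Zero"
| "tuple [t] = t"
| "tuple (t # u # us) = pair t (tuple (u # us))"

text \<open>\<open>x\<close> codes a tuple extending \<open>us\<close> by \<open>k\<close> further entries from \<open>A\<close>.\<close>

primrec Tuple_ext :: "nat \<Rightarrow> nat \<Rightarrow> tm list \<Rightarrow> tm \<Rightarrow> fm" where
  "Tuple_ext A 0 us x = Eq x (tuple us)"
| "Tuple_ext A (Suc k) us x =
     ExN (And (Mem (Var 0) A) (Tuple_ext A k (map tlift us @ [Var 0]) (tlift x)))"

definition Relation_on :: "nat \<Rightarrow> nat \<Rightarrow> nat \<Rightarrow> fm" where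
  "Relation_on k R A = AllN (Imp (Mem (Var 0) R) (Tuple_ext A k [] (Var 0)))"

text \<open>
  \<open>Value F c e s y\<close>: the term \<open>s\<close> has value \<open>y\<close>, where the function is given by its graph
  \<open>F\<close>, the constant by \<open>c\<close>, and the individual variables by \<open>e\<close>.
\<close>

primrec Value :: "nat \<Rightarrow> tm \<Rightarrow> (nat \<Rightarrow> tm) \<Rightarrow> so_tm \<Rightarrow> tm \<Rightarrow> fm" where
  "Value F c e (SVar i) y = Eq (e i) y"
| "Value F c e Const y = Eq c y"
| "Value F c e (App s) y =
     ExN (And (Value F (tlift c) (\<lambda>i. tlift (e i)) s (Var 0))
              (Mem (pair (Var 0) (tlift y)) F))"

text \<open>The tuple of \<open>us\<close> followed by the values of the terms \<open>ts\<close> is in \<open>R\<close>.\<close>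

primrec Holds :: "nat \<Rightarrow> nat \<Rightarrow> tm \<Rightarrow> (nat \<Rightarrow> tm) \<Rightarrow> tm list \<Rightarrow> so_tm list \<Rightarrow> fm" where
  "Holds R F c e us [] = Mem (tuple us) R"
| "Holds R F c e us (t # ts) =
     ExN (And (Value F (tlift c) (\<lambda>i. tlift (e i)) t (Var 0))
              (Holds R F (tlift c) (\<lambda>i. tlift (e i)) (map tlift us @ [Var 0]) ts))"

text \<open>
  \<open>Sat A F c p\<close> expresses that \<open>\<langle>A, F, c\<rangle>\<close> satisfies \<open>p\<close>. The individual and relation
  variables of \<open>p\<close> become the number and set variables with the same index; the parameters
  \<open>A\<close>, \<open>F\<close>, \<open>c\<close> are lifted instead, so no clash arises when \<open>p\<close> is a sentence.
\<close>

primrec Sat :: "nat \<Rightarrow> nat \<Rightarrow> tm \<Rightarrow> so_fm \<Rightarrow> fm" where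
  "Sat A F c SFalsum = Falsum"
| "Sat A F c (SEq s t) =
     ExN (And (Value F (tlift c) (\<lambda>i. Var (Suc i)) s (Var 0))
              (Value F (tlift c) (\<lambda>i. Var (Suc i)) t (Var 0)))"
| "Sat A F c (SRel R ts) = Holds R F c Var [] ts"
| "Sat A F c (SImp p q) = Imp (Sat A F c p) (Sat A F c q)"
| "Sat A F c (SAll p) = AllN (Imp (Mem (Var 0) A) (Sat A F (tlift c) p))"
| "Sat A F c (SAllR k p) = AllS (Imp (Relation_on k 0 (Suc A)) (Sat (Suc A) (Suc F) c p))"

definition Function :: "nat \<Rightarrow> nat \<Rightarrow> nat \<Rightarrow> fm" where
  "Function F A B =
     And (AllN (Imp (Mem (Var 0) F)
           (ExN (ExN (And (And (Mem (Var 1) A) (Mem (Var 0) B))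
                          (Eq (Var 2) (pair (Var 1) (Var 0))))))))
       (And (AllN (Imp (Mem (Var 0) A) (ExN (Mem (pair (Var 1) (Var 0)) F))))
            (AllN (AllN (AllN
              (Imp (And (Mem (pair (Var 2) (Var 1)) F) (Mem (pair (Var 2) (Var 0)) F))
                   (Eq (Var 1) (Var 0)))))))"

definition Bijection :: "nat \<Rightarrow> nat \<Rightarrow> nat \<Rightarrow> fm" where
  "Bijection F A B =
     And (Function F A B)
       (And (AllN (AllN (AllN
              (Imp (And (Mem (pair (Var 2) (Var 0)) F) (Mem (pair (Var 1) (Var 0)) F))
                   (Eq (Var 2) (Var 1))))))
            (AllN (Imp (Mem (Var 0) B) (ExN (Mem (pair (Var 0) (Var 1)) F)))))"

definition Structure :: "nat \<Rightarrow> nat \<Rightarrow> tm \<Rightarrow> fm" where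
  "Structure A F c = And (Function F A A) (Mem c A)"

definition All_numbers :: "nat \<Rightarrow> fm" where
  "All_numbers N = AllN (Mem (Var 0) N)"

definition Successor_graph :: "nat \<Rightarrow> fm" where
  "Successor_graph F =
     AllN (Iff (Mem (Var 0) F) (ExN (Eq (Var 1) (pair (Var 0) (Add (Var 0) One)))))"

text \<open>
  \<open>\<langle>\<nat>, S, 0\<rangle>\<close> satisfies \<open>p\<close>; here and below, set index 0 is the universe \<open>A\<close> and set index 1
  the graph \<open>F\<close>. The two sets are determined by the premise and exist by comprehension.
\<close>

definition Nat_sat :: "so_fm \<Rightarrow> fm" where
  "Nat_sat p = AllS (AllS (Imp (And (All_numbers 0) (Successor_graph 1)) (Sat 0 1 Zero p)))"

text \<open>
  Every structure satisfying \<open>p\<close> is in bijection with \<open>\<nat>\<close>. Innermost, the set indices 0, 1, 2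
  are the bijection, the set of all numbers and \<open>A\<close>.
\<close>

definition Models_bij_Nat :: "so_fm \<Rightarrow> fm" where
  "Models_bij_Nat p =
     AllS (AllS (AllN
       (Imp (Structure 0 1 (Var 0))
         (Imp (Sat 0 1 (Var 0) p)
           (ExS (ExS (And (All_numbers 1) (Bijection 0 1 2))))))))"

end

theory Submission
  imports Defs "HOL-Library.Countable" "HOL-Library.Nat_Bijection"
begin

text \<open>By soundness and Henkin completeness it suffices to refute a model \<open>M\<close> of \<open>RCA\<^sub>0\<^sup>*\<close> in which \<open>\<Sigma>\<^sub>1\<close>
  induction fails while every structure satisfying \<open>\<psi>\<close> is in bijection with \<open>M\<close>. A failure of \<open>\<Sigma>\<^sub>1\<close> induction
  yields a proper \<open>\<Sigma>\<^sub>1\<close> definable cut, which can be shortened to a cut \<open>U\<close> closed under exponentiation. With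
  the traces \<open>Y \<inter> U\<close> of the sets of \<open>M\<close>, it is a model of \<open>WKL\<^sub>0\<^sup>*\<close>, so \<open>\<langle>U, S, 0\<rangle>\<close> satisfies \<open>\<psi>\<close> there. The set
  \<open>A\<close> of all pairs of an element of \<open>U\<close> and its least witness belongs to \<open>M\<close> and carries a copy of \<open>\<langle>U, S, 0\<rangle>\<close>.
  Collection and the coding of bounded sets by numbers show that the relations on \<open>A\<close> in \<open>M\<close> are exactly
  the copies of the traces, so \<open>A\<close> satisfies \<open>\<psi>\<close> in \<open>M\<close>. But a bijection of \<open>M\<close> with \<open>A\<close> would map an
  interval of \<open>M\<close> injectively into a shorter one.\<close>

section \<open>Two-sorted structures and soundness\<close>

text \<open>The cut is not a set of the model, yet the bijection statement only speaks of structures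
  that are sets. Attaching least witnesses repairs this, but then the satisfaction of
  \<open>\<psi>\<close> has to be carried across for all relations. Pulling a relation on
  \<open>A\<close> back to the cut gives a predicate that is Sigma_1 together with its complement
  only on the cut itself, so comprehension cannot be applied to it; separating the two parts below
  some \<open>d\<close> beyond the cut gives a set with the right trace. The same room beyond the
  cut, through overspill, yields weak Koenig's lemma in the cut with no such assumption on the
  model, which is why a proof from \<open>WKL0_star\<close> may be assumed. Shortening is delicate
  as well. The usual condition that \<open>x + y\<close> stays in the cut for all \<open>y\<close>
  in the cut is no longer Sigma_1. Instead the cut is restricted to lengths of coded iterations of
  an exponential; if that cut is not closed, some element escapes a still smaller Sigma_1 cut, and
  the iterates along the smaller cut are already coded by one number.\<close>

record 'a str =
  universe :: "'a set"
  zeroS :: 'a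
  oneS :: 'a
  plusS :: "'a \<Rightarrow> 'a \<Rightarrow> 'a"
  timesS :: "'a \<Rightarrow> 'a \<Rightarrow> 'a"
  lessS :: "'a \<Rightarrow> 'a \<Rightarrow> bool"
  sets :: "'a set set"

primrec tval :: "('a, 'm) str_scheme \<Rightarrow> (nat \<Rightarrow> 'a) \<Rightarrow> tm \<Rightarrow> 'a" where
  "tval M e (Var i) = e i"
| "tval M e Zero = zeroS M"
| "tval M e One = oneS M"
| "tval M e (Add s t) = plusS M (tval M e s) (tval M e t)"
| "tval M e (Mul s t) = timesS M (tval M e s) (tval M e t)"

primrec eval :: "('a, 'm) str_scheme \<Rightarrow> (nat \<Rightarrow> 'a) \<Rightarrow> (nat \<Rightarrow> 'a set) \<Rightarrow> fm \<Rightarrow> bool" where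
  "eval M e S Falsum \<longleftrightarrow> False"
| "eval M e S (Eq s t) \<longleftrightarrow> tval M e s = tval M e t"
| "eval M e S (Less s t) \<longleftrightarrow> lessS M (tval M e s) (tval M e t)"
| "eval M e S (Mem t X) \<longleftrightarrow> tval M e t \<in> S X"
| "eval M e S (Imp p q) \<longleftrightarrow> (eval M e S p \<longrightarrow> eval M e S q)"
| "eval M e S (AllN p) \<longleftrightarrow> (\<forall>x\<in>universe M. eval M (case_nat x e) S p)"
| "eval M e S (AllS p) \<longleftrightarrow> (\<forall>Y\<in>sets M. eval M e (case_nat Y S) p)"

text \<open>Members of \<open>sets M\<close> may contain objects outside the universe, since
  formulas only test elements of the universe; this is why isomorphisms later act on
  \<open>Y \<inter> universe M\<close>. Nonemptiness of \<open>sets M\<close> provides values for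
  set variables.\<close>

definition wf_str :: "('a, 'm) str_scheme \<Rightarrow> bool" where
  "wf_str M \<longleftrightarrow> zeroS M \<in> universe M \<and> oneS M \<in> universe M \<and> sets M \<noteq> {} \<and>
     (\<forall>x\<in>universe M. \<forall>y\<in>universe M. plusS M x y \<in> universe M \<and> timesS M x y \<in> universe M)"

lemma tval_in: "wf_str M \<Longrightarrow> (\<And>i. e i \<in> universe M) \<Longrightarrow> tval M e t \<in> universe M"
  by (induction t) (auto simp: wf_str_def)

lemma tval_tsubst: "tval M e (tsubst \<sigma> t) = tval M (\<lambda>i. tval M e (\<sigma> i)) t"
  by (induction t) auto

lemma tval_tlift [simp]: "tval M (case_nat x e) (tlift t) = tval M e t"
  by (simp add: tlift_def tval_tsubst)

lemma eval_substN: "eval M e S (substN \<sigma> p) \<longleftrightarrow> eval M (\<lambda>i. tval M e (\<sigma> i)) S p"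
proof (induction p arbitrary: e S \<sigma>)
  case (AllN p)
  have "(\<lambda>i. tval M (case_nat x e) (case i of 0 \<Rightarrow> Var 0 | Suc i \<Rightarrow> tlift (\<sigma> i)))
      = case_nat x (\<lambda>i. tval M e (\<sigma> i))" for x
    by (rule ext) (auto split: nat.split)
  then show ?case by (simp add: AllN)
qed (auto simp: tval_tsubst)

lemma eval_substS: "eval M e S (substS \<rho> p) \<longleftrightarrow> eval M e (\<lambda>X. S (\<rho> X)) p"
proof (induction p arbitrary: e S \<rho>)
  case (AllS p)
  have "(\<lambda>X. (case_nat Y S) (case X of 0 \<Rightarrow> 0 | Suc i \<Rightarrow> Suc (\<rho> i)))
      = case_nat Y (\<lambda>X. S (\<rho> X))" for Y
    by (rule ext) (auto split: nat.split)
  then show ?case by (simp add: AllS)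
qed auto

lemma eval_liftN [simp]: "eval M (case_nat x e) S (liftN p) \<longleftrightarrow> eval M e S p"
  by (simp add: liftN_def eval_substN)

lemma eval_liftS [simp]: "eval M e (case_nat Y S) (liftS p) \<longleftrightarrow> eval M e S p"
  by (simp add: liftS_def eval_substS)

lemma eval_instN: "eval M e S (instN t p) \<longleftrightarrow> eval M (case_nat (tval M e t) e) S p"
proof -
  have "(\<lambda>i. tval M e (case i of 0 \<Rightarrow> t | Suc i \<Rightarrow> Var i)) = case_nat (tval M e t) e"
    by (rule ext) (auto split: nat.split)
  then show ?thesis by (simp add: instN_def eval_substN)
qed

lemma eval_instS: "eval M e S (instS X p) \<longleftrightarrow> eval M e (case_nat (S X) S) p"
proof -
  have "(\<lambda>Y. S (case Y of 0 \<Rightarrow> X | Suc i \<Rightarrow> i)) = case_nat (S X) S"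
    by (rule ext) (auto split: nat.split)
  then show ?thesis by (simp add: instS_def eval_substS)
qed

lemma case_nat_in: "x \<in> A \<Longrightarrow> (\<And>i. e i \<in> A) \<Longrightarrow> case_nat x e i \<in> A"
  by (cases i) auto

theorem soundness:
  assumes "\<Gamma> \<turnstile> p" "wf_str M"
  shows "(\<And>i. e i \<in> universe M) \<Longrightarrow> (\<And>X. S X \<in> sets M) \<Longrightarrow> \<forall>q\<in>\<Gamma>. eval M e S q
    \<Longrightarrow> eval M e S p"
  using assms(1)
proof (induction arbitrary: e S)
  case (AllNI \<Gamma> p)
  have "eval M (case_nat x e) S p" if "x \<in> universe M" for x
    by (rule AllNI.IH) (auto simp: AllNI.prems that intro: case_nat_in)
  then show ?case by simp
next
  case (AllNE \<Gamma> p t)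
  then show ?case using tval_in[OF assms(2)] by (auto simp: eval_instN)
next
  case (AllSI \<Gamma> p)
  have "eval M e (case_nat Y S) p" if "Y \<in> sets M" for Y
    by (rule AllSI.IH) (auto simp: AllSI.prems that intro: case_nat_in)
  then show ?case by simp
next
  case (AllSE \<Gamma> p X)
  then show ?case by (auto simp: eval_instS)
next
  case (EqSubst \<Gamma> s t p)
  then have "tval M e s = tval M e t" by fastforce
  moreover have "eval M e S (instN s p)" by (rule EqSubst.IH(2)) (fact EqSubst.prems)+
  ultimately show ?case by (simp add: eval_instN)
next
  case (Contr p \<Gamma>)
  then show ?case by fastforce
next
  case (ImpI p \<Gamma> q)
  then show ?case by fastforce
next
  case (ImpE \<Gamma> p q)
  then show ?case by fastforce
qed auto

lemma tval_cong: "(\<And>i. i < tbound t \<Longrightarrow> e i = e' i) \<Longrightarrow> tval M e t = tval M e' t"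
  by (induction t) auto

lemma eval_cong:
  "(\<And>i. i < boundN p \<Longrightarrow> e i = e' i) \<Longrightarrow> (\<And>X. X < boundS p \<Longrightarrow> S X = S' X) \<Longrightarrow>
   eval M e S p \<longleftrightarrow> eval M e' S' p"
proof (induction p arbitrary: e e' S S')
  case (Eq s t)
  then show ?case by (metis boundN.simps(2) eval.simps(2) less_max_iff_disj tval_cong)
next
  case (Less s t)
  then show ?case by (metis boundN.simps(3) eval.simps(3) less_max_iff_disj tval_cong)
next
  case (Mem t X)
  then have "tval M e t = tval M e' t" by (intro tval_cong) auto
  then show ?case using Mem by simp
next
  case (Imp p q)
  have "eval M e S p \<longleftrightarrow> eval M e' S' p" by (rule Imp.IH) (use Imp.prems in simp_all)
  moreover have "eval M e S q \<longleftrightarrow> eval M e' S' q" by (rule Imp.IH) (use Imp.prems in simp_all)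
  ultimately show ?case by simp
next
  case (AllN p)
  have "eval M (case_nat x e) S p \<longleftrightarrow> eval M (case_nat x e') S' p" for x
    by (rule AllN.IH) (use AllN.prems in \<open>simp_all split: nat.split\<close>)
  then show ?case by simp
next
  case (AllS p)
  have "eval M e (case_nat Y S) p \<longleftrightarrow> eval M e' (case_nat Y S') p" for Y
    by (rule AllS.IH) (use AllS.prems in \<open>simp_all split: nat.split\<close>)
  then show ?case by simp
qed simp

lemma case_nat_diff: "case_nat x f (i - n) = (if i \<le> n then x else f (i - Suc n))"
  by (cases "i \<le> n") (auto simp flip: Suc_diff_Suc)

lemma eval_AllN_funpow:
  "eval M e S ((AllN ^^ n) p) \<Longrightarrow> (\<And>i. e' i \<in> universe M) \<Longrightarrow>
   eval M (\<lambda>i. if i < n then e' i else e (i - n)) S p"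
proof (induction n arbitrary: e)
  case (Suc n)
  then have "eval M (case_nat (e' n) e) S ((AllN ^^ n) p)" by simp
  from Suc.IH[OF this Suc.prems(2)]
  have "eval M (\<lambda>i. if i < n then e' i else case_nat (e' n) e (i - n)) S p" .
  moreover have "(\<lambda>i. if i < n then e' i else case_nat (e' n) e (i - n))
      = (\<lambda>i. if i < Suc n then e' i else e (i - Suc n))"
    by (rule ext) (simp add: case_nat_diff less_Suc_eq)
  ultimately show ?case by simp
qed simp

lemma eval_AllS_funpow:
  "eval M e S ((AllS ^^ n) p) \<Longrightarrow> (\<And>i. S' i \<in> sets M) \<Longrightarrow>
   eval M e (\<lambda>i. if i < n then S' i else S (i - n)) p"
proof (induction n arbitrary: S)
  case (Suc n)
  then have "eval M e (case_nat (S' n) S) ((AllS ^^ n) p)" by simp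
  from Suc.IH[OF this Suc.prems(2)]
  have "eval M e (\<lambda>i. if i < n then S' i else case_nat (S' n) S (i - n)) p" .
  moreover have "(\<lambda>i. if i < n then S' i else case_nat (S' n) S (i - n))
      = (\<lambda>i. if i < Suc n then S' i else S (i - Suc n))"
    by (rule ext) (simp add: case_nat_diff less_Suc_eq)
  ultimately show ?case by simp
qed simp

text \<open>Stripping the two quantifier blocks gives arbitrary values to the indices below
  \<open>boundN p\<close> and \<open>boundS p\<close>, and by \<open>eval_cong\<close> no other
  index matters. Hence the truth of a closure does not depend on the environment.\<close>

lemma eval_ucl:
  assumes "\<And>i. e i \<in> universe M" "\<And>X. S X \<in> sets M"
  shows "eval M e S (ucl p) \<longleftrightarrow>
    (\<forall>e' S'. (\<forall>i. e' i \<in> universe M) \<longrightarrow> (\<forall>X. S' X \<in> sets M) \<longrightarrow> eval M e' S' p)"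
proof (intro iffI allI impI)
  fix e' :: "nat \<Rightarrow> 'a" and S' :: "nat \<Rightarrow> 'a set"
  assume *: "eval M e S (ucl p)" "\<forall>i. e' i \<in> universe M" "\<forall>X. S' X \<in> sets M"
  let ?e = "\<lambda>i. if i < boundN p then e' i else e (i - boundN p)"
  let ?S = "\<lambda>X. if X < boundS p then S' X else S (X - boundS p)"
  have "eval M ?e S ((AllS ^^ boundS p) p)"
    using * by (intro eval_AllN_funpow) (auto simp: ucl_def)
  then have "eval M ?e ?S p" using * by (intro eval_AllS_funpow) auto
  then show "eval M e' S' p" by (subst eval_cong[where e' = ?e and S' = ?S]) auto
next
  assume *: "\<forall>e' S'. (\<forall>i. e' i \<in> universe M) \<longrightarrow> (\<forall>X. S' X \<in> sets M) \<longrightarrow> eval M e' S' p"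
  have "\<forall>X. S X \<in> sets M \<Longrightarrow> \<forall>i. e i \<in> universe M \<Longrightarrow> eval M e S ((AllS ^^ n) p)" for n e S
    by (induction n arbitrary: S) (auto simp: * intro!: case_nat_in)
  then have "\<forall>X. S X \<in> sets M \<Longrightarrow> \<forall>i. e i \<in> universe M \<Longrightarrow>
      eval M e S ((AllN ^^ m) ((AllS ^^ n) p))" for n m e S
    by (induction m arbitrary: e) (auto intro!: case_nat_in)
  then show "eval M e S (ucl p)" using assms by (simp add: ucl_def)
qed

section \<open>Completeness\<close>

lemma weakening: "\<Gamma> \<turnstile> p \<Longrightarrow> \<Gamma> \<subseteq> \<Delta> \<Longrightarrow> \<Delta> \<turnstile> p"
proof (induction arbitrary: \<Delta> rule: proves.induct)
  case (Assm p \<Gamma>)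
  then show ?case by (intro proves.Assm) auto
next
  case (ImpI p \<Gamma> q)
  show ?case by (rule proves.ImpI, rule ImpI.IH) (use ImpI.prems in auto)
next
  case (ImpE \<Gamma> p q)
  show ?case by (rule proves.ImpE[OF ImpE.IH]) fact+
next
  case (Contr p \<Gamma>)
  show ?case by (rule proves.Contr, rule Contr.IH) (use Contr.prems in auto)
next
  case (AllNI \<Gamma> p)
  show ?case by (rule proves.AllNI, rule AllNI.IH) (use AllNI.prems in auto)
next
  case (AllNE \<Gamma> p t)
  show ?case by (rule proves.AllNE, rule AllNE.IH) fact
next
  case (AllSI \<Gamma> p)
  show ?case by (rule proves.AllSI, rule AllSI.IH) (use AllSI.prems in auto)
next
  case (AllSE \<Gamma> p X)
  show ?case by (rule proves.AllSE, rule AllSE.IH) fact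
next
  case (EqRefl \<Gamma> t)
  show ?case by (rule proves.EqRefl)
next
  case (EqSubst \<Gamma> s t p)
  show ?case by (rule proves.EqSubst[OF EqSubst.IH]) fact+
qed

text \<open>Compactness of the calculus: it makes the union of the Henkin chain consistent.\<close>

lemma finite_support: "\<Gamma> \<turnstile> p \<Longrightarrow> \<exists>\<Delta>. finite \<Delta> \<and> \<Delta> \<subseteq> \<Gamma> \<and> \<Delta> \<turnstile> p"
proof (induction rule: proves.induct)
  case (Assm p \<Gamma>)
  then show ?case by (intro exI[of _ "{p}"]) (simp add: proves.Assm)
next
  case (ImpI p \<Gamma> q)
  then obtain \<Delta> where \<Delta>: "finite \<Delta>" "\<Delta> \<subseteq> insert p \<Gamma>" "\<Delta> \<turnstile> q" by blast
  have "\<Delta> - {p} \<turnstile> Imp p q" by (rule proves.ImpI, rule weakening[OF \<Delta>(3)]) auto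
  then show ?case using \<Delta> by (intro exI[of _ "\<Delta> - {p}"]) auto
next
  case (ImpE \<Gamma> p q)
  then obtain \<Delta> \<Delta>' where \<Delta>: "finite \<Delta>" "\<Delta> \<subseteq> \<Gamma>" "\<Delta> \<turnstile> Imp p q" "finite \<Delta>'" "\<Delta>' \<subseteq> \<Gamma>" "\<Delta>' \<turnstile> p"
    by blast
  have "\<Delta> \<union> \<Delta>' \<turnstile> q"
    by (rule proves.ImpE[OF weakening[OF \<Delta>(3)] weakening[OF \<Delta>(6)]]) auto
  then show ?case using \<Delta> by (intro exI[of _ "\<Delta> \<union> \<Delta>'"]) auto
next
  case (Contr p \<Gamma>)
  then obtain \<Delta> where \<Delta>: "finite \<Delta>" "\<Delta> \<subseteq> insert (Neg p) \<Gamma>" "\<Delta> \<turnstile> Falsum" by blast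
  have "\<Delta> - {Neg p} \<turnstile> p" by (rule proves.Contr, rule weakening[OF \<Delta>(3)]) auto
  then show ?case using \<Delta> by (intro exI[of _ "\<Delta> - {Neg p}"]) auto
next
  case (AllNI \<Gamma> p)
  then obtain \<Delta> where "finite \<Delta>" "\<Delta> \<subseteq> \<Gamma>" "liftN ` \<Delta> \<turnstile> p" by (metis finite_subset_image)
  then show ?case by (intro exI[of _ \<Delta>]) (simp add: proves.AllNI)
next
  case (AllNE \<Gamma> p t)
  then show ?case by (elim exE) (rule exI, auto intro!: proves.AllNE)
next
  case (AllSI \<Gamma> p)
  then obtain \<Delta> where "finite \<Delta>" "\<Delta> \<subseteq> \<Gamma>" "liftS ` \<Delta> \<turnstile> p" by (metis finite_subset_image)
  then show ?case by (intro exI[of _ \<Delta>]) (simp add: proves.AllSI)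
next
  case (AllSE \<Gamma> p X)
  then show ?case by (elim exE) (rule exI, auto intro!: proves.AllSE)
next
  case (EqRefl \<Gamma> t)
  then show ?case by (intro exI[of _ "{}"]) (simp add: proves.EqRefl)
next
  case (EqSubst \<Gamma> s t p)
  then obtain \<Delta> \<Delta>' where \<Delta>: "finite \<Delta>" "\<Delta> \<subseteq> \<Gamma>" "\<Delta> \<turnstile> Eq s t" "finite \<Delta>'" "\<Delta>' \<subseteq> \<Gamma>" "\<Delta>' \<turnstile> instN s p"
    by blast
  have "\<Delta> \<union> \<Delta>' \<turnstile> instN t p"
    by (rule proves.EqSubst[OF weakening[OF \<Delta>(3)] weakening[OF \<Delta>(6)]]) auto
  then show ?case using \<Delta> by (intro exI[of _ "\<Delta> \<union> \<Delta>'"]) auto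
qed

section \<open>Substitution calculus and stability of provability under renaming\<close>

lemma tsubst_comp: "tsubst \<sigma> (tsubst \<tau> t) = tsubst (\<lambda>i. tsubst \<sigma> (\<tau> i)) t"
  by (induction t) auto

lemma substN_comp: "substN \<sigma> (substN \<tau> p) = substN (\<lambda>i. tsubst \<sigma> (\<tau> i)) p"
proof (induction p arbitrary: \<sigma> \<tau>)
  case (AllN p)
  have "(\<lambda>i. tsubst (case_nat (Var 0) (\<lambda>i. tlift (\<sigma> i))) (case i of 0 \<Rightarrow> Var 0 | Suc i \<Rightarrow> tlift (\<tau> i)))
     = case_nat (Var 0) (\<lambda>i. tlift (tsubst \<sigma> (\<tau> i)))"
    by (rule ext) (auto split: nat.split simp: tlift_def tsubst_comp)
  then show ?case by (simp add: AllN)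
qed (auto simp: tsubst_comp)

lemma substS_comp: "substS \<rho> (substS \<rho>' p) = substS (\<lambda>i. \<rho> (\<rho>' i)) p"
proof (induction p arbitrary: \<rho> \<rho>')
  case (AllS p)
  have "(\<lambda>i. (case_nat 0 (\<lambda>i. Suc (\<rho> i))) (case i of 0 \<Rightarrow> 0 | Suc i \<Rightarrow> Suc (\<rho>' i)))
     = case_nat 0 (\<lambda>i. Suc (\<rho> (\<rho>' i)))"
    by (rule ext) (auto split: nat.split)
  then show ?case by (simp add: AllS)
qed auto

lemma substN_substS: "substN \<sigma> (substS \<rho> p) = substS \<rho> (substN \<sigma> p)"
  by (induction p arbitrary: \<sigma> \<rho>) auto

lemma tsubst_cong: "(\<And>i. i < tbound t \<Longrightarrow> \<sigma> i = \<tau> i) \<Longrightarrow> tsubst \<sigma> t = tsubst \<tau> t"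
  by (induction t) auto

lemma substN_cong: "(\<And>i. i < boundN p \<Longrightarrow> \<sigma> i = \<tau> i) \<Longrightarrow> substN \<sigma> p = substN \<tau> p"
proof (induction p arbitrary: \<sigma> \<tau>)
  case (AllN p)
  have "substN (case_nat (Var 0) (\<lambda>i. tlift (\<sigma> i))) p = substN (case_nat (Var 0) (\<lambda>i. tlift (\<tau> i))) p"
    by (rule AllN.IH) (use AllN.prems in \<open>simp split: nat.split\<close>)
  then show ?case by simp
next
  case (Imp p q)
  have "substN \<sigma> p = substN \<tau> p" "substN \<sigma> q = substN \<tau> q"
    by (rule Imp.IH, use Imp.prems in simp)+
  then show ?case by simp
next
  case (AllS p)
  have "substN \<sigma> p = substN \<tau> p" by (rule AllS.IH) (use AllS.prems in simp)
  then show ?case by simp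
qed (auto intro!: tsubst_cong)

lemma substS_cong: "(\<And>i. i < boundS p \<Longrightarrow> \<rho> i = \<rho>' i) \<Longrightarrow> substS \<rho> p = substS \<rho>' p"
proof (induction p arbitrary: \<rho> \<rho>')
  case (AllS p)
  have "substS (case_nat 0 (\<lambda>i. Suc (\<rho> i))) p = substS (case_nat 0 (\<lambda>i. Suc (\<rho>' i))) p"
    by (rule AllS.IH) (use AllS.prems in \<open>simp split: nat.split\<close>)
  then show ?case by simp
next
  case (Imp p q)
  have "substS \<rho> p = substS \<rho>' p" "substS \<rho> q = substS \<rho>' q"
    by (rule Imp.IH, use Imp.prems in simp)+
  then show ?case by simp
next
  case (AllN p)
  have "substS \<rho> p = substS \<rho>' p" by (rule AllN.IH) (use AllN.prems in simp)
  then show ?case by simp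
qed auto

lemma tsubst_Var [simp]: "tsubst Var t = t"
  by (induction t) auto

lemma case_nat_Var: "case_nat (Var 0) (\<lambda>i. Var (Suc i)) = Var"
  by (rule ext) (auto split: nat.split)

lemma substN_Var [simp]: "substN Var p = p"
  by (induction p) (auto simp: tlift_def case_nat_Var)

lemma case_nat_Suc_id: "case_nat 0 Suc = (\<lambda>i. i)"
  by (rule ext) (auto split: nat.split)

lemma substS_id [simp]: "substS (\<lambda>i. i) p = p"
  by (induction p) (auto simp: case_nat_Suc_id)

lemma substN_liftN: "substN (case_nat (Var 0) (\<lambda>i. tlift (\<sigma> i))) (liftN p) = liftN (substN \<sigma> p)"
  by (simp add: liftN_def substN_comp tlift_def)

lemma substS_liftS: "substS (case_nat 0 (\<lambda>i. Suc (\<rho> i))) (liftS p) = liftS (substS \<rho> p)"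
  by (simp add: liftS_def substS_comp)

lemma substN_instN:
  "substN \<sigma> (instN t p) = instN (tsubst \<sigma> t) (substN (case_nat (Var 0) (\<lambda>i. tlift (\<sigma> i))) p)"
proof -
  have "(\<lambda>i. tsubst \<sigma> (case i of 0 \<Rightarrow> t | Suc i \<Rightarrow> Var i)) =
    (\<lambda>i. tsubst (case_nat (tsubst \<sigma> t) Var) (case i of 0 \<Rightarrow> Var 0 | Suc i \<Rightarrow> tlift (\<sigma> i)))"
    by (rule ext) (auto split: nat.split simp: tlift_def tsubst_comp)
  then show ?thesis by (simp add: instN_def substN_comp)
qed

lemma substS_instS:
  "substS \<rho> (instS X p) = instS (\<rho> X) (substS (case_nat 0 (\<lambda>i. Suc (\<rho> i))) p)"
proof -
  have "(\<lambda>i. \<rho> (case i of 0 \<Rightarrow> X | Suc i \<Rightarrow> i)) =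
    (\<lambda>i. (case_nat (\<rho> X) (\<lambda>i. i)) (case i of 0 \<Rightarrow> 0 | Suc i \<Rightarrow> Suc (\<rho> i)))"
    by (rule ext) (auto split: nat.split)
  then show ?thesis by (simp add: instS_def substS_comp)
qed

text \<open>Because derivations are stable under every substitution, ordinary free variables can
  play the part of new constants: a variable absent from the context can be moved to the position
  that is about to be bound.\<close>

lemma proves_substN: "\<Gamma> \<turnstile> p \<Longrightarrow> substN \<sigma> ` \<Gamma> \<turnstile> substN \<sigma> p"
proof (induction arbitrary: \<sigma> rule: proves.induct)
  case (Assm p \<Gamma>)
  then show ?case by (intro proves.Assm) simp
next
  case (ImpI p \<Gamma> q)
  from ImpI.IH[of \<sigma>] show ?case by (simp add: proves.ImpI)
next
  case (ImpE \<Gamma> p q)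
  show ?case by (rule proves.ImpE[OF ImpE.IH(1)[simplified] ImpE.IH(2)])
next
  case (Contr p \<Gamma>)
  from Contr.IH[of \<sigma>] show ?case by (simp add: proves.Contr)
next
  case (AllNI \<Gamma> p)
  have "liftN ` substN \<sigma> ` \<Gamma> = substN (case_nat (Var 0) (\<lambda>i. tlift (\<sigma> i))) ` liftN ` \<Gamma>"
    by (simp add: image_image substN_liftN)
  then show ?case using AllNI.IH[of "case_nat (Var 0) (\<lambda>i. tlift (\<sigma> i))"]
    by (simp add: proves.AllNI)
next
  case (AllSI \<Gamma> p)
  have "liftS ` substN \<sigma> ` \<Gamma> = substN \<sigma> ` liftS ` \<Gamma>"
    by (simp add: image_image liftS_def substN_substS)
  then show ?case using AllSI.IH[of \<sigma>] by (simp add: proves.AllSI)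
next
  case (AllNE \<Gamma> p t)
  from proves.AllNE[OF AllNE.IH[of \<sigma>, simplified]] show ?case by (simp add: substN_instN)
next
  case (AllSE \<Gamma> p X)
  from proves.AllSE[OF AllSE.IH[of \<sigma>, simplified]] show ?case
    by (simp add: instS_def substN_substS)
next
  case (EqRefl \<Gamma> t)
  show ?case by (simp add: proves.EqRefl)
next
  case (EqSubst \<Gamma> s t p)
  from proves.EqSubst[OF EqSubst.IH(1)[of \<sigma>, simplified] EqSubst.IH(2)[of \<sigma>, unfolded substN_instN]]
  show ?case by (simp add: substN_instN)
qed

lemma proves_substS: "\<Gamma> \<turnstile> p \<Longrightarrow> substS \<rho> ` \<Gamma> \<turnstile> substS \<rho> p"
proof (induction arbitrary: \<rho> rule: proves.induct)
  case (Assm p \<Gamma>)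
  then show ?case by (intro proves.Assm) simp
next
  case (ImpI p \<Gamma> q)
  from ImpI.IH[of \<rho>] show ?case by (simp add: proves.ImpI)
next
  case (ImpE \<Gamma> p q)
  show ?case by (rule proves.ImpE[OF ImpE.IH(1)[simplified] ImpE.IH(2)])
next
  case (Contr p \<Gamma>)
  from Contr.IH[of \<rho>] show ?case by (simp add: proves.Contr)
next
  case (AllNI \<Gamma> p)
  have "liftN ` substS \<rho> ` \<Gamma> = substS \<rho> ` liftN ` \<Gamma>"
    by (simp add: image_image liftN_def substN_substS)
  then show ?case using AllNI.IH[of \<rho>] by (simp add: proves.AllNI)
next
  case (AllSI \<Gamma> p)
  have "liftS ` substS \<rho> ` \<Gamma> = substS (case_nat 0 (\<lambda>i. Suc (\<rho> i))) ` liftS ` \<Gamma>"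
    by (simp add: image_image substS_liftS)
  then show ?case using AllSI.IH[of "case_nat 0 (\<lambda>i. Suc (\<rho> i))"] by (simp add: proves.AllSI)
next
  case (AllNE \<Gamma> p t)
  from proves.AllNE[OF AllNE.IH[of \<rho>, simplified]] show ?case
    by (simp add: instN_def substN_substS)
next
  case (AllSE \<Gamma> p X)
  from proves.AllSE[OF AllSE.IH[of \<rho>, simplified]] show ?case by (simp add: substS_instS)
next
  case (EqRefl \<Gamma> t)
  show ?case by (simp add: proves.EqRefl)
next
  case (EqSubst \<Gamma> s t p)
  have *: "substS \<rho> (instN t p) = instN t (substS \<rho> p)" for t by (simp add: instN_def substN_substS)
  from proves.EqSubst[OF EqSubst.IH(1)[of \<rho>, simplified] EqSubst.IH(2)[of \<rho>, unfolded *]]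
  show ?case by (simp add: *)
qed

instance tm :: countable by countable_datatype
instance fm :: countable by countable_datatype

section \<open>Maximal consistent sets with witnesses\<close>

definition consistent :: "fm set \<Rightarrow> bool" where
  "consistent \<Gamma> \<longleftrightarrow> \<not> \<Gamma> \<turnstile> Falsum"

text \<open>Renaming to even variables leaves the odd ones free to serve as Henkin constants.\<close>

definition spread :: "fm \<Rightarrow> fm" where
  "spread p = substS (\<lambda>X. 2 * X) (substN (\<lambda>i. Var (2 * i)) p)"

text \<open>Halving all indices undoes the renaming and preserves provability, so a contradiction
  could be renamed back.\<close>

lemma consistent_spread:
  assumes "consistent \<Gamma>" shows "consistent (spread ` \<Gamma>)"
proof -
  let ?g = "\<lambda>p. substS (\<lambda>i. i div 2) (substN (\<lambda>i. Var (i div 2)) p)"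
  have "?g (spread p) = p" for p
    by (simp add: spread_def substN_substS substN_comp substS_comp)
  then have "?g ` spread ` \<Gamma> = \<Gamma>" by (simp add: image_image)
  moreover have "spread ` \<Gamma> \<turnstile> Falsum \<Longrightarrow> ?g ` spread ` \<Gamma> \<turnstile> Falsum"
    using proves_substS[OF proves_substN[of "spread ` \<Gamma>" Falsum "\<lambda>i. Var (i div 2)"], of "\<lambda>i. i div 2"]
    by (simp add: image_image)
  ultimately show ?thesis using assms by (auto simp: consistent_def)
qed

text \<open>If the instance at a fresh \<open>c\<close> were derivable from \<open>G\<close>,
  renaming by \<open>\<sigma>\<close> would give a derivation of \<open>p\<close> from the lifted
  \<open>G\<close>, hence one of \<open>AllN p\<close>, although its negation belongs to the
  consistent set \<open>G\<close>.\<close>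

lemma witnessN:
  assumes "G = spread ` \<Gamma> \<union> F" "finite F" "G \<turnstile> Neg (AllN p) \<Longrightarrow> consistent G"
    and "Neg (AllN p) \<in> G"
  shows "\<exists>c. consistent (insert (Neg (instN (Var c) p)) G)"
proof -
  have con: "consistent G" using assms by (auto intro: proves.Assm)
  \<comment> \<open>Odd, so it avoids all variables of renamed formulas, and large enough to be free
    neither in \<open>p\<close> nor in any member of the finite set \<open>F\<close>.\<close>
  define c where "c = 2 * (boundN p + Max (insert 0 (boundN ` F))) + 1"
  have cF: "boundN q \<le> c" if "q \<in> F" for q
  proof -
    have "boundN q \<le> Max (insert 0 (boundN ` F))" using assms(2) that by (intro Max_ge) auto
    then show ?thesis by (simp add: c_def)
  qed
  \<comment> \<open>Sends \<open>c\<close> to the variable about to be bound and lifts all others;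
    on \<open>G\<close>, where \<open>c\<close> does not occur, it is therefore
    \<open>liftN\<close>.\<close>
  define \<sigma> where "\<sigma> i = (if i = c then Var 0 else Var (Suc i))" for i
  have "substN \<sigma> q = liftN q" if qG: "q \<in> G" for q
  proof (cases "q \<in> F")
    case True
    then show ?thesis unfolding liftN_def using cF[of q]
      by (intro substN_cong) (auto simp: \<sigma>_def)
  next
    case False
    then obtain r where q: "q = spread r" using qG assms(1) by auto
    have "\<sigma> (2 * i) = Var (Suc (2 * i))" for i
      unfolding \<sigma>_def c_def by (metis One_nat_def add.right_neutral add_Suc_right dvd_triv_left even_Suc)
    then show ?thesis unfolding q spread_def liftN_def by (simp add: substN_substS substN_comp)
  qed
  then have im: "substN \<sigma> ` G = liftN ` G" by (rule image_cong[OF refl])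
  have inst: "substN \<sigma> (instN (Var c) p) = p"
  proof -
    have "substN \<sigma> (instN (Var c) p) = substN Var p"
      unfolding instN_def substN_comp
      by (rule substN_cong) (auto simp: \<sigma>_def c_def split: nat.split)
    then show ?thesis by simp
  qed
  have "\<not> insert (Neg (instN (Var c) p)) G \<turnstile> Falsum"
  proof
    assume "insert (Neg (instN (Var c) p)) G \<turnstile> Falsum"
    then have "G \<turnstile> instN (Var c) p" by (rule proves.Contr)
    from proves_substN[OF this, of \<sigma>] have "G \<turnstile> AllN p"
      unfolding im inst by (rule proves.AllNI)
    then have "G \<turnstile> Falsum" by (rule proves.ImpE[OF proves.Assm[OF assms(4)]])
    then show False using con by (simp add: consistent_def)
  qed
  then show ?thesis by (auto simp: consistent_def)
qed

lemma witnessS: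
  assumes "G = spread ` \<Gamma> \<union> F" "finite F" "consistent G" "Neg (AllS p) \<in> G"
  shows "\<exists>c. consistent (insert (Neg (instS c p)) G)"
proof -
  define c where "c = 2 * (boundS p + Max (insert 0 (boundS ` F))) + 1"
  have cF: "boundS q \<le> c" if "q \<in> F" for q
  proof -
    have "boundS q \<le> Max (insert 0 (boundS ` F))" using assms(2) that by (intro Max_ge) auto
    then show ?thesis by (simp add: c_def)
  qed
  define \<rho> where "\<rho> i = (if i = c then 0 else Suc i)" for i
  have "substS \<rho> q = liftS q" if qG: "q \<in> G" for q
  proof (cases "q \<in> F")
    case True
    then show ?thesis unfolding liftS_def using cF[of q]
      by (intro substS_cong) (auto simp: \<rho>_def)
  next
    case False
    then obtain r where q: "q = spread r" using qG assms(1) by auto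
    have "\<rho> (2 * i) = Suc (2 * i)" for i
      unfolding \<rho>_def c_def by (metis One_nat_def add.right_neutral add_Suc_right dvd_triv_left even_Suc)
    then show ?thesis unfolding q spread_def liftS_def by (simp add: substS_comp)
  qed
  then have im: "substS \<rho> ` G = liftS ` G" by (rule image_cong[OF refl])
  have inst: "substS \<rho> (instS c p) = p"
  proof -
    have "substS \<rho> (instS c p) = substS (\<lambda>i. i) p"
      unfolding instS_def substS_comp
      by (rule substS_cong) (auto simp: \<rho>_def c_def split: nat.split)
    then show ?thesis by simp
  qed
  have "\<not> insert (Neg (instS c p)) G \<turnstile> Falsum"
  proof
    assume "insert (Neg (instS c p)) G \<turnstile> Falsum"
    then have "G \<turnstile> instS c p" by (rule proves.Contr)
    from proves_substS[OF this, of \<rho>] have "G \<turnstile> AllS p"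
      unfolding im inst by (rule proves.AllSI)
    then have "G \<turnstile> Falsum" by (rule proves.ImpE[OF proves.Assm[OF assms(4)]])
    then show False using assms(3) by (simp add: consistent_def)
  qed
  then show ?thesis by (auto simp: consistent_def)
qed

text \<open>A formula that cannot be added consistently has a derivable negation. A negated
  universal formula enters together with a refuting instance, so deciding formulas and supplying
  witnesses happen in one pass.\<close>

lemma henkin_step:
  assumes "finite F" "consistent (spread ` \<Gamma> \<union> F)"
  shows "\<exists>F'. finite F' \<and> F \<subseteq> F' \<and> consistent (spread ` \<Gamma> \<union> F') \<and>
    (q \<in> F' \<or> Neg q \<in> F' \<and>
      (\<forall>p. q = AllN p \<longrightarrow> (\<exists>c. Neg (instN (Var c) p) \<in> F')) \<and>
      (\<forall>p. q = AllS p \<longrightarrow> (\<exists>c. Neg (instS c p) \<in> F')))"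
proof (cases "consistent (spread ` \<Gamma> \<union> insert q F)")
  case True
  then show ?thesis using assms by (intro exI[of _ "insert q F"]) auto
next
  case False
  let ?G = "spread ` \<Gamma> \<union> insert (Neg q) F"
  have neg: "spread ` \<Gamma> \<union> F \<turnstile> Neg q"
    using False by (simp add: consistent_def proves.ImpI)
  have con: "consistent ?G"
    unfolding consistent_def
  proof
    assume "?G \<turnstile> Falsum"
    then have "spread ` \<Gamma> \<union> F \<turnstile> q" by (simp add: proves.Contr)
    then have "spread ` \<Gamma> \<union> F \<turnstile> Falsum" by (rule proves.ImpE[OF neg])
    then show False using assms(2) by (simp add: consistent_def)
  qed
  consider p where "q = AllN p" | p where "q = AllS p" | "\<nexists>p. q = AllN p \<or> q = AllS p" by auto
  then show ?thesis
  proof cases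
    case 1
    then obtain c where "consistent (insert (Neg (instN (Var c) p)) ?G)"
      using witnessN[of ?G \<Gamma> "insert (Neg q) F" p] con assms(1) by auto
    then show ?thesis using assms(1) 1
      by (intro exI[of _ "insert (Neg (instN (Var c) p)) (insert (Neg q) F)"]) auto
  next
    case 2
    then obtain c where "consistent (insert (Neg (instS c p)) ?G)"
      using witnessS[of ?G \<Gamma> "insert (Neg q) F" p] con assms(1) by auto
    then show ?thesis using assms(1) 2
      by (intro exI[of _ "insert (Neg (instS c p)) (insert (Neg q) F)"]) auto
  next
    case 3
    then show ?thesis using assms(1) con by (intro exI[of _ "insert (Neg q) F"]) auto
  qed
qed

text \<open>Formulas are countable, so a sequence of steps decides all of them. Each stage adds only
  finitely many formulas to the renamed theory, which is what leaves a fresh odd index for the next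
  witness.\<close>

lemma henkin_extension:
  assumes "consistent \<Gamma>"
  obtains H where "spread ` \<Gamma> \<subseteq> H" "consistent H" "\<And>q. q \<in> H \<or> Neg q \<in> H"
    "\<And>p. Neg (AllN p) \<in> H \<Longrightarrow> \<exists>c. Neg (instN (Var c) p) \<in> H"
    "\<And>p. Neg (AllS p) \<in> H \<Longrightarrow> \<exists>c. Neg (instS c p) \<in> H"
proof -
  let ?P = "\<lambda>F. finite F \<and> consistent (spread ` \<Gamma> \<union> F)"
  let ?R = "\<lambda>n F F'. F \<subseteq> F' \<and> (from_nat n \<in> F' \<or> Neg (from_nat n) \<in> F' \<and>
      (\<forall>p. from_nat n = AllN p \<longrightarrow> (\<exists>c. Neg (instN (Var c) p) \<in> F')) \<and>
      (\<forall>p. from_nat n = AllS p \<longrightarrow> (\<exists>c. Neg (instS c p) \<in> F')))"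
  have "\<exists>f. \<forall>n. ?P (f n) \<and> ?R n (f n) (f (Suc n))"
  proof (rule dependent_nat_choice)
    show "\<exists>F. ?P F" using consistent_spread[OF assms] by (intro exI[of _ "{}"]) simp
    show "\<exists>F'. ?P F' \<and> ?R n F F'" if "?P F" for n F
    proof -
      from that have "finite F" "consistent (spread ` \<Gamma> \<union> F)" by simp_all
      from henkin_step[OF this, of "from_nat n"] show ?thesis by (elim exE conjE) (intro exI conjI; assumption)
    qed
  qed
  then obtain f where f: "\<And>n. ?P (f n)" "\<And>n. ?R n (f n) (f (Suc n))" by (elim exE) metis
  have "f n \<subseteq> f (Suc n)" for n using f(2)[of n] by (elim conjE)
  then have mono: "f m \<subseteq> f n" if "m \<le> n" for m n
    using that lift_Suc_mono_le by metis
  define H where "H = (\<Union>n. spread ` \<Gamma> \<union> f n)"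
  have con: "consistent H"
    unfolding consistent_def
  proof
    assume "H \<turnstile> Falsum"
    then obtain \<Delta> where \<Delta>: "finite \<Delta>" "\<Delta> \<subseteq> H" "\<Delta> \<turnstile> Falsum" using finite_support by blast
    have "\<exists>n. \<Delta> \<subseteq> spread ` \<Gamma> \<union> f n" using \<Delta>(1,2)
    proof (induction \<Delta>)
      case (insert q \<Delta>)
      then obtain n where n: "\<Delta> \<subseteq> spread ` \<Gamma> \<union> f n" by auto
      obtain m where "q \<in> spread ` \<Gamma> \<union> f m" using insert.prems unfolding H_def by blast
      then have "insert q \<Delta> \<subseteq> spread ` \<Gamma> \<union> f (max m n)"
        using n mono[of n "max m n"] mono[of m "max m n"] by fastforce
      then show ?case by blast
    qed blast
    then show False using f(1) weakening[OF \<Delta>(3)] unfolding consistent_def by blast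
  qed
  have sub: "f n \<subseteq> H" for n unfolding H_def by blast
  have dec: "q \<in> H \<or> Neg q \<in> H \<and> (\<forall>p. q = AllN p \<longrightarrow> (\<exists>c. Neg (instN (Var c) p) \<in> H)) \<and>
      (\<forall>p. q = AllS p \<longrightarrow> (\<exists>c. Neg (instS c p) \<in> H))" for q
    using f(2)[of "to_nat q"] sub[of "Suc (to_nat q)"] unfolding from_nat_to_nat by blast
  have not_both: "\<not> (q \<in> H \<and> Neg q \<in> H)" for q
    using con unfolding consistent_def by (meson proves.ImpE proves.Assm)
  show thesis
  proof (rule that)
    show "spread ` \<Gamma> \<subseteq> H" unfolding H_def by blast
    show "consistent H" by (rule con)
    show "q \<in> H \<or> Neg q \<in> H" for q using dec[of q] by blast
    show "\<exists>c. Neg (instN (Var c) p) \<in> H" if "Neg (AllN p) \<in> H" for p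
      using dec[of "AllN p"] not_both[of "AllN p"] that by blast
    show "\<exists>c. Neg (instS c p) \<in> H" if "Neg (AllS p) \<in> H" for p
      using dec[of "AllS p"] not_both[of "AllS p"] that by blast
  qed
qed

text \<open>Measure for the truth lemma: instances of a quantified formula are not among its
  subformulas, but substitution leaves this depth unchanged.\<close>

primrec depth :: "fm \<Rightarrow> nat" where
  "depth Falsum = 0"
| "depth (Eq s t) = 0"
| "depth (Less s t) = 0"
| "depth (Mem t X) = 0"
| "depth (Imp p q) = Suc (max (depth p) (depth q))"
| "depth (AllN p) = Suc (depth p)"
| "depth (AllS p) = Suc (depth p)"

lemma depth_substN [simp]: "depth (substN \<sigma> p) = depth p"
  by (induction p arbitrary: \<sigma>) auto

lemma depth_substS [simp]: "depth (substS \<rho> p) = depth p"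
  by (induction p arbitrary: \<rho>) auto

lemma instN_tlift [simp]: "tsubst (case_nat t Var) (tlift s) = s"
  by (simp add: tlift_def tsubst_comp)

section \<open>The canonical model of a Henkin set\<close>

locale henkin =
  fixes H :: "fm set"
  assumes con: "consistent H"
    and complete: "q \<in> H \<or> Neg q \<in> H"
    and witN: "Neg (AllN p) \<in> H \<Longrightarrow> \<exists>c. Neg (instN (Var c) p) \<in> H"
    and witS: "Neg (AllS p) \<in> H \<Longrightarrow> \<exists>c. Neg (instS c p) \<in> H"
begin

lemma not_both: "q \<in> H \<Longrightarrow> Neg q \<notin> H"
  using con proves.ImpE[OF proves.Assm proves.Assm, of q Falsum H] unfolding consistent_def by blast

lemma closed: "H \<turnstile> q \<Longrightarrow> q \<in> H"
  using complete[of q] con proves.ImpE[OF proves.Assm, of q Falsum H] unfolding consistent_def by blast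

lemma Neg_iff: "Neg q \<in> H \<longleftrightarrow> q \<notin> H"
  using complete not_both by blast

lemma Falsum_iff: "Falsum \<notin> H"
  using con proves.Assm[of Falsum H] unfolding consistent_def by blast

lemma Imp_iff: "Imp p q \<in> H \<longleftrightarrow> (p \<in> H \<longrightarrow> q \<in> H)"
proof
  assume "p \<in> H \<longrightarrow> q \<in> H"
  then consider "q \<in> H" | "Neg p \<in> H" using Neg_iff by blast
  then show "Imp p q \<in> H"
  proof cases
    case 1
    then show ?thesis by (simp add: closed proves.ImpI proves.Assm)
  next
    case 2
    have "insert (Neg q) (insert p H) \<turnstile> Falsum"
      by (rule proves.ImpE[of _ p]; rule proves.Assm) (use 2 in simp_all)
    then show ?thesis by (intro closed proves.ImpI) (rule proves.Contr)
  qed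
next
  assume "Imp p q \<in> H"
  then show "p \<in> H \<longrightarrow> q \<in> H" using closed[OF proves.ImpE[OF proves.Assm proves.Assm]] by blast
qed

lemma AllN_iff: "AllN p \<in> H \<longleftrightarrow> (\<forall>t. instN t p \<in> H)"
proof
  assume "\<forall>t. instN t p \<in> H"
  then show "AllN p \<in> H" using witN[of p] Neg_iff by blast
next
  assume "AllN p \<in> H"
  then show "\<forall>t. instN t p \<in> H" using closed[OF proves.AllNE[OF proves.Assm]] by blast
qed

lemma AllS_iff: "AllS p \<in> H \<longleftrightarrow> (\<forall>X. instS X p \<in> H)"
proof
  assume "\<forall>X. instS X p \<in> H"
  then show "AllS p \<in> H" using witS[of p] Neg_iff by blast
next
  assume "AllS p \<in> H"
  then show "\<forall>X. instS X p \<in> H" using closed[OF proves.AllSE[OF proves.Assm]] by blast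
qed

lemma Eq_refl: "Eq t t \<in> H"
  by (rule closed[OF proves.EqRefl])

lemma Eq_subst: "Eq s t \<in> H \<Longrightarrow> instN s p \<in> H \<Longrightarrow> instN t p \<in> H"
  using closed[OF proves.EqSubst[OF proves.Assm proves.Assm]] by blast

lemma Eq_sym: "Eq s t \<in> H \<Longrightarrow> Eq t s \<in> H"
  using Eq_subst[of s t "Eq (Var 0) (tlift s)"] Eq_refl by (simp add: instN_def)

lemma Eq_trans: "Eq s t \<in> H \<Longrightarrow> Eq t u \<in> H \<Longrightarrow> Eq s u \<in> H"
  using Eq_subst[of t u "Eq (tlift s) (Var 0)"] by (simp add: instN_def)

lemma Eq_tsubst: "Eq s t \<in> H \<Longrightarrow> Eq (tsubst (case_nat s Var) u) (tsubst (case_nat t Var) u) \<in> H"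
  using Eq_subst[of s t "Eq (tlift (tsubst (case_nat s Var) u)) u"] Eq_refl by (simp add: instN_def)

lemma Eq_Add: "Eq s s' \<in> H \<Longrightarrow> Eq t t' \<in> H \<Longrightarrow> Eq (Add s t) (Add s' t') \<in> H"
  using Eq_tsubst[of s s' "Add (Var 0) (tlift t)"] Eq_tsubst[of t t' "Add (tlift s') (Var 0)"]
  by (simp add: Eq_trans)

lemma Eq_Mul: "Eq s s' \<in> H \<Longrightarrow> Eq t t' \<in> H \<Longrightarrow> Eq (Mul s t) (Mul s' t') \<in> H"
  using Eq_tsubst[of s s' "Mul (Var 0) (tlift t)"] Eq_tsubst[of t t' "Mul (tlift s') (Var 0)"]
  by (simp add: Eq_trans)

lemma Less_cong: "Eq s s' \<in> H \<Longrightarrow> Eq t t' \<in> H \<Longrightarrow> Less s t \<in> H \<Longrightarrow> Less s' t' \<in> H"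
  using Eq_subst[of s s' "Less (Var 0) (tlift t)"] Eq_subst[of t t' "Less (tlift s') (Var 0)"]
  by (simp add: instN_def)

lemma Mem_cong: "Eq s s' \<in> H \<Longrightarrow> Mem s X \<in> H \<Longrightarrow> Mem s' X \<in> H"
  using Eq_subst[of s s' "Mem (Var 0) X"] by (simp add: instN_def)

text \<open>The least code in the class of terms equated by \<open>H\<close>. With numbers in place
  of classes every countermodel has the one type \<open>nat str\<close>, on which the choice of a
  global countermodel relies.\<close>

definition rep :: "tm \<Rightarrow> nat" where
  "rep t = (LEAST n. Eq t (from_nat n) \<in> H)"

lemma rep: "Eq t (from_nat (rep t)) \<in> H"
  unfolding rep_def by (rule LeastI[of _ "to_nat t"]) (simp add: Eq_refl)

lemma rep_eq_iff: "rep s = rep t \<longleftrightarrow> Eq s t \<in> H"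
proof
  assume "rep s = rep t"
  then show "Eq s t \<in> H" using rep[of s] rep[of t] by (metis Eq_sym Eq_trans)
next
  assume "Eq s t \<in> H"
  then have "Eq s u \<in> H \<longleftrightarrow> Eq t u \<in> H" for u by (metis Eq_sym Eq_trans)
  then show "rep s = rep t" by (simp add: rep_def)
qed

definition canonical :: "nat str" where
  "canonical = \<lparr>universe = range rep, zeroS = rep Zero, oneS = rep One,
     plusS = (\<lambda>x y. rep (Add (from_nat x) (from_nat y))),
     timesS = (\<lambda>x y. rep (Mul (from_nat x) (from_nat y))),
     lessS = (\<lambda>x y. Less (from_nat x) (from_nat y) \<in> H),
     sets = range (\<lambda>X. {n. Mem (from_nat n) X \<in> H})\<rparr>"

lemma wf_canonical: "wf_str canonical"
  by (auto simp: wf_str_def canonical_def)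

lemma tval_canonical: "tval canonical (\<lambda>i. rep (Var i)) t = rep t"
proof (induction t)
  case (Add s t)
  then show ?case using Eq_Add[OF Eq_sym[OF rep[of s]] Eq_sym[OF rep[of t]]]
    by (simp add: canonical_def rep_eq_iff)
next
  case (Mul s t)
  then show ?case using Eq_Mul[OF Eq_sym[OF rep[of s]] Eq_sym[OF rep[of t]]]
    by (simp add: canonical_def rep_eq_iff)
qed (simp_all add: canonical_def)

text \<open>Every element of the universe is the value of a term and every set is named by a set
  variable, so quantifiers reduce to their instances.\<close>

lemma truth: "eval canonical (\<lambda>i. rep (Var i)) (\<lambda>X. {n. Mem (from_nat n) X \<in> H}) p \<longleftrightarrow> p \<in> H"
proof (induction p rule: measure_induct_rule[of depth])
  case (less p)
  let ?e = "\<lambda>i. rep (Var i)" and ?S = "\<lambda>X. {n. Mem (from_nat n) X \<in> H}"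
  show ?case
  proof (cases p)
    case (Less s t)
    then show ?thesis
      using Less_cong[OF rep[of s] rep[of t]]
        Less_cong[OF Eq_sym[OF rep[of s]] Eq_sym[OF rep[of t]]]
      by (simp add: tval_canonical) (auto simp: canonical_def)
  next
    case (Mem t X)
    then show ?thesis
      using Mem_cong[OF rep[of t]] Mem_cong[OF Eq_sym[OF rep[of t]]] by (auto simp: tval_canonical)
  next
    case (Imp q r)
    then show ?thesis using less[of q] less[of r] by (simp add: Imp_iff)
  next
    case (AllN q)
    have "eval canonical (case_nat (rep t) ?e) ?S q \<longleftrightarrow> instN t q \<in> H" for t
      using less[of "instN t q"] AllN by (simp add: eval_instN tval_canonical) (simp add: instN_def)
    then show ?thesis using AllN by (simp add: AllN_iff) (auto simp: canonical_def)
  next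
    case (AllS q)
    have "eval canonical ?e (case_nat (?S X) ?S) q \<longleftrightarrow> instS X q \<in> H" for X
      using less[of "instS X q"] AllS by (simp add: eval_instS) (simp add: instS_def)
    then show ?thesis using AllS by (simp add: AllS_iff) (auto simp: canonical_def)
  qed (simp_all add: tval_canonical rep_eq_iff Falsum_iff)
qed

end

theorem completeness:
  assumes "\<not> \<Gamma> \<turnstile> p"
  obtains M :: "nat str" and e S where "wf_str M" "\<And>i. e i \<in> universe M" "\<And>X. S X \<in> sets M"
    "\<And>q. q \<in> \<Gamma> \<Longrightarrow> eval M e S q" "\<not> eval M e S p"
proof -
  have "consistent (insert (Neg p) \<Gamma>)" using assms proves.Contr unfolding consistent_def by blast
  then obtain H where
    H: "spread ` insert (Neg p) \<Gamma> \<subseteq> H" and hen: "henkin H"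
    using henkin_extension henkin.intro by metis
  interpret henkin H by (rule hen)
  let ?e = "\<lambda>i. rep (Var i)" and ?S = "\<lambda>X. {n. Mem (from_nat n) X \<in> H}"
  \<comment> \<open>The odd variables served as witnesses; the original free variables sit at the
    even indices.\<close>
  have *: "eval canonical (\<lambda>i. ?e (2 * i)) (\<lambda>X. ?S (2 * X)) q \<longleftrightarrow> spread q \<in> H" for q
    using truth[of "spread q"] by (simp add: spread_def eval_substN eval_substS tval_canonical)
  show thesis
  proof (rule that[of canonical "\<lambda>i. ?e (2 * i)" "\<lambda>X. ?S (2 * X)"])
    show "\<not> eval canonical (\<lambda>i. ?e (2 * i)) (\<lambda>X. ?S (2 * X)) p"
    proof
      assume "eval canonical (\<lambda>i. ?e (2 * i)) (\<lambda>X. ?S (2 * X)) p"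
      moreover have "eval canonical (\<lambda>i. ?e (2 * i)) (\<lambda>X. ?S (2 * X)) (Neg p)"
        using H by (subst *) (rule subsetD, assumption, blast)
      ultimately show False by simp
    qed
    show "eval canonical (\<lambda>i. ?e (2 * i)) (\<lambda>X. ?S (2 * X)) q" if "q \<in> \<Gamma>" for q
      using H that by (subst *) (rule subsetD, assumption, blast)
    show "wf_str canonical" by (rule wf_canonical)
    show "?e (2 * i) \<in> universe canonical" for i by (simp add: canonical_def)
    show "?S (2 * X) \<in> sets canonical" for X by (simp add: canonical_def)
  qed
qed

section \<open>Bounded definability with parameters\<close>

text \<open>Environments are split in two: even indices carry the arguments, odd indices the parameters.\<close>

definition mix :: "(nat \<Rightarrow> 'a) \<Rightarrow> (nat \<Rightarrow> 'a) \<Rightarrow> nat \<Rightarrow> 'a" where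
  "mix e c i = (if even i then e (i div 2) else c (i div 2))"

lemma mix_simps [simp]: "mix e c (2 * i) = e i" "mix e c (Suc (2 * i)) = c i" "mix e c 0 = e 0"
  by (auto simp: mix_def)

lemma mix_in: "(\<And>i. e i \<in> A) \<Longrightarrow> (\<And>i. c i \<in> A) \<Longrightarrow> mix e c i \<in> A"
  by (simp add: mix_def)

definition trm :: "('a, 'm) str_scheme \<Rightarrow> ((nat \<Rightarrow> 'a) \<Rightarrow> 'a) \<Rightarrow> bool" where
  "trm M t \<longleftrightarrow> (\<exists>s c. (\<forall>i. c i \<in> universe M) \<and>
     (\<forall>e. (\<forall>i. e i \<in> universe M) \<longrightarrow> t e = tval M (mix e c) s))"

text \<open>Definability by a bounded formula with parameters, as a property of predicates on
  environments inside the universe. Closure rules then replace the writing of object formulas, and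
  the axiom schemes can be applied to predicates of the metalanguage.\<close>

definition dlt :: "('a, 'm) str_scheme \<Rightarrow> ((nat \<Rightarrow> 'a) \<Rightarrow> bool) \<Rightarrow> bool" where
  "dlt M P \<longleftrightarrow> (\<exists>p c S. delta0 p \<and> (\<forall>i. c i \<in> universe M) \<and> (\<forall>X. S X \<in> sets M) \<and>
     (\<forall>e. (\<forall>i. e i \<in> universe M) \<longrightarrow> (P e \<longleftrightarrow> eval M (mix e c) S p)))"

text \<open>\<open>c j\<close> for all \<open>j\<close> packed into one sequence of parameters, and the matching renaming.\<close>

definition pack :: "(nat \<Rightarrow> nat \<Rightarrow> 'a) \<Rightarrow> nat \<Rightarrow> 'a" where
  "pack c n = (case prod_decode n of (j, i) \<Rightarrow> c j i)"

definition ren :: "nat \<Rightarrow> nat \<Rightarrow> tm" where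
  "ren j i = (if even i then Var i else Var (Suc (2 * prod_encode (j, i div 2))))"

lemma tval_ren: "tval M (mix e (pack c)) (ren j i) = mix e (c j) i"
  by (auto simp: ren_def pack_def mix_def)

lemma pack_in: "(\<And>j i. c j i \<in> A) \<Longrightarrow> pack c n \<in> A"
  by (simp add: pack_def split: prod.split)

lemma delta0_substN: "delta0 p \<Longrightarrow> delta0 (substN \<sigma> p)"
proof (induction arbitrary: \<sigma> rule: delta0.induct)
  case (6 p t)
  have "tsubst (case_nat (Var 0) (\<lambda>i. tlift (\<sigma> i))) (tlift t) = tlift (tsubst \<sigma> t)"
    by (simp add: tlift_def tsubst_comp)
  then show ?case using 6 by (simp add: delta0.intros)
qed (simp_all add: delta0.intros)

lemma delta0_substS: "delta0 p \<Longrightarrow> delta0 (substS \<rho> p)"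
  by (induction arbitrary: \<rho> rule: delta0.induct) (simp_all add: delta0.intros)

section \<open>Closure properties of bounded definability\<close>

locale model =
  fixes M :: "('a, 'm) str_scheme"
  assumes wf: "wf_str M"
begin

lemma zero_in [simp]: "zeroS M \<in> universe M"
  and one_in [simp]: "oneS M \<in> universe M"
  and plus_in [simp]: "x \<in> universe M \<Longrightarrow> y \<in> universe M \<Longrightarrow> plusS M x y \<in> universe M"
  and times_in [simp]: "x \<in> universe M \<Longrightarrow> y \<in> universe M \<Longrightarrow> timesS M x y \<in> universe M"
  using wf by (auto simp: wf_str_def)

lemma some_set: "\<exists>Y. Y \<in> sets M"
  using wf by (auto simp: wf_str_def)

lemma trm_in:
  assumes "trm M t" "\<And>i. e i \<in> universe M"
  shows "t e \<in> universe M"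
proof -
  from assms obtain s c where c: "\<forall>i. c i \<in> universe M" "t e = tval M (mix e c) s"
    unfolding trm_def by blast
  have "tval M (mix e c) s \<in> universe M"
    by (rule tval_in[OF wf], rule mix_in) (use c assms in simp_all)
  then show ?thesis using c by simp
qed

lemma trm_var [intro!]: "trm M (\<lambda>e. e i)"
  unfolding trm_def by (intro exI[of _ "Var (2 * i)"] exI[of _ "\<lambda>_. zeroS M"]) simp

lemma trm_const: "a \<in> universe M \<Longrightarrow> trm M (\<lambda>e. a)"
  unfolding trm_def by (intro exI[of _ "Var 1"] exI[of _ "\<lambda>_. a"]) (simp add: mix_def)

lemma trm_pair:
  assumes "trm M t" "trm M u"
  obtains s r c where "\<forall>i. c i \<in> universe M"
    "\<forall>e. (\<forall>i. e i \<in> universe M) \<longrightarrow> t e = tval M (mix e c) s"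
    "\<forall>e. (\<forall>i. e i \<in> universe M) \<longrightarrow> u e = tval M (mix e c) r"
proof -
  from assms(1) obtain s c where s: "\<forall>i. c i \<in> universe M"
    "\<forall>e. (\<forall>i. e i \<in> universe M) \<longrightarrow> t e = tval M (mix e c) s"
    unfolding trm_def by blast
  from assms(2) obtain r d where r: "\<forall>i. d i \<in> universe M"
    "\<forall>e. (\<forall>i. e i \<in> universe M) \<longrightarrow> u e = tval M (mix e d) r"
    unfolding trm_def by blast
  show thesis
  proof (rule that; intro allI impI)
    show "pack (case_nat c (\<lambda>_. d)) i \<in> universe M" for i
      by (rule pack_in) (use s r in \<open>simp split: nat.split\<close>)
    show "t e = tval M (mix e (pack (case_nat c (\<lambda>_. d)))) (tsubst (ren 0) s)"
      if "\<forall>i. e i \<in> universe M" for e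
      using s that by (simp add: tval_tsubst tval_ren)
    show "u e = tval M (mix e (pack (case_nat c (\<lambda>_. d)))) (tsubst (ren 1) r)"
      if "\<forall>i. e i \<in> universe M" for e
      using r that by (simp add: tval_tsubst tval_ren)
  qed
qed

lemma trm_add: "trm M t \<Longrightarrow> trm M u \<Longrightarrow> trm M (\<lambda>e. plusS M (t e) (u e))"
proof (erule (1) trm_pair)
  fix s r c
  assume "\<forall>i. c i \<in> universe M"
    "\<forall>e. (\<forall>i. e i \<in> universe M) \<longrightarrow> t e = tval M (mix e c) s"
    "\<forall>e. (\<forall>i. e i \<in> universe M) \<longrightarrow> u e = tval M (mix e c) r"
  then show ?thesis unfolding trm_def by (intro exI[of _ "Add s r"] exI[of _ c]) simp
qed

lemma trm_mul: "trm M t \<Longrightarrow> trm M u \<Longrightarrow> trm M (\<lambda>e. timesS M (t e) (u e))"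
proof (erule (1) trm_pair)
  fix s r c
  assume "\<forall>i. c i \<in> universe M"
    "\<forall>e. (\<forall>i. e i \<in> universe M) \<longrightarrow> t e = tval M (mix e c) s"
    "\<forall>e. (\<forall>i. e i \<in> universe M) \<longrightarrow> u e = tval M (mix e c) r"
  then show ?thesis unfolding trm_def by (intro exI[of _ "Mul s r"] exI[of _ c]) simp
qed

lemma dlt_atom:
  assumes "trm M t" "trm M u" "\<And>s r. delta0 (A s r)" "Y \<in> sets M"
    and A: "\<And>s r e c. eval M (mix e c) (\<lambda>_. Y) (A s r) \<longleftrightarrow> R (tval M (mix e c) s) (tval M (mix e c) r)"
  shows "dlt M (\<lambda>e. R (t e) (u e))"
proof -
  obtain s r c where c: "\<forall>i. c i \<in> universe M"
    and s: "\<forall>e. (\<forall>i. e i \<in> universe M) \<longrightarrow> t e = tval M (mix e c) s"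
    and r: "\<forall>e. (\<forall>i. e i \<in> universe M) \<longrightarrow> u e = tval M (mix e c) r"
    using trm_pair[OF assms(1,2)] by metis
  show ?thesis unfolding dlt_def
  proof (intro exI conjI allI impI)
    show "delta0 (A s r)" by fact
    show "Y \<in> sets M" by fact
    show "c i \<in> universe M" for i using c by blast
    show "R (t e) (u e) \<longleftrightarrow> eval M (mix e c) (\<lambda>_. Y) (A s r)" if "\<forall>i. e i \<in> universe M" for e
      using A s r that by simp
  qed
qed

lemma dlt_eq:
  assumes "trm M t" "trm M u" shows "dlt M (\<lambda>e. t e = u e)"
proof -
  obtain Y where "Y \<in> sets M" using some_set by blast
  with assms show ?thesis by (rule_tac dlt_atom[where A = Eq]) (simp_all add: delta0.intros)
qed

lemma dlt_lessS:
  assumes "trm M t" "trm M u" shows "dlt M (\<lambda>e. lessS M (t e) (u e))"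
proof -
  obtain Y where "Y \<in> sets M" using some_set by blast
  with assms show ?thesis by (rule_tac dlt_atom[where A = Less]) (simp_all add: delta0.intros)
qed

lemma dlt_mem: "trm M t \<Longrightarrow> Y \<in> sets M \<Longrightarrow> dlt M (\<lambda>e. t e \<in> Y)"
  by (rule dlt_atom[of t t "\<lambda>s r. Mem s 0" Y "\<lambda>x y. x \<in> Y"]) (simp_all add: delta0.intros)

lemma dlt_False: "dlt M (\<lambda>e. False)"
proof -
  obtain Y where "Y \<in> sets M" using some_set by blast
  then show ?thesis unfolding dlt_def
    by (intro exI[of _ Falsum] exI[of _ "\<lambda>_. zeroS M"] exI[of _ "\<lambda>_. Y"]) (auto intro: delta0.intros)
qed

lemma dlt_imp:
  assumes "dlt M P" "dlt M Q"
  shows "dlt M (\<lambda>e. P e \<longrightarrow> Q e)"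
proof -
  from assms(1) obtain p c S where p: "delta0 p" "\<forall>i. c i \<in> universe M" "\<forall>X. S X \<in> sets M"
    "\<forall>e. (\<forall>i. e i \<in> universe M) \<longrightarrow> (P e \<longleftrightarrow> eval M (mix e c) S p)" unfolding dlt_def by blast
  from assms(2) obtain q d T where q: "delta0 q" "\<forall>i. d i \<in> universe M" "\<forall>X. T X \<in> sets M"
    "\<forall>e. (\<forall>i. e i \<in> universe M) \<longrightarrow> (Q e \<longleftrightarrow> eval M (mix e d) T q)" unfolding dlt_def by blast
  let ?c = "pack (case_nat c (\<lambda>_. d))"
  \<comment> \<open>Set parameters are merged like number parameters: those of \<open>p\<close> move
    to the even indices, those of \<open>q\<close> to the odd ones.\<close>
  show ?thesis unfolding dlt_def
  proof (intro exI[of _ "Imp (substS ((*) 2) (substN (ren 0) p)) (substS (\<lambda>X. Suc (2 * X)) (substN (ren 1) q))"]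
      exI[of _ ?c] exI[of _ "mix S T"] conjI allI impI)
    show "?c i \<in> universe M" for i
      by (rule pack_in) (use p q in \<open>simp split: nat.split\<close>)
    show "mix S T X \<in> sets M" for X by (rule mix_in) (use p q in simp_all)
    show "delta0 (Imp (substS ((*) 2) (substN (ren 0) p)) (substS (\<lambda>X. Suc (2 * X)) (substN (ren 1) q)))"
      using p(1) q(1) by (intro delta0.intros delta0_substN delta0_substS)
    show "(P e \<longrightarrow> Q e) \<longleftrightarrow> eval M (mix e ?c) (mix S T)
        (Imp (substS ((*) 2) (substN (ren 0) p)) (substS (\<lambda>X. Suc (2 * X)) (substN (ren 1) q)))"
      if "\<forall>i. e i \<in> universe M" for e
      using p(4) q(4) that by (simp add: eval_substN eval_substS tval_ren)
  qed
qed

lemma dlt_ball: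
  assumes "trm M t" "dlt M (\<lambda>e. Q (e 0) (\<lambda>i. e (Suc i)))"
  shows "dlt M (\<lambda>e. \<forall>z\<in>universe M. lessS M z (t e) \<longrightarrow> Q z e)"
proof -
  from assms(1) obtain s c where s: "\<forall>i. c i \<in> universe M"
    "\<forall>e. (\<forall>i. e i \<in> universe M) \<longrightarrow> t e = tval M (mix e c) s"
    unfolding trm_def by blast
  from assms(2) obtain q d S where q: "delta0 q" "\<forall>i. d i \<in> universe M" "\<forall>X. S X \<in> sets M"
    "\<And>e. (\<forall>i. e i \<in> universe M) \<Longrightarrow> Q (e 0) (\<lambda>i. e (Suc i)) \<longleftrightarrow> eval M (mix e d) S q"
    unfolding dlt_def by blast
  let ?c = "pack (case_nat c (\<lambda>_. d))"
  \<comment> \<open>Argument 0 of the matrix is the bound variable. Argument \<open>j + 1\<close>,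
    at index \<open>2 * j + 2\<close>, becomes argument \<open>j\<close> of the outer environment,
    found at \<open>2 * j + 1\<close> below the binder. Parameters keep their place in
    \<open>?c\<close>, shifted by one for the binder.\<close>
  define \<sigma> where "\<sigma> i = (if i = 0 then Var 0 else if even i then Var (i - 1)
    else Var (Suc (Suc (2 * prod_encode (1, i div 2)))))" for i
  have \<sigma>: "tval M (case_nat z (mix e ?c)) (\<sigma> i) = mix (case_nat z e) d i" for z e i
  proof (cases i rule: nat.exhaust)
    case (Suc j)
    show ?thesis
    proof (cases "even j")
      case True
      then show ?thesis using Suc by (auto simp: \<sigma>_def mix_def pack_def elim!: evenE)
    next
      case False
      then obtain k where "j = Suc (2 * k)" by (metis Suc_eq_plus1 oddE)
      then show ?thesis using Suc by (auto simp: \<sigma>_def mix_def)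
    qed
  qed (auto simp: \<sigma>_def)
  have c: "?c i \<in> universe M" for i using s q by (auto intro!: pack_in split: nat.split)
  show ?thesis unfolding dlt_def
  proof (intro exI[of _ "AllN (Imp (Less (Var 0) (tlift (tsubst (ren 0) s))) (substN \<sigma> q))"]
      exI[of _ ?c] exI[of _ S] conjI allI impI)
    fix e :: "nat \<Rightarrow> 'a" assume e: "\<forall>i. e i \<in> universe M"
    have "eval M (case_nat z (mix e ?c)) S (substN \<sigma> q) \<longleftrightarrow> Q z e" if "z \<in> universe M" for z
      using q(4)[of "case_nat z e"] e that by (auto simp: eval_substN \<sigma> intro: case_nat_in)
    then show "(\<forall>z\<in>universe M. lessS M z (t e) \<longrightarrow> Q z e) \<longleftrightarrow>
      eval M (mix e ?c) S (AllN (Imp (Less (Var 0) (tlift (tsubst (ren 0) s))) (substN \<sigma> q)))"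
      using s e by (simp add: tval_tsubst tval_ren)
  qed (use q c in \<open>auto intro!: delta0.intros delta0_substN\<close>)
qed

lemma dlt_subst:
  assumes "dlt M P" "\<And>i. trm M (\<tau> i)"
  shows "dlt M (\<lambda>e. P (\<lambda>i. \<tau> i e))"
proof -
  from assms(1) obtain p c S where p: "delta0 p" "\<forall>i. c i \<in> universe M" "\<forall>X. S X \<in> sets M"
    "\<And>e. (\<forall>i. e i \<in> universe M) \<Longrightarrow> (P e \<longleftrightarrow> eval M (mix e c) S p)" unfolding dlt_def by blast
  from assms(2) obtain s d where s: "\<And>i j. d i j \<in> universe M"
    "\<And>i e. (\<forall>i. e i \<in> universe M) \<Longrightarrow> \<tau> i e = tval M (mix e (d i)) (s i)"
    unfolding trm_def by metis
  let ?c = "pack (case_nat c d)"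
  define \<sigma> where "\<sigma> i = (if even i then tsubst (ren (Suc (i div 2))) (s (i div 2)) else ren 0 i)" for i
  show ?thesis unfolding dlt_def
  proof (intro exI[of _ "substN \<sigma> p"] exI[of _ ?c] exI[of _ S] conjI allI impI)
    show "?c i \<in> universe M" for i using p s by (auto intro!: pack_in split: nat.split)
    fix e :: "nat \<Rightarrow> 'a" assume e: "\<forall>i. e i \<in> universe M"
    have "tval M (mix e ?c) (\<sigma> i) = mix (\<lambda>i. \<tau> i e) c i" for i
      unfolding mix_def[of "\<lambda>i. \<tau> i e"] using s e
      by (cases "even i") (simp_all add: \<sigma>_def tval_tsubst tval_ren mix_def[of e c i])
    moreover have "\<forall>i. \<tau> i e \<in> universe M" using assms(2) e trm_in by blast
    ultimately show "P (\<lambda>i. \<tau> i e) \<longleftrightarrow> eval M (mix e ?c) S (substN \<sigma> p)"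
      using p(4)[of "\<lambda>i. \<tau> i e"] by (simp add: eval_substN)
  qed (use p in \<open>auto intro!: delta0_substN\<close>)
qed

lemma dlt_cong:
  assumes "dlt M P" "\<And>e. (\<And>i. e i \<in> universe M) \<Longrightarrow> P e \<longleftrightarrow> Q e"
  shows "dlt M Q"
proof -
  from assms(1) obtain p c S where "delta0 p" "\<forall>i. c i \<in> universe M" "\<forall>X. S X \<in> sets M"
    "\<And>e. (\<forall>i. e i \<in> universe M) \<Longrightarrow> (P e \<longleftrightarrow> eval M (mix e c) S p)" unfolding dlt_def by blast
  then show ?thesis unfolding dlt_def
    by (intro exI[of _ p] exI[of _ c] exI[of _ S]) (simp add: assms(2)[symmetric])
qed

lemma dlt_not: "dlt M P \<Longrightarrow> dlt M (\<lambda>e. \<not> P e)"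
  using dlt_imp[OF _ dlt_False, of P] by simp

lemma dlt_const: "dlt M (\<lambda>e. Q)"
  using dlt_False dlt_not[OF dlt_False] by (cases Q) simp_all

lemma dlt_and: "dlt M P \<Longrightarrow> dlt M Q \<Longrightarrow> dlt M (\<lambda>e. P e \<and> Q e)"
  using dlt_not[OF dlt_imp[OF _ dlt_not], of P Q] by simp

lemma dlt_or: "dlt M P \<Longrightarrow> dlt M Q \<Longrightarrow> dlt M (\<lambda>e. P e \<or> Q e)"
  using dlt_imp[OF dlt_not, of P Q] by (simp add: disj_imp)

lemma dlt_iff: "dlt M P \<Longrightarrow> dlt M Q \<Longrightarrow> dlt M (\<lambda>e. P e \<longleftrightarrow> Q e)"
  using dlt_and[OF dlt_imp dlt_imp, of P Q Q P] by (simp add: iff_conv_conj_imp)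

lemma dlt_bex:
  "trm M t \<Longrightarrow> dlt M (\<lambda>e. Q (e 0) (\<lambda>i. e (Suc i))) \<Longrightarrow> dlt M (\<lambda>e. \<exists>z\<in>universe M. lessS M z (t e) \<and> Q z e)"
  using dlt_not[OF dlt_ball[of t "\<lambda>z e. \<not> Q z e"]] by (simp add: dlt_not)

lemma dlt_subst1: "dlt M (\<lambda>e. P (e 0)) \<Longrightarrow> trm M t \<Longrightarrow> dlt M (\<lambda>e. P (t e))"
  using dlt_subst[of "\<lambda>e. P (e 0)" "\<lambda>_. t"] by simp

lemma dlt_subst2: "dlt M (\<lambda>e. P (e 0) (e 1)) \<Longrightarrow> trm M t \<Longrightarrow> trm M u \<Longrightarrow> dlt M (\<lambda>e. P (t e) (u e))"
  using dlt_subst[of "\<lambda>e. P (e 0) (e 1)" "\<lambda>i. if i = 0 then t else u"] by simp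

lemma dlt_subst3:
  "dlt M (\<lambda>e. P (e 0) (e 1) (e 2)) \<Longrightarrow> trm M t \<Longrightarrow> trm M u \<Longrightarrow> trm M v \<Longrightarrow> dlt M (\<lambda>e. P (t e) (u e) (v e))"
  using dlt_subst[of "\<lambda>e. P (e 0) (e 1) (e 2)" "\<lambda>i. if i = 0 then t else if i = 1 then u else v"] by simp

lemma dlt_subst4:
  "dlt M (\<lambda>e. P (e 0) (e 1) (e 2) (e 3)) \<Longrightarrow> trm M t \<Longrightarrow> trm M u \<Longrightarrow> trm M v \<Longrightarrow> trm M w \<Longrightarrow> dlt M (\<lambda>e. P (t e) (u e) (v e) (w e))"
  using dlt_subst[of "\<lambda>e. P (e 0) (e 1) (e 2) (e 3)"
    "\<lambda>i. if i = 0 then t else if i = 1 then u else if i = 2 then v else w"] by simp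

end

section \<open>Ordered semiring laws from the basic axioms and bounded induction\<close>

definition models :: "('a, 'm) str_scheme \<Rightarrow> fm set \<Rightarrow> bool" where
  "models M \<Gamma> \<longleftrightarrow> (\<forall>p\<in>\<Gamma>. \<forall>e S. (\<forall>i. e i \<in> universe M) \<longrightarrow> (\<forall>X. S X \<in> sets M) \<longrightarrow> eval M e S p)"

lemma modelsD: "models M \<Gamma> \<Longrightarrow> p \<in> \<Gamma> \<Longrightarrow> (\<And>i. e i \<in> universe M) \<Longrightarrow> (\<And>X. S X \<in> sets M) \<Longrightarrow> eval M e S p"
  by (simp add: models_def)

lemma models_ucl:
  assumes "models M \<Gamma>" "ucl p \<in> \<Gamma>" "\<And>i. e i \<in> universe M" "\<And>X. S X \<in> sets M"
  shows "eval M e S p"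
proof -
  have "eval M e S (ucl p)" using assms by (intro modelsD)
  then show ?thesis using assms(3,4) by (simp add: eval_ucl)
qed

definition basic_fms :: "fm set" where
  "basic_fms = {
       Neg (Eq (Add (Var 0) One) Zero),
       Imp (Eq (Add (Var 0) One) (Add (Var 1) One)) (Eq (Var 0) (Var 1)),
       Eq (Add (Var 0) Zero) (Var 0),
       Eq (Add (Var 0) (Add (Var 1) One)) (Add (Add (Var 0) (Var 1)) One),
       Eq (Mul (Var 0) Zero) Zero,
       Eq (Mul (Var 0) (Add (Var 1) One)) (Add (Mul (Var 0) (Var 1)) (Var 0)),
       Neg (Less (Var 0) Zero),
       Iff (Less (Var 0) (Add (Var 1) One)) (Or (Less (Var 0) (Var 1)) (Eq (Var 0) (Var 1)))}"

lemma basic_axioms_eq: "basic_axioms = ucl ` basic_fms"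
  by (simp add: basic_axioms_def basic_fms_def)

locale weak_arith = model M for M :: "('a, 'm) str_scheme" +
  assumes basic: "models M basic_axioms"
    and ind0: "models M (induction delta0)"
begin

lemma basic_eval:
  assumes "p \<in> basic_fms" "x \<in> universe M" "y \<in> universe M"
  shows "\<exists>S. eval M (case_nat x (\<lambda>_. y)) S p"
proof -
  obtain Y where Y: "Y \<in> sets M" using some_set by blast
  have "eval M (case_nat x (\<lambda>_. y)) (\<lambda>_. Y) p"
    by (rule models_ucl[OF basic]) (use assms Y in \<open>auto simp: basic_axioms_eq case_nat_in\<close>)
  then show ?thesis by blast
qed

lemma Suc_neq_zero: "x \<in> universe M \<Longrightarrow> plusS M x (oneS M) \<noteq> zeroS M"
  using basic_eval[of "Neg (Eq (Add (Var 0) One) Zero)" x x] by (auto simp: basic_fms_def)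

lemma Suc_inj: "x \<in> universe M \<Longrightarrow> y \<in> universe M \<Longrightarrow> plusS M x (oneS M) = plusS M y (oneS M) \<Longrightarrow> x = y"
  using basic_eval[of "Imp (Eq (Add (Var 0) One) (Add (Var 1) One)) (Eq (Var 0) (Var 1))" x y]
  by (auto simp: basic_fms_def)

lemma add_0: "x \<in> universe M \<Longrightarrow> plusS M x (zeroS M) = x"
  using basic_eval[of "Eq (Add (Var 0) Zero) (Var 0)" x x] by (auto simp: basic_fms_def)

lemma add_Suc: "x \<in> universe M \<Longrightarrow> y \<in> universe M \<Longrightarrow> plusS M x (plusS M y (oneS M)) = plusS M (plusS M x y) (oneS M)"
  using basic_eval[of "Eq (Add (Var 0) (Add (Var 1) One)) (Add (Add (Var 0) (Var 1)) One)" x y]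
  by (auto simp: basic_fms_def)

lemma mul_0: "x \<in> universe M \<Longrightarrow> timesS M x (zeroS M) = zeroS M"
  using basic_eval[of "Eq (Mul (Var 0) Zero) Zero" x x] by (auto simp: basic_fms_def)

lemma mul_Suc: "x \<in> universe M \<Longrightarrow> y \<in> universe M \<Longrightarrow> timesS M x (plusS M y (oneS M)) = plusS M (timesS M x y) x"
  using basic_eval[of "Eq (Mul (Var 0) (Add (Var 1) One)) (Add (Mul (Var 0) (Var 1)) (Var 0))" x y]
  by (auto simp: basic_fms_def)

lemma not_less_zero: "x \<in> universe M \<Longrightarrow> \<not> lessS M x (zeroS M)"
  using basic_eval[of "Neg (Less (Var 0) Zero)" x x] by (auto simp: basic_fms_def)

lemma less_Suc: "x \<in> universe M \<Longrightarrow> y \<in> universe M \<Longrightarrow> lessS M x (plusS M y (oneS M)) \<longleftrightarrow> lessS M x y \<or> x = y"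
  using basic_eval[of "Iff (Less (Var 0) (Add (Var 1) One)) (Or (Less (Var 0) (Var 1)) (Eq (Var 0) (Var 1)))" x y]
  by (auto simp: basic_fms_def)

lemma induct [consumes 1, case_names dlt zero Suc]:
  assumes "x \<in> universe M" "dlt M (\<lambda>e. P (e 0))" "P (zeroS M)"
    and "\<And>x. x \<in> universe M \<Longrightarrow> P x \<Longrightarrow> P (plusS M x (oneS M))"
  shows "P x"
proof -
  from assms(2) obtain p c S where p: "delta0 p" "\<forall>i. c i \<in> universe M" "\<forall>X. S X \<in> sets M"
    "\<And>e. (\<forall>i. e i \<in> universe M) \<Longrightarrow> P (e 0) \<longleftrightarrow> eval M (mix e c) S p" unfolding dlt_def by blast
  \<comment> \<open>\<open>mix\<close> has the induction variable at index 0, so removing that index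
    leaves the environment of the parameters in the induction axiom.\<close>
  let ?e = "\<lambda>i. mix (\<lambda>_. zeroS M) c (Suc i)"
  have "case_nat x ?e i = mix (case_nat x (\<lambda>_. zeroS M)) c i" for x i
    by (cases i) (auto simp: mix_def split: nat.split)
  then have "case_nat x ?e = mix (case_nat x (\<lambda>_. zeroS M)) c" for x by blast
  then have *: "eval M (case_nat x ?e) S p \<longleftrightarrow> P x" if "x \<in> universe M" for x
    using p(4)[of "case_nat x (\<lambda>_. zeroS M)"] that by (simp add: case_nat_in)
  have **: "(\<lambda>i. tval M (case_nat x ?e) (case i of 0 \<Rightarrow> Add (Var 0) One | Suc i \<Rightarrow> Var (Suc i)))
    = case_nat (plusS M x (oneS M)) ?e" for x
    by (rule ext) (auto split: nat.split)
  have "eval M ?e S (ind_axiom p)"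
    by (rule models_ucl[OF ind0]) (use p in \<open>auto simp: induction_def intro!: mix_in\<close>)
  then show ?thesis using assms(1,3,4)
    by (simp add: ind_axiom_def eval_instN eval_substN * **)
qed

lemmas dlt_rules = dlt_eq dlt_lessS dlt_imp dlt_and dlt_or dlt_not dlt_iff dlt_ball dlt_bex
  trm_var trm_add trm_mul trm_const

lemma zero_add:
  assumes "x \<in> universe M"
  shows "plusS M (zeroS M) x = x"
  using assms(1)
  by (induct x rule: induct) (use assms in \<open>auto intro!: dlt_rules simp: add_0 add_Suc\<close>)

lemma add_assoc:
  assumes "x \<in> universe M" "y \<in> universe M" "z \<in> universe M"
  shows "plusS M (plusS M x y) z = plusS M x (plusS M y z)"
  using assms(3)
  by (induct z rule: induct) (use assms in \<open>auto intro!: dlt_rules simp: add_0 add_Suc\<close>)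

lemma Suc_add:
  assumes "x \<in> universe M" "y \<in> universe M"
  shows "plusS M (plusS M x (oneS M)) y = plusS M (plusS M x y) (oneS M)"
  using assms(2)
  by (induct y rule: induct) (use assms in \<open>auto intro!: dlt_rules simp: add_0 add_Suc\<close>)

lemma add_commute:
  assumes "x \<in> universe M" "y \<in> universe M"
  shows "plusS M x y = plusS M y x"
  using assms(2)
  by (induct y rule: induct) (use assms in \<open>auto intro!: dlt_rules simp: add_0 add_Suc zero_add Suc_add\<close>)

lemma distrib:
  assumes "x \<in> universe M" "y \<in> universe M" "z \<in> universe M"
  shows "timesS M x (plusS M y z) = plusS M (timesS M x y) (timesS M x z)"
  using assms(3)
proof (induct z rule: induct)
  case (Suc z)
  then show ?case using assms by (simp add: add_Suc mul_Suc) (simp add: add_assoc)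
qed (use assms in \<open>auto intro!: dlt_rules simp: add_0 mul_0\<close>)

lemma mul_assoc:
  assumes "x \<in> universe M" "y \<in> universe M" "z \<in> universe M"
  shows "timesS M (timesS M x y) z = timesS M x (timesS M y z)"
  using assms(3)
proof (induct z rule: induct)
  case (Suc z)
  then show ?case using assms by (simp add: mul_Suc) (simp add: distrib)
qed (use assms in \<open>auto intro!: dlt_rules simp: mul_0\<close>)

lemma zero_mul:
  assumes "x \<in> universe M"
  shows "timesS M (zeroS M) x = zeroS M"
  using assms(1)
  by (induct x rule: induct) (use assms in \<open>auto intro!: dlt_rules simp: mul_0 mul_Suc add_0\<close>)

lemma one_mul:
  assumes "x \<in> universe M"
  shows "timesS M (oneS M) x = x"
  using assms(1)
  by (induct x rule: induct) (use assms in \<open>auto intro!: dlt_rules simp: mul_0 mul_Suc\<close>)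

lemma Suc_mul:
  assumes "x \<in> universe M" "y \<in> universe M"
  shows "timesS M (plusS M x (oneS M)) y = plusS M (timesS M x y) y"
  using assms(2)
proof (induct y rule: induct)
  case (Suc y)
  then show ?case using assms(1)
    by (simp add: mul_Suc add_Suc) (metis add_assoc add_commute times_in)
qed (use assms(1) in \<open>auto intro!: dlt_rules simp: mul_0 add_0\<close>)

lemma mul_commute:
  assumes "x \<in> universe M" "y \<in> universe M"
  shows "timesS M x y = timesS M y x"
  using assms(2)
  by (induct y rule: induct) (use assms in \<open>auto intro!: dlt_rules simp: mul_0 mul_Suc zero_mul Suc_mul\<close>)

lemma less_add:
  assumes "x \<in> universe M" "y \<in> universe M"
  shows "lessS M x (plusS M (plusS M x y) (oneS M))"
  using assms(2)
proof (induct y rule: induct)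
  case (Suc y)
  then show ?case using assms(1) by (simp add: add_Suc) (simp add: less_Suc)
qed (use assms(1) in \<open>auto intro!: dlt_rules simp: add_0 less_Suc\<close>)

lemma less_iff_add:
  assumes "x \<in> universe M" "y \<in> universe M"
  shows "lessS M x y \<longleftrightarrow> (\<exists>z\<in>universe M. y = plusS M (plusS M x z) (oneS M))"
proof
  \<comment> \<open>The bound on the difference \<open>z\<close> makes the induction formula
    bounded.\<close>
  have "lessS M x y \<longrightarrow> (\<exists>z\<in>universe M. lessS M z y \<and> y = plusS M (plusS M x z) (oneS M))"
    using assms(2)
  proof (induct y rule: induct)
    case (Suc y)
    show ?case
    proof
      assume "lessS M x (plusS M y (oneS M))"
      then consider "x = y" | "lessS M x y" using less_Suc Suc assms(1) by blast
      then show "\<exists>z\<in>universe M. lessS M z (plusS M y (oneS M)) \<and>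
          plusS M y (oneS M) = plusS M (plusS M x z) (oneS M)"
      proof cases
        case 1
        then show ?thesis using assms(1) less_add[of "zeroS M" y]
          by (intro bexI[of _ "zeroS M"]) (auto simp: add_0 zero_add)
      next
        case 2
        then obtain z where z: "z \<in> universe M" "lessS M z y" "y = plusS M (plusS M x z) (oneS M)"
          using Suc by blast
        have "lessS M (plusS M z (oneS M)) (plusS M y (oneS M))"
        proof -
          have "plusS M y (oneS M) = plusS M (plusS M (plusS M z (oneS M)) x) (oneS M)"
            using z assms(1) by (metis Suc_add add_commute)
          then show ?thesis using less_add[of "plusS M z (oneS M)" x] z assms(1) by simp
        qed
        then show ?thesis using z assms(1) by (intro bexI[of _ "plusS M z (oneS M)"]) (auto simp: add_Suc)
      qed
    qed
  qed (use assms(1) in \<open>auto intro!: dlt_rules simp: not_less_zero\<close>)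
  then show "lessS M x y \<Longrightarrow> \<exists>z\<in>universe M. y = plusS M (plusS M x z) (oneS M)" by blast
qed (use less_add assms in auto)

lemma less_linear:
  assumes "x \<in> universe M" "y \<in> universe M"
  shows "lessS M x y \<or> x = y \<or> lessS M y x"
  using assms(2)
proof (induct y rule: induct)
  case zero
  have "zeroS M = x \<or> lessS M (zeroS M) x" using assms(1)
    by (induct x rule: induct) (auto intro!: dlt_rules simp: less_Suc)
  then show ?case by blast
next
  case (Suc y)
  have "lessS M y x \<Longrightarrow> plusS M y (oneS M) = x \<or> lessS M (plusS M y (oneS M)) x"
  proof -
    assume "lessS M y x"
    then obtain z where z: "z \<in> universe M" "x = plusS M (plusS M y z) (oneS M)"
      using less_iff_add Suc assms by blast
    have "zeroS M = z \<or> lessS M (zeroS M) z" using z(1)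
      by (induct z rule: induct) (auto intro!: dlt_rules simp: less_Suc)
    then show ?thesis
    proof
      assume "zeroS M = z"
      then show ?thesis using z Suc by (auto simp: add_0)
    next
      assume "lessS M (zeroS M) z"
      then obtain w where w: "w \<in> universe M" "z = plusS M w (oneS M)"
        using less_iff_add z by (metis zero_add zero_in)
      then have "x = plusS M (plusS M (plusS M y (oneS M)) w) (oneS M)"
        unfolding z(2) w(2) using w(1) Suc(1) by (simp add: add_Suc Suc_add[of y w])
      then show ?thesis using less_add w Suc by simp
    qed
  qed
  then show ?case using Suc assms(1) by (auto simp: less_Suc)
qed (use assms(1) in \<open>auto intro!: dlt_rules\<close>)

lemma less_irrefl:
  assumes "x \<in> universe M" shows "\<not> lessS M x x"
proof
  assume "lessS M x x"
  then obtain z where z: "z \<in> universe M" "x = plusS M (plusS M x z) (oneS M)"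
    using less_iff_add assms by blast
  have "x \<noteq> plusS M (plusS M x z) (oneS M)" using assms
  proof (induct x rule: induct)
    case zero
    then show ?case using z(1) Suc_neq_zero[of z] by (metis zero_add)
  next
    case (Suc x)
    then show ?case using z(1) by (simp add: Suc_add[of x z]) (metis Suc_inj plus_in one_in)
  qed (use z(1) in \<open>auto intro!: dlt_rules\<close>)
  then show False using z(2) by blast
qed

lemma less_trans:
  assumes "x \<in> universe M" "y \<in> universe M" "z \<in> universe M" "lessS M x y" "lessS M y z"
  shows "lessS M x z"
proof -
  obtain a where "a \<in> universe M" "y = plusS M (plusS M x a) (oneS M)"
    using less_iff_add assms by blast
  moreover obtain b where "b \<in> universe M" "z = plusS M (plusS M y b) (oneS M)"
    using less_iff_add assms by blast
  ultimately have "a \<in> universe M" "b \<in> universe M"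
      "z = plusS M (plusS M x (plusS M (plusS M a b) (oneS M))) (oneS M)"
    using assms(1) by (simp_all add: Suc_add[of _ b] add_Suc add_assoc[of x a b])
  then show ?thesis using less_add[of x "plusS M (plusS M a b) (oneS M)"] assms(1) by simp
qed

end

section \<open>Embedding an arithmetic semiring into an ordered ring\<close>

text \<open>Just enough for the formal differences to form an ordered ring, so that subtraction,
  negative multipliers and divisibility become available while the model remains visible as the
  nonnegative part.\<close>

class arith_semiring = comm_semiring_1 + linorder +
  assumes less_iff_add: "a < b \<longleftrightarrow> (\<exists>c. b = a + c + 1)"
    and add_one_neq_zero: "a + 1 \<noteq> 0"
begin

lemma less_add_left: "b < c \<Longrightarrow> a + b < a + c"
  by (metis add.assoc less_iff_add)

lemma add_left_iff: "a + b = a + c \<longleftrightarrow> b = c"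
  using less_add_left[of b c a] less_add_left[of c b a] by (cases b c rule: linorder_cases) auto

lemma less_add_left_iff: "a + b < a + c \<longleftrightarrow> b < c"
  using less_add_left[of b c a] less_add_left[of c b a] by (cases b c rule: linorder_cases) auto

lemma zero_le: "0 \<le> a"
  by (metis add_one_neq_zero less_iff_add not_less)

lemma add_right_iff: "b + a = c + a \<longleftrightarrow> b = c"
  by (simp add: add.commute[of _ a] add_left_iff)

end

\<comment> \<open>The Grothendieck ring of formal differences; cancellation of addition makes the
  relation transitive.\<close>
quotient_type (overloaded) 'a zint = "'a::arith_semiring \<times> 'a" / "\<lambda>(a, b) (c, d). a + d = c + b"
  morphisms Rep_zint Abs_zint
proof (rule equivpI)
  show "transp (\<lambda>(a, b) (c, d). a + d = c + (b::'a))"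
  proof (rule transpI, clarsimp)
    fix a b c d e f :: 'a
    assume *: "a + d = c + b" "c + f = e + d"
    have "d + (a + f) = (a + d) + f" by (simp add: ac_simps)
    also have "\<dots> = b + (c + f)" unfolding *(1) by (simp add: ac_simps)
    also have "\<dots> = d + (e + b)" unfolding *(2) by (simp add: ac_simps)
    finally show "a + f = e + b" by (simp only: add_left_iff)
  qed
qed (auto intro!: reflpI sympI)

instantiation zint :: (arith_semiring) comm_ring_1
begin

lift_definition zero_zint :: "'a zint" is "(0, 0)" .
lift_definition one_zint :: "'a zint" is "(1, 0)" .
lift_definition uminus_zint :: "'a zint \<Rightarrow> 'a zint" is "\<lambda>(a, b). (b, a)"
  by (auto simp: ac_simps)
lift_definition plus_zint :: "'a zint \<Rightarrow> 'a zint \<Rightarrow> 'a zint" is "\<lambda>(a, b) (c, d). (a + c, b + d)"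
proof clarsimp
  fix a b c d e f g h :: 'a
  assume "a + d = c + b" "e + h = g + f"
  then have "(a + d) + (e + h) = (c + b) + (g + f)" by simp
  then show "a + e + (d + h) = c + g + (b + f)" by (simp add: ac_simps)
qed
lift_definition minus_zint :: "'a zint \<Rightarrow> 'a zint \<Rightarrow> 'a zint" is "\<lambda>(a, b) (c, d). (a + d, b + c)"
proof clarsimp
  fix a b c d e f g h :: 'a
  assume "a + d = c + b" "e + h = g + f"
  then have "(a + d) + (g + f) = (c + b) + (e + h)" by simp
  then show "a + f + (d + g) = c + h + (b + e)" by (simp add: ac_simps)
qed
lift_definition times_zint :: "'a zint \<Rightarrow> 'a zint \<Rightarrow> 'a zint"
  is "\<lambda>(a, b) (c, d). (a * c + b * d, a * d + b * c)"
proof clarsimp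
  fix a b c d e f g h :: 'a
  assume *: "a + d = c + b" "e + h = g + f"
  \<comment> \<open>Adding \<open>d * e + c * f\<close> to both sides allows the two hypotheses to
    be used one at a time; the term is cancelled at the end.\<close>
  have "(a * e + b * f + (c * h + d * g)) + (d * e + c * f)
      = (a + d) * e + (c + b) * f + c * h + d * g" by (simp add: algebra_simps)
  also have "\<dots> = (c + b) * e + (a + d) * f + c * h + d * g" unfolding * ..
  also have "\<dots> = c * (e + h) + b * e + (a + d) * f + d * g" by (simp add: algebra_simps)
  also have "\<dots> = c * (g + f) + b * e + (a + d) * f + d * g" unfolding * ..
  also have "\<dots> = c * g + c * f + b * e + a * f + d * (g + f)" by (simp add: algebra_simps)
  also have "\<dots> = c * g + c * f + b * e + a * f + d * (e + h)" unfolding * ..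
  also have "\<dots> = (c * g + d * h + (a * f + b * e)) + (d * e + c * f)" by (simp add: algebra_simps)
  finally show "a * e + b * f + (c * h + d * g) = c * g + d * h + (a * f + b * e)"
    by (simp only: add_right_iff)
qed

instance
  by standard (transfer; clarsimp simp: algebra_simps)+

end

instantiation zint :: (arith_semiring) linordered_idom
begin

lift_definition less_zint :: "'a zint \<Rightarrow> 'a zint \<Rightarrow> bool" is "\<lambda>(a, b) (c, d). a + d < c + b"
proof clarsimp
  fix a b c d e f g h :: 'a
  assume *: "a + d = c + b" "e + h = g + f"
  have "a + f < e + b \<longleftrightarrow> (d + h) + (a + f) < (d + h) + (e + b)" by (simp only: less_add_left_iff)
  also have "(d + h) + (a + f) = (a + d) + (h + f)" by (simp add: ac_simps)
  also have "\<dots> = (b + f) + (c + h)" unfolding * by (simp add: ac_simps)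
  also have "(d + h) + (e + b) = (e + h) + (d + b)" by (simp add: ac_simps)
  also have "\<dots> = (b + f) + (g + d)" unfolding * by (simp add: ac_simps)
  finally show "a + f < e + b \<longleftrightarrow> c + h < g + d" by (simp only: less_add_left_iff)
qed

definition less_eq_zint :: "'a zint \<Rightarrow> 'a zint \<Rightarrow> bool" where
  "less_eq_zint x y \<longleftrightarrow> x < y \<or> x = y"
definition abs_zint :: "'a zint \<Rightarrow> 'a zint" where
  "abs_zint x = (if x < 0 then - x else x)"
definition sgn_zint :: "'a zint \<Rightarrow> 'a zint" where
  "sgn_zint x = (if x = 0 then 0 else if 0 < x then 1 else - 1)"

lemma less_zint_trans: "x < y \<Longrightarrow> y < z \<Longrightarrow> x < (z :: 'a zint)"
proof (transfer, clarsimp)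
  fix a b c d e f :: 'a
  assume "a + d < c + b" "c + f < e + d"
  then have "(a + d) + (c + f) < (c + b) + (e + d)"
    by (metis add.commute less_add_left less_trans)
  then have "(c + d) + (a + f) < (c + d) + (e + b)" by (simp add: ac_simps)
  then show "a + f < e + b" by (simp only: less_add_left_iff)
qed

lemma less_zint_linear: "x < y \<or> x = y \<or> y < (x :: 'a zint)"
  by (transfer, clarsimp)

lemma less_zint_irrefl: "\<not> x < (x :: 'a zint)"
  by (transfer, clarsimp)


instance
proof
  fix x y z :: "'a zint"
  show "x < y \<longleftrightarrow> x \<le> y \<and> \<not> y \<le> x"
    by (metis less_eq_zint_def less_zint_irrefl less_zint_trans)
  show "x \<le> x" by (simp add: less_eq_zint_def)
  show "x \<le> y \<Longrightarrow> y \<le> z \<Longrightarrow> x \<le> z"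
    unfolding less_eq_zint_def using less_zint_trans by blast
  show "x \<le> y \<Longrightarrow> y \<le> x \<Longrightarrow> x = y"
    by (metis less_eq_zint_def less_zint_irrefl less_zint_trans)
  show "x \<le> y \<or> y \<le> x"
    unfolding less_eq_zint_def using less_zint_linear by blast
  have "x < y \<Longrightarrow> z + x < z + y"
  proof (transfer, clarsimp)
    fix a b c d e f :: 'a
    assume "a + d < c + b"
    then have "(e + f) + (a + d) < (e + f) + (c + b)" by (rule less_add_left)
    then show "e + a + (f + d) < e + c + (f + b)" by (simp add: ac_simps)
  qed
  then show "x \<le> y \<Longrightarrow> z + x \<le> z + y" by (auto simp: less_eq_zint_def)
  show "x < y \<Longrightarrow> 0 < z \<Longrightarrow> z * x < z * y"
  proof (transfer, clarsimp)
    fix a b c d e f :: 'a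
    assume "a + d < c + b" "f < e"
    then obtain u v where *: "c + b = a + d + u + 1" "e = f + v + 1" by (auto simp: less_iff_add)
    have "e * c + f * d + (e * b + f * a) = e * (c + b) + f * (a + d)" by (simp add: algebra_simps)
    also have "\<dots> = (e * (a + d) + f * (c + b)) + (v * u + v + u) + 1"
      unfolding * by (simp add: algebra_simps)
    also have "e * (a + d) + f * (c + b) = e * a + f * b + (e * d + f * c)" by (simp add: algebra_simps)
    finally show "e * a + f * b + (e * d + f * c) < e * c + f * d + (e * b + f * a)"
      unfolding less_iff_add by blast
  qed
  show "\<bar>x\<bar> = (if x < 0 then - x else x)" by (simp add: abs_zint_def)
  show "sgn x = (if x = 0 then 0 else if 0 < x then 1 else - 1)" by (simp add: sgn_zint_def)
qed

end

lift_definition emb :: "'a::arith_semiring \<Rightarrow> 'a zint" is "\<lambda>a. (a, 0)" .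

lemma emb_simps [simp]:
  "emb 0 = 0" "emb 1 = 1" "emb (a + b) = emb a + emb b" "emb (a * b) = emb a * emb b"
  "emb a < emb b \<longleftrightarrow> a < b" "emb a = emb b \<longleftrightarrow> a = b"
  by (transfer; simp)+

lemma emb_nonneg: "0 \<le> emb a"
  using zero_le[of a] unfolding less_eq_zint_def by (metis emb_simps(1,5) le_less)

lemma ex_emb:
  assumes "0 \<le> x" obtains a where "x = emb a"
proof -
  have "0 < x \<Longrightarrow> \<exists>a. x = emb (a + 1)"
  proof (transfer, clarsimp)
    fix a b :: 'a
    assume "b < a"
    then obtain c where "a = b + c + 1" by (auto simp: less_iff_add)
    then show "\<exists>c. a = c + 1 + b" by (intro exI[of _ c]) (simp add: ac_simps)
  qed
  then show thesis using assms that emb_simps(1) by (metis le_less)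
qed

lemma zint_discrete:
  assumes "0 < (x :: 'a::arith_semiring zint)" shows "1 \<le> x"
proof -
  obtain a where a: "x = emb a" using assms ex_emb by (metis less_imp_le)
  then obtain c where "a = c + 1" using assms emb_simps(1,5) by (metis add_0 less_iff_add)
  then show ?thesis using a emb_nonneg[of c] by simp
qed

lemma eval_iso:
  assumes inj: "inj_on f (universe M)" and N: "universe N = f ` universe M"
    "zeroS N = f (zeroS M)" "oneS N = f (oneS M)"
    "\<And>x y. x \<in> universe M \<Longrightarrow> y \<in> universe M \<Longrightarrow> plusS N (f x) (f y) = f (plusS M x y)"
    "\<And>x y. x \<in> universe M \<Longrightarrow> y \<in> universe M \<Longrightarrow> timesS N (f x) (f y) = f (timesS M x y)"
    "\<And>x y. x \<in> universe M \<Longrightarrow> y \<in> universe M \<Longrightarrow> lessS N (f x) (f y) \<longleftrightarrow> lessS M x y"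
    "sets N = (\<lambda>Y. f ` (Y \<inter> universe M)) ` sets M"
    and M: "wf_str M"
  shows "(\<And>i. e i \<in> universe M) \<Longrightarrow>
    eval N (\<lambda>i. f (e i)) (\<lambda>X. f ` (S X \<inter> universe M)) p \<longleftrightarrow> eval M e S p"
proof (induction p arbitrary: e S)
  case (Eq s t)
  note e = Eq
  have *: "tval N (\<lambda>i. f (e i)) t = f (tval M e t)" for t
    by (induction t) (use N tval_in[OF M e] in simp_all)
  show ?case using inj tval_in[OF M e] by (simp add: * inj_on_eq_iff)
next
  case (Less s t)
  note e = Less
  have *: "tval N (\<lambda>i. f (e i)) t = f (tval M e t)" for t
    by (induction t) (use N tval_in[OF M e] in simp_all)
  show ?case using N tval_in[OF M e] by (simp add: *)
next
  case (Mem t X)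
  note e = Mem
  have *: "tval N (\<lambda>i. f (e i)) t = f (tval M e t)" for t
    by (induction t) (use N tval_in[OF M e] in simp_all)
  show ?case using inj tval_in[OF M e] by (auto simp: * inj_on_def)
next
  case (AllN p)
  have "case_nat (f x) (\<lambda>i. f (e i)) = (\<lambda>i. f (case_nat x e i))" for x
    by (rule ext) (simp split: nat.split)
  moreover have "eval N (\<lambda>i. f (case_nat x e i)) (\<lambda>X. f ` (S X \<inter> universe M)) p \<longleftrightarrow> eval M (case_nat x e) S p"
    if "x \<in> universe M" for x
    by (rule AllN.IH) (use AllN.prems that in \<open>auto intro: case_nat_in\<close>)
  ultimately show ?case using N(1) by simp
next
  case (AllS p)
  have "case_nat (f ` (Y \<inter> universe M)) (\<lambda>X. f ` (S X \<inter> universe M))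
    = (\<lambda>X. f ` (case_nat Y S X \<inter> universe M))" for Y
    by (rule ext) (simp split: nat.split)
  moreover have "eval N (\<lambda>i. f (e i)) (\<lambda>X. f ` (case_nat Y S X \<inter> universe M)) p \<longleftrightarrow> eval M e (case_nat Y S) p" for Y
    by (rule AllS.IH) (rule AllS.prems)
  ultimately show ?case using N(7) by simp
qed simp_all

section \<open>Models of the base theory on the nonnegative part of an ordered ring\<close>

definition ring_str :: "'a::linordered_idom set \<Rightarrow> 'a set set \<Rightarrow> 'a str" where
  "ring_str U \<X> = \<lparr>universe = U, zeroS = 0, oneS = 1, plusS = (+), timesS = (*), lessS = (<), sets = \<X>\<rparr>"

lemma ring_str_simps [simp]:
  "universe (ring_str U \<X>) = U" "zeroS (ring_str U \<X>) = 0" "oneS (ring_str U \<X>) = 1"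
  "plusS (ring_str U \<X>) = (+)" "timesS (ring_str U \<X>) = (*)" "lessS (ring_str U \<X>) = (<)"
  "sets (ring_str U \<X>) = \<X>"
  by (simp_all add: ring_str_def)

locale rca =
  fixes \<X> :: "'a::linordered_idom set set"
  assumes discrete: "0 < x \<Longrightarrow> 1 \<le> (x :: 'a)"
    and nonempty: "\<X> \<noteq> {}"
    and RCA: "models (ring_str {0..} \<X>) RCA0_star"
begin

abbreviation MM :: "'a str" where "MM \<equiv> ring_str {0..} \<X>"

sublocale weak_arith MM
proof
  show "wf_str MM" using nonempty by (simp add: wf_str_def)
  show "models MM basic_axioms" "models MM (induction delta0)"
    using RCA by (auto simp: models_def RCA0_star_def)
qed

lemma less_plus_one: "x < y + 1 \<longleftrightarrow> x \<le> (y :: 'a)"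
  using discrete[of "x - y"] by (cases "x \<le> y") auto

abbreviation T :: "((nat \<Rightarrow> 'a) \<Rightarrow> 'a) \<Rightarrow> bool" where "T \<equiv> trm MM"
abbreviation D :: "((nat \<Rightarrow> 'a) \<Rightarrow> bool) \<Rightarrow> bool" where "D \<equiv> dlt MM"

lemma T_add: "T t \<Longrightarrow> T u \<Longrightarrow> T (\<lambda>e. t e + u e)"
  using trm_add[of t u] by simp

lemma T_mul: "T t \<Longrightarrow> T u \<Longrightarrow> T (\<lambda>e. t e * u e)"
  using trm_mul[of t u] by simp

lemma T_const: "0 \<le> a \<Longrightarrow> T (\<lambda>e. a)"
  by (rule trm_const) simp

lemma T_numeral: "T (\<lambda>e. numeral k)" and T_zero: "T (\<lambda>e. 0)" and T_one: "T (\<lambda>e. 1)"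
  by (rule T_const, simp)+

lemma T_nonneg: "T t \<Longrightarrow> (\<And>i. 0 \<le> e i) \<Longrightarrow> 0 \<le> t e"
  using trm_in[of t e] by simp

lemma D_less: "T t \<Longrightarrow> T u \<Longrightarrow> D (\<lambda>e. t e < u e)"
  using dlt_lessS[of t u] by simp

lemma D_le: "T t \<Longrightarrow> T u \<Longrightarrow> D (\<lambda>e. t e \<le> u e)"
  using dlt_not[OF D_less[of u t]] by (simp add: not_less)

lemma D_mem: "T t \<Longrightarrow> Y \<in> \<X> \<Longrightarrow> D (\<lambda>e. t e \<in> Y)"
  using dlt_mem[of t Y] by simp

lemma D_all_less: "T t \<Longrightarrow> D (\<lambda>e. Q (e 0) (\<lambda>i. e (Suc i))) \<Longrightarrow> D (\<lambda>e. \<forall>z\<in>{0..<t e}. Q z e)"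
  using dlt_ball[of t Q] by (simp add: Ball_def imp_conjL)

lemma D_ex_less: "T t \<Longrightarrow> D (\<lambda>e. Q (e 0) (\<lambda>i. e (Suc i))) \<Longrightarrow> D (\<lambda>e. \<exists>z\<in>{0..<t e}. Q z e)"
  using dlt_bex[of t Q] by (simp add: Bex_def conj_assoc)

lemma atLeastLessThan_plus_one: "{0..<y + 1} = {0..(y :: 'a)}"
  by (auto simp: less_plus_one)

lemma D_all_le: "T t \<Longrightarrow> D (\<lambda>e. Q (e 0) (\<lambda>i. e (Suc i))) \<Longrightarrow> D (\<lambda>e. \<forall>z\<in>{0..t e}. Q z e)"
  using D_all_less[of "\<lambda>e. t e + 1" Q] by (simp add: atLeastLessThan_plus_one T_add T_one)

lemma D_ex_le: "T t \<Longrightarrow> D (\<lambda>e. Q (e 0) (\<lambda>i. e (Suc i))) \<Longrightarrow> D (\<lambda>e. \<exists>z\<in>{0..t e}. Q z e)"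
  using D_ex_less[of "\<lambda>e. t e + 1" Q] by (simp add: atLeastLessThan_plus_one T_add T_one)

lemmas D_rules = D_all_less D_ex_less D_all_le D_ex_le D_less D_le dlt_eq
  dlt_imp dlt_and dlt_or dlt_not dlt_iff dlt_const
  trm_var T_zero T_one T_numeral T_add T_mul T_const

lemma D_induct [consumes 1, case_names D zero Suc]:
  assumes "0 \<le> x" "D (\<lambda>e. P (e 0))" "P 0" "\<And>x. 0 \<le> x \<Longrightarrow> P x \<Longrightarrow> P (x + 1)"
  shows "P x"
  using induct[of x P] assms by simp

lemma D_induct_le [consumes 2, case_names D zero Suc]:
  assumes "0 \<le> x" "x \<le> n" "D (\<lambda>e. P (e 0))" "P 0" "\<And>x. 0 \<le> x \<Longrightarrow> x < n \<Longrightarrow> P x \<Longrightarrow> P (x + 1)"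
  shows "P x"
proof -
  have "x \<le> n \<longrightarrow> P x" using assms(1)
  proof (induct x rule: D_induct)
    case (Suc x)
    then show ?case using assms(5)[of x] by auto
  qed (use assms in \<open>auto intro!: D_rules\<close>)
  then show ?thesis using assms(2) by simp
qed

lemma D_strong_induct [consumes 1, case_names D less]:
  assumes "0 \<le> x" "D (\<lambda>e. P (e 0))" "\<And>x. 0 \<le> x \<Longrightarrow> (\<And>y. 0 \<le> y \<Longrightarrow> y < x \<Longrightarrow> P y) \<Longrightarrow> P x"
  shows "P x"
proof -
  have "\<forall>y\<in>{0..x}. P y" using assms(1)
  proof (induct x rule: D_induct)
    case D
    show ?case using assms(2) by (intro D_rules) (rule dlt_subst1, auto intro!: D_rules)
  next
    case zero
    then show ?case using assms(3)[of 0] by auto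
  next
    case (Suc x)
    have "P (x + 1)"
    proof (rule assms(3))
      show "P y" if "0 \<le> y" "y < x + 1" for y
        using that Suc(2) less_plus_one[of y x] by simp
    qed (use Suc(1) in simp)
    moreover have "{0..x + 1} \<subseteq> insert (x + 1) {0..x}"
      using less_plus_one by fastforce
    ultimately show ?case using Suc(2) by blast
  qed
  then show ?thesis using assms(1) by simp
qed

lemma delta1_comprehension_set:
  assumes "D (\<lambda>e. R (e 0) (e 1))" "D (\<lambda>e. Q (e 0) (e 1))"
    and eq: "\<And>x. 0 \<le> x \<Longrightarrow> (\<exists>y\<ge>0. R x y) \<longleftrightarrow> (\<forall>y\<ge>0. Q x y)"
  shows "\<exists>Y\<in>\<X>. \<forall>x\<ge>0. x \<in> Y \<longleftrightarrow> (\<exists>y\<ge>0. R x y)"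
proof -
  \<comment> \<open>The selector \<open>e 2\<close> merges both predicates into one formula, so that
    they share their number and set parameters, as one comprehension instance requires.\<close>
  have "D (\<lambda>e. (e 2 = 0 \<longrightarrow> R (e 0) (e 1)) \<and> (e 2 \<noteq> 0 \<longrightarrow> Q (e 0) (e 1)))"
    by (intro D_rules assms)
  then obtain p c S where p: "delta0 p" "\<forall>i. 0 \<le> c i" "\<forall>X. S X \<in> \<X>"
    "\<And>e. (\<forall>i. 0 \<le> e i) \<Longrightarrow> ((e 2 = 0 \<longrightarrow> R (e 0) (e 1)) \<and> (e 2 \<noteq> 0 \<longrightarrow> Q (e 0) (e 1))) \<longleftrightarrow>
      eval MM (mix e c) S p" unfolding dlt_def by auto
  define \<sigma> where "\<sigma> z i = (if i = 0 then Var 1 else if i = 2 then Var 0 else if i = 4 then z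
    else if even i then Zero else Var (i div 2 + 2))" for z i
  have \<sigma>: "(\<lambda>i. tval MM (case_nat y (case_nat x c)) (\<sigma> z i))
      = mix (\<lambda>i. if i = 0 then x else if i = 1 then y else if i = 2 then tval MM (case_nat y (case_nat x c)) z else 0) c"
    for x y z
    by (rule ext) (auto simp: \<sigma>_def mix_def elim!: evenE)
  have R: "eval MM (case_nat y (case_nat x c)) S (substN (\<sigma> Zero) p) \<longleftrightarrow> R x y" if "0 \<le> x" "0 \<le> y" for x y
    unfolding eval_substN \<sigma> using that by (subst p(4)[symmetric]) auto
  have Q: "eval MM (case_nat y (case_nat x c)) S (substN (\<sigma> One) p) \<longleftrightarrow> Q x y" if "0 \<le> x" "0 \<le> y" for x y
    unfolding eval_substN \<sigma> using that by (subst p(4)[symmetric]) auto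
  let ?p = "ExN (substN (\<sigma> Zero) p)" and ?q = "AllN (substN (\<sigma> One) p)"
  have "eval MM c S (Imp (AllN (Iff ?p ?q)) (ExS (AllN (Iff (Mem (Var 0) 0) (liftS ?p)))))"
  proof (rule models_ucl[OF RCA])
    show "ucl (Imp (AllN (Iff ?p ?q)) (ExS (AllN (Iff (Mem (Var 0) 0) (liftS ?p))))) \<in> RCA0_star"
      unfolding RCA0_star_def delta1_comprehension_def sigma1_def pi1_def
      using delta0_substN[OF p(1)] by blast
  qed (use p in auto)
  moreover have "eval MM c S (AllN (Iff ?p ?q))"
  proof -
    have "(\<exists>y\<in>{0..}. R x y) \<longleftrightarrow> (\<forall>y\<in>{0..}. Q x y)" if "0 \<le> x" for x
      using eq[OF that] by (simp add: Bex_def Ball_def)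
    then show ?thesis by (simp add: R Q)
  qed
  ultimately have "eval MM c S (ExS (AllN (Iff (Mem (Var 0) 0) (liftS ?p))))" by simp
  then show ?thesis using R by (simp add: Bex_def Ball_def) (metis atLeast_iff)
qed

lemma comprehension:
  assumes "D (\<lambda>e. P (e 0))"
  shows "\<exists>Y\<in>\<X>. \<forall>x\<ge>0. x \<in> Y \<longleftrightarrow> P x"
proof -
  have "\<exists>y. 0 \<le> (y :: 'a)" by blast
  then show ?thesis using delta1_comprehension_set[of "\<lambda>x y. P x" "\<lambda>x y. P x"] assms by simp
qed

text \<open>Comprehension turns the predicate into a set, and membership in a set is atomic. Hence
  \<open>D\<close> absorbs Delta_1 definitions, and induction becomes available for them.\<close>

lemma D_of_delta1:
  assumes "D (\<lambda>e. R (e 0) (e 1))" "D (\<lambda>e. Q (e 0) (e 1))"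
    and "\<And>x. 0 \<le> x \<Longrightarrow> P x \<longleftrightarrow> (\<exists>y\<ge>0. R x y)" "\<And>x. 0 \<le> x \<Longrightarrow> P x \<longleftrightarrow> (\<forall>y\<ge>0. Q x y)"
  shows "D (\<lambda>e. P (e 0))"
proof -
  have eq: "(\<exists>y\<ge>0. R x y) \<longleftrightarrow> (\<forall>y\<ge>0. Q x y)" if "0 \<le> x" for x
    using assms(3,4)[OF that] by simp
  obtain Y where Y: "Y \<in> \<X>" "\<forall>x\<ge>0. x \<in> Y \<longleftrightarrow> (\<exists>y\<ge>0. R x y)"
    using delta1_comprehension_set[OF assms(1,2) eq] by blast
  have "D (\<lambda>e. e 0 \<in> Y)" by (intro D_mem trm_var Y)
  then show ?thesis by (rule dlt_cong) (use assms(3) Y in simp)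
qed

end

section \<open>Pairing, beta codes and coprime moduli\<close>

definition pr :: "'a::linordered_idom \<Rightarrow> 'a \<Rightarrow> 'a" where
  "pr x y = (x + y) * (x + y) + x"

text \<open>The meaning of the object formula \<open>Beta\<close> in a ring structure, just as
  \<open>pr\<close> and \<open>pow_code\<close> are the meanings of \<open>pair\<close> and of the
  matrix of \<open>Power\<close>.\<close>

definition bet :: "'a::linordered_idom \<Rightarrow> 'a \<Rightarrow> 'a \<Rightarrow> 'a \<Rightarrow> bool" where
  "bet a b i r \<longleftrightarrow> 0 \<le> r \<and> r < 1 + (i + 1) * b \<and> (\<exists>q\<in>{0..a}. a = q * (1 + (i + 1) * b) + r)"

definition pow_code :: "'a::linordered_idom \<Rightarrow> 'a \<Rightarrow> 'a \<Rightarrow> 'a \<Rightarrow> 'a \<Rightarrow> bool" where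
  "pow_code x y z a b \<longleftrightarrow> bet a b 0 1 \<and>
     (\<forall>i\<in>{0..<y}. \<exists>v\<in>{0..a}. bet a b i v \<and> bet a b (i + 1) (v * x)) \<and> bet a b y z"

text \<open>Invertibility modulo \<open>m\<close>, with the sign changed to avoid subtraction.\<close>

definition inv_mod :: "'a::linordered_idom \<Rightarrow> 'a \<Rightarrow> bool" where
  "inv_mod c m \<longleftrightarrow> (\<exists>u. m dvd u * c + 1)"

lemma inv_mod_mult:
  assumes "inv_mod c m" "inv_mod d m" shows "inv_mod (c * d) m"
proof -
  obtain u v where uv: "m dvd u * c + 1" "m dvd v * d + 1" using assms by (auto simp: inv_mod_def)
  have "- (u * v) * (c * d) + 1 = (u * c + 1) - (u * c) * (v * d + 1)" by (simp add: algebra_simps)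
  then have "m dvd - (u * v) * (c * d) + 1" using uv by (metis dvd_diff dvd_mult)
  then show ?thesis unfolding inv_mod_def by blast
qed

lemma inv_mod_cancel:
  assumes "inv_mod c m" "m dvd c * q" shows "m dvd q"
proof -
  obtain u where u: "m dvd u * c + 1" using assms by (auto simp: inv_mod_def)
  have "q = (u * c + 1) * q - u * (c * q)" by (simp add: algebra_simps)
  then show ?thesis using u assms(2) by (metis dvd_diff dvd_mult dvd_mult2)
qed

lemma inv_mod_one: "inv_mod 1 m"
  unfolding inv_mod_def by (rule exI[of _ "-1"]) simp

text \<open>Goedel's observation. Modulo \<open>?m\<close> the other modulus is
  \<open>- (j - i) * b\<close>, and \<open>b * (j + 1)\<close> is -1. With
  \<open>b = (j - i) * e\<close>, multiplication by \<open>e * (j + 1) * (j + 1)\<close> gives the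
  negative of the square of \<open>b * (j + 1)\<close>, that is -1.\<close>

lemma beta_moduli_coprime:
  assumes "(j - i) dvd b"
  shows "inv_mod (1 + (i + 1) * b) (1 + (j + 1) * b)"
proof -
  from assms obtain e where e: "b = (j - i) * e" by (elim dvdE)
  let ?m = "1 + (j + 1) * b" and ?c = "j + 1"
  have "1 + (i + 1) * b = ?m - (j - i) * b" by (simp add: algebra_simps)
  then have "(e * ?c * ?c) * (1 + (i + 1) * b) + 1
      = ?m * (e * ?c * ?c) - ((j - i) * e) * (b * ?c * ?c) + 1"
    by (simp add: algebra_simps)
  also have "\<dots> = ?m * (e * ?c * ?c) - ?m * (b * ?c - 1)"
    unfolding e[symmetric] by (simp add: algebra_simps)
  finally have "?m dvd (e * ?c * ?c) * (1 + (i + 1) * b) + 1" by (metis dvd_diff dvd_triv_left)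
  then show ?thesis unfolding inv_mod_def by blast
qed

context rca
begin

lemma less_iff_le: "x < y \<longleftrightarrow> x + 1 \<le> (y :: 'a)"
  using less_plus_one[of x "y - 1"] less_plus_one[of y x] by auto

lemma pr_nonneg: "0 \<le> x \<Longrightarrow> 0 \<le> y \<Longrightarrow> 0 \<le> pr x (y :: 'a)"
  by (simp add: pr_def)

lemma square_ge: "0 \<le> (s :: 'a) \<Longrightarrow> s \<le> s * s"
  using discrete[of s] mult_left_mono[of 1 s s] by (cases "s = 0") auto

lemma pr_ge: "0 \<le> x \<Longrightarrow> 0 \<le> y \<Longrightarrow> x \<le> pr x y \<and> y \<le> pr x (y :: 'a)"
  using square_ge[of "x + y"] by (auto simp: pr_def)

text \<open>For \<open>s = x + y\<close> the code is at least \<open>s * s\<close> and less than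
  \<open>(s + 1) * (s + 1)\<close>, so it determines \<open>s\<close> and then
  \<open>x\<close>.\<close>

lemma pr_inj:
  assumes "0 \<le> x" "0 \<le> y" "0 \<le> x'" "0 \<le> y'" "pr x y = pr x' (y' :: 'a)"
  shows "x = x' \<and> y = y'"
proof -
  have *: "\<not> x + y < x' + y'" if "0 \<le> x" "0 \<le> y" "0 \<le> x'" "0 \<le> y'" "pr x y = pr x' (y' :: 'a)" for x y x' y'
  proof
    assume "x + y < x' + y'"
    then have "x + y + 1 \<le> x' + y'" using less_iff_le by blast
    then have "(x + y + 1) * (x + y + 1) \<le> (x' + y') * (x' + y')" using that by (intro mult_mono) auto
    moreover have "(x + y + 1) * (x + y + 1) = (x + y) * (x + y) + x + (x + y + y + 1)"
      by (simp add: algebra_simps)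
    ultimately show False using that unfolding pr_def by linarith
  qed
  then have "x + y = x' + y'" using assms by (metis linorder_cases)
  then show ?thesis using assms(5) by (simp add: pr_def)
qed

lemma T_pr: "T t \<Longrightarrow> T u \<Longrightarrow> T (\<lambda>e. pr (t e) (u e))"
  unfolding pr_def by (intro T_add T_mul)

text \<open>Sets are unary, so the predicate is first comprehended on the codes
  \<open>pr x y\<close> and then read back by substituting that term.\<close>

lemma D_of_delta1_2:
  assumes "D (\<lambda>e. R (e 0) (e 1) (e 2))" "D (\<lambda>e. Q (e 0) (e 1) (e 2))"
    and "\<And>x y. 0 \<le> x \<Longrightarrow> 0 \<le> y \<Longrightarrow> P x y \<longleftrightarrow> (\<exists>z\<ge>0. R x y z)"
    and "\<And>x y. 0 \<le> x \<Longrightarrow> 0 \<le> y \<Longrightarrow> P x y \<longleftrightarrow> (\<forall>z\<ge>0. Q x y z)"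
  shows "D (\<lambda>e. P (e 0) (e 1))"
proof -
  have "D (\<lambda>e. (\<lambda>t. \<exists>x\<in>{0..t}. \<exists>y\<in>{0..t}. t = pr x y \<and> P x y) (e 0))"
  proof (rule D_of_delta1)
    show "D (\<lambda>e. \<exists>x\<in>{0..e 0}. \<exists>y\<in>{0..e 0}. e 0 = pr x y \<and> R x y (e 1))"
      by (intro D_rules T_pr dlt_subst3[OF assms(1)])
    show "D (\<lambda>e. \<exists>x\<in>{0..e 0}. \<exists>y\<in>{0..e 0}. e 0 = pr x y \<and> Q x y (e 1))"
      by (intro D_rules T_pr dlt_subst3[OF assms(2)])
    fix t :: 'a assume "0 \<le> t"
    show "(\<exists>x\<in>{0..t}. \<exists>y\<in>{0..t}. t = pr x y \<and> P x y) \<longleftrightarrow>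
        (\<exists>z\<ge>0. \<exists>x\<in>{0..t}. \<exists>y\<in>{0..t}. t = pr x y \<and> R x y z)"
      using assms(3) by fastforce
    show "(\<exists>x\<in>{0..t}. \<exists>y\<in>{0..t}. t = pr x y \<and> P x y) \<longleftrightarrow>
        (\<forall>z\<ge>0. \<exists>x\<in>{0..t}. \<exists>y\<in>{0..t}. t = pr x y \<and> Q x y z)" (is "?l \<longleftrightarrow> ?r")
    proof
      assume ?r
      then obtain x y where xy: "x \<in> {0..t}" "y \<in> {0..t}" "t = pr x y" by (metis order_refl)
      have "Q x y z" if z: "0 \<le> z" for z
      proof -
        obtain x' y' where "x' \<in> {0..t}" "y' \<in> {0..t}" "t = pr x' y'" "Q x' y' z"
          using \<open>?r\<close> z by blast
        then show ?thesis using xy pr_inj[of x y x' y'] by auto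
      qed
      then have "P x y" using xy assms(4)[of x y] by auto
      then show ?l using xy by blast
    next
      assume ?l
      then obtain x y where xy: "x \<in> {0..t}" "y \<in> {0..t}" "t = pr x y" "P x y" by blast
      then have "\<forall>z\<ge>0. Q x y z" using assms(4)[of x y] by simp
      then show ?r using xy by blast
    qed
  qed
  from dlt_subst1[OF this, of "\<lambda>e. pr (e 0) (e 1)"]
  have "D (\<lambda>e. \<exists>x\<in>{0..pr (e 0) (e 1)}. \<exists>y\<in>{0..pr (e 0) (e 1)}. pr (e 0) (e 1) = pr x y \<and> P x y)"
    by (simp add: T_pr trm_var)
  then show ?thesis
  proof (rule dlt_cong)
    fix e :: "nat \<Rightarrow> 'a" assume "\<And>i. e i \<in> universe MM"
    then have e: "0 \<le> e 0" "0 \<le> e 1" by simp_all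
    show "(\<exists>x\<in>{0..pr (e 0) (e 1)}. \<exists>y\<in>{0..pr (e 0) (e 1)}. pr (e 0) (e 1) = pr x y \<and> P x y)
      \<longleftrightarrow> P (e 0) (e 1)"
    proof
      assume "\<exists>x\<in>{0..pr (e 0) (e 1)}. \<exists>y\<in>{0..pr (e 0) (e 1)}. pr (e 0) (e 1) = pr x y \<and> P x y"
      then obtain x y where "x \<in> {0..pr (e 0) (e 1)}" "y \<in> {0..pr (e 0) (e 1)}"
        "pr (e 0) (e 1) = pr x y" "P x y" by blast
      then show "P (e 0) (e 1)" using pr_inj[OF e, of x y] by simp
    qed (rule bexI[of _ "e 0"], rule bexI[of _ "e 1"], use pr_ge[OF e] e in auto)
  qed
qed

lemma D_of_delta1_3:
  assumes "D (\<lambda>e. R (e 0) (e 1) (e 2) (e 3))" "D (\<lambda>e. Q (e 0) (e 1) (e 2) (e 3))"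
    and "\<And>x y z. 0 \<le> x \<Longrightarrow> 0 \<le> y \<Longrightarrow> 0 \<le> z \<Longrightarrow> P x y z \<longleftrightarrow> (\<exists>w\<ge>0. R x y z w)"
    and "\<And>x y z. 0 \<le> x \<Longrightarrow> 0 \<le> y \<Longrightarrow> 0 \<le> z \<Longrightarrow> P x y z \<longleftrightarrow> (\<forall>w\<ge>0. Q x y z w)"
  shows "D (\<lambda>e. P (e 0) (e 1) (e 2))"
proof -
  have "D (\<lambda>e. (\<lambda>x t. \<exists>y\<in>{0..t}. \<exists>z\<in>{0..t}. t = pr y z \<and> P x y z) (e 0) (e 1))"
  proof (rule D_of_delta1_2)
    show "D (\<lambda>e. \<exists>y\<in>{0..e 1}. \<exists>z\<in>{0..e 1}. e 1 = pr y z \<and> R (e 0) y z (e 2))"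
      by (intro D_rules T_pr dlt_subst4[OF assms(1)])
    show "D (\<lambda>e. \<exists>y\<in>{0..e 1}. \<exists>z\<in>{0..e 1}. e 1 = pr y z \<and> Q (e 0) y z (e 2))"
      by (intro D_rules T_pr dlt_subst4[OF assms(2)])
    fix x t :: 'a assume x: "0 \<le> x" and "0 \<le> t"
    show "(\<exists>y\<in>{0..t}. \<exists>z\<in>{0..t}. t = pr y z \<and> P x y z) \<longleftrightarrow>
        (\<exists>w\<ge>0. \<exists>y\<in>{0..t}. \<exists>z\<in>{0..t}. t = pr y z \<and> R x y z w)"
      using assms(3)[OF x] by fastforce
    show "(\<exists>y\<in>{0..t}. \<exists>z\<in>{0..t}. t = pr y z \<and> P x y z) \<longleftrightarrow>
        (\<forall>w\<ge>0. \<exists>y\<in>{0..t}. \<exists>z\<in>{0..t}. t = pr y z \<and> Q x y z w)" (is "?l \<longleftrightarrow> ?r")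
    proof
      assume ?r
      then obtain y z where yz: "y \<in> {0..t}" "z \<in> {0..t}" "t = pr y z" by (metis order_refl)
      have "Q x y z w" if z: "0 \<le> w" for w
      proof -
        obtain y' z' where "y' \<in> {0..t}" "z' \<in> {0..t}" "t = pr y' z'" "Q x y' z' w"
          using \<open>?r\<close> z by blast
        then show ?thesis using yz pr_inj[of y z y' z'] by auto
      qed
      then have "P x y z" using yz assms(4)[OF x, of y z] by auto
      then show ?l using yz by blast
    next
      assume ?l
      then obtain y z where yz: "y \<in> {0..t}" "z \<in> {0..t}" "t = pr y z" "P x y z" by blast
      then have "\<forall>w\<ge>0. Q x y z w" using assms(4)[OF x, of y z] by simp
      then show ?r using yz by blast
    qed
  qed
  from dlt_subst2[OF this, of "\<lambda>e. e 0" "\<lambda>e. pr (e 1) (e 2)"]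
  have "D (\<lambda>e. \<exists>y\<in>{0..pr (e 1) (e 2)}. \<exists>z\<in>{0..pr (e 1) (e 2)}. pr (e 1) (e 2) = pr y z \<and> P (e 0) y z)"
    by (simp add: T_pr trm_var)
  then show ?thesis
  proof (rule dlt_cong)
    fix e :: "nat \<Rightarrow> 'a" assume "\<And>i. e i \<in> universe MM"
    then have e: "0 \<le> e 1" "0 \<le> e 2" by simp_all
    show "(\<exists>y\<in>{0..pr (e 1) (e 2)}. \<exists>z\<in>{0..pr (e 1) (e 2)}. pr (e 1) (e 2) = pr y z \<and> P (e 0) y z)
      \<longleftrightarrow> P (e 0) (e 1) (e 2)"
    proof
      assume "\<exists>y\<in>{0..pr (e 1) (e 2)}. \<exists>z\<in>{0..pr (e 1) (e 2)}. pr (e 1) (e 2) = pr y z \<and> P (e 0) y z"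
      then obtain y z where "y \<in> {0..pr (e 1) (e 2)}" "z \<in> {0..pr (e 1) (e 2)}"
        "pr (e 1) (e 2) = pr y z" "P (e 0) y z" by blast
      then show "P (e 0) (e 1) (e 2)" using pr_inj[OF e, of y z] by simp
    qed (rule bexI[of _ "e 1"], rule bexI[of _ "e 2"], use pr_ge[OF e] e in auto)
  qed
qed

lemma least_witness:
  assumes "D (\<lambda>e. P (e 0))" "0 \<le> x" "P x"
  obtains y where "0 \<le> y" "y \<le> x" "P y" "\<forall>z\<in>{0..<y}. \<not> P z"
proof -
  have "P x \<longrightarrow> (\<exists>y\<in>{0..x}. P y \<and> (\<forall>z\<in>{0..<y}. \<not> P z))" using assms(2)
  proof (induct x rule: D_strong_induct)
    case D
    show ?case by (intro D_rules dlt_subst1[OF assms(1)])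
  next
    case (less x)
    show ?case
    proof (cases "\<exists>z\<in>{0..<x}. P z")
      case True
      then obtain z where "0 \<le> z" "z < x" "P z" by auto
      then show ?thesis using less(2)[of z] by fastforce
    qed (use less(1) in auto)
  qed
  then show thesis using assms that by auto
qed

text \<open>The witness function induces a linear preorder on an interval. It is a set of the model,
  so bounded induction finds a maximal element, and its witness bounds all others.\<close>

lemma collection:
  assumes \<theta>: "D (\<lambda>e. \<theta> (e 0) (e 1))" and a: "0 \<le> a" and ex: "\<forall>x\<in>{0..<a}. \<exists>y\<ge>0. \<theta> x y"
  shows "\<exists>w\<ge>0. \<forall>x\<in>{0..<a}. \<exists>y\<in>{0..w}. \<theta> x y"
proof -
  define L where "L x x' \<longleftrightarrow> x < a \<and> x' < a \<and> (\<forall>y'\<ge>0. \<theta> x' y' \<longrightarrow> (\<exists>y\<in>{0..y'}. \<theta> x y))" for x x'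
  have DL: "D (\<lambda>e. L (e 0) (e 1))"
  \<comment> \<open>Existential form: \<open>x\<close> has a witness such that \<open>x'\<close> has
    none below it. Universal form: the definition, its quantifier cut off at a stage. They agree
    because \<open>x'\<close> has a least witness.\<close>
  proof (rule D_of_delta1_2)
    show "D (\<lambda>e. e 0 < a \<and> e 1 < a \<and> (\<exists>y\<in>{0..e 2}. \<theta> (e 0) y \<and> (\<forall>y'\<in>{0..<y}. \<not> \<theta> (e 1) y')))"
      by (intro D_rules dlt_subst2[OF \<theta>] a)
    show "D (\<lambda>e. e 0 < a \<and> e 1 < a \<and> (\<forall>y'\<in>{0..e 2}. \<theta> (e 1) y' \<longrightarrow> (\<exists>y\<in>{0..y'}. \<theta> (e 0) y)))"
      by (intro D_rules dlt_subst2[OF \<theta>] a)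
    fix x x' :: 'a assume x: "0 \<le> x" "0 \<le> x'"
    show "L x x' \<longleftrightarrow> (\<exists>w\<ge>0. x < a \<and> x' < a \<and> (\<exists>y\<in>{0..w}. \<theta> x y \<and> (\<forall>y'\<in>{0..<y}. \<not> \<theta> x' y')))" (is "_ \<longleftrightarrow> ?r")
    proof
      assume l: "L x x'"
      then obtain y0 where "0 \<le> y0" "\<theta> x' y0" using ex[rule_format, of x'] x by (auto simp: L_def)
      moreover have "D (\<lambda>e. \<theta> x' (e 0))" by (intro D_rules dlt_subst2[OF \<theta>] x)
      ultimately obtain y1 where y1: "0 \<le> y1" "\<theta> x' y1" "\<forall>z\<in>{0..<y1}. \<not> \<theta> x' z"
        by (metis least_witness[of "\<theta> x'"])
      then obtain y where "y \<in> {0..y1}" "\<theta> x y" using l by (auto simp: L_def)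
      then show ?r using l y1 by (intro exI[of _ y]) (auto simp: L_def)
    next
      assume ?r
      then show "L x x'" unfolding L_def by (metis atLeastAtMost_iff atLeastLessThan_iff not_less)
    qed
    show "L x x' \<longleftrightarrow> (\<forall>w\<ge>0. x < a \<and> x' < a \<and> (\<forall>y'\<in>{0..w}. \<theta> x' y' \<longrightarrow> (\<exists>y\<in>{0..y'}. \<theta> x y)))"
      unfolding L_def by (metis atLeastAtMost_iff order_refl)
  qed
  have refl: "L x x" if "x < a" for x using that by (auto simp: L_def)
  have trans: "L x z" if xy: "L x y" and yz: "L y z" for x y z
    unfolding L_def
  proof (intro conjI allI impI)
    show "x < a" "z < a" using xy yz by (simp_all add: L_def)
    fix w :: 'a assume "0 \<le> w" "\<theta> z w"
    then obtain v where "v \<in> {0..w}" "\<theta> y v" using yz by (auto simp: L_def)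
    moreover from this obtain u where "u \<in> {0..v}" "\<theta> x u" using xy by (auto simp: L_def)
    ultimately show "\<exists>u\<in>{0..w}. \<theta> x u" by (intro bexI[of _ u]) auto
  qed
  have total: "L x y \<or> L y x" if xy: "x < a" "y < a" for x y
  proof (rule disjCI)
    assume "\<not> L y x"
    then obtain y' where "0 \<le> y'" "\<theta> x y'" "\<forall>z\<in>{0..y'}. \<not> \<theta> y z" using xy by (auto simp: L_def)
    then show "L x y" using xy unfolding L_def by (metis atLeastAtMost_iff linear)
  qed
  have max: "0 < k \<longrightarrow> (\<exists>m\<in>{0..<k}. \<forall>x\<in>{0..<k}. L x m)" if "0 \<le> k" "k \<le> a" for k
    using that
  proof (induct k rule: D_induct_le)
    case D
    show ?case by (intro D_rules dlt_subst2[OF DL])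
  next
    case (Suc k)
    show ?case
    proof (cases "k = 0")
      case True
      have *: "x = 0" if "x \<in> {0..<1}" for x :: 'a using that less_plus_one[of x 0] by simp
      have "{0..<1} = {0 :: 'a}" by (rule equalityI) (use * in blast, simp)
      then show ?thesis using refl[of 0] Suc(2) True by simp
    next
      case False
      then obtain m where m: "m \<in> {0..<k}" "\<forall>x\<in>{0..<k}. L x m" using Suc by auto
      have split: "x \<in> {0..<k} \<or> x = k" if "x \<in> {0..<k + 1}" for x
        using that less_plus_one[of x k] by auto
      have "m < a" using m Suc(2) by auto
      show ?thesis
      proof (cases "L m k")
        case True
        then have "\<forall>x\<in>{0..<k + 1}. L x k" using split m trans refl[OF Suc(2)] by metis
        then show ?thesis using Suc(1) by auto
      next
        case False
        then have "L k m" using total[OF \<open>m < a\<close> Suc(2)] by blast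
        then have "\<forall>x\<in>{0..<k + 1}. L x m" using split m by metis
        then show ?thesis using m by auto
      qed
    qed
  qed simp
  show ?thesis
  proof (cases "a = 0")
    case False
    then obtain m where m: "m \<in> {0..<a}" "\<forall>x\<in>{0..<a}. L x m" using max[of a] a by auto
    then obtain w where "0 \<le> w" "\<theta> m w" using ex by blast
    then show ?thesis using m by (intro exI[of _ w]) (auto simp: L_def)
  qed auto
qed

section \<open>Division with remainder and bounded forms of divisibility\<close>

lemma euclid_nonneg:
  fixes a m :: 'a
  assumes "0 \<le> a" "0 < m"
  shows "\<exists>q\<in>{0..a}. \<exists>r\<in>{0..<m}. a = q * m + r"
  using assms(1)
proof (induct a rule: D_induct)
  case D
  show ?case using assms by (intro D_rules) auto
next
  case zero
  show ?case using assms by auto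
next
  case (Suc a)
  then obtain q r where qr: "q \<in> {0..a}" "r \<in> {0..<m}" "a = q * m + r" by blast
  show ?case
  proof (cases "r + 1 = m")
    case True
    then have "a + 1 = (q + 1) * m + 0" using qr by (simp add: algebra_simps)
    moreover have "q + 1 \<in> {0..a + 1}" "0 \<in> {0..<m}" using qr(1) assms by simp_all
    ultimately show ?thesis by blast
  next
    case False
    then have "r + 1 < m" using qr less_iff_le[of r m] by auto
    then have "q \<in> {0..a + 1}" "r + 1 \<in> {0..<m}" using qr(1,2) by simp_all
    moreover have "a + 1 = q * m + (r + 1)" using qr(3) by simp
    ultimately show ?thesis by blast
  qed
qed

lemma euclid:
  fixes a m :: 'a
  assumes "0 < m"
  obtains q r where "a = q * m + r" "0 \<le> r" "r < m"
proof (cases "0 \<le> a")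
  case True
  then show thesis using euclid_nonneg[OF True assms] that by auto
next
  case False
  then have "0 \<le> - a" by simp
  from euclid_nonneg[OF this assms] obtain q r where qr: "- a = q * m + r" "0 \<le> r" "r < m" by auto
  have a: "a = - q * m - r" using qr(1) by (simp add: algebra_simps)
  show thesis
  proof (cases "r = 0")
    case True
    then show thesis using that[of "- q" 0] a assms by simp
  next
    case False
    then show thesis using that[of "- q - 1" "m - r"] a qr by (simp add: algebra_simps)
  qed
qed

lemma quotient_unique:
  assumes "q * m + r = q' * m + (r' :: 'a)" "0 \<le> r" "r < m" "0 \<le> r'" "r' < m"
  shows "r = r'"
proof -
  have *: "\<not> q < q'" if "q * m + r = q' * m + r'" "0 \<le> r'" "r < m" "0 \<le> r" for q q' r r' :: 'a
  proof
    assume "q < q'"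
    then have "q + 1 \<le> q'" using less_iff_le by blast
    then have "(q + 1) * m \<le> q' * m" using that by (intro mult_right_mono) auto
    then show False using that by (simp add: algebra_simps)
  qed
  then have "q = q'" using assms by (metis linorder_cases)
  then show ?thesis using assms(1) by simp
qed

text \<open>Divisibility in the ring admits negative cofactors; between nonnegative elements a
  bounded cofactor suffices, which makes the relation definable.\<close>

lemma dvd_iff_bounded:
  assumes "0 \<le> m" "0 \<le> c" shows "m dvd c \<longleftrightarrow> (\<exists>q\<in>{0..c}. c = m * (q :: 'a))"
proof
  assume "m dvd c"
  then obtain q where q: "c = m * q" by (elim dvdE)
  show "\<exists>q\<in>{0..c}. c = m * q"
  proof (cases "c = 0")
    case False
    then have "0 < m * q" using assms(2) unfolding q[symmetric] by simp
    then have "0 < m" "0 < q" using assms(1) by (auto simp: zero_less_mult_iff)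
    then have "1 * q \<le> m * q" using discrete[of m] by (intro mult_right_mono) auto
    then show ?thesis using q \<open>0 < q\<close> by auto
  qed auto
qed auto

lemma D_dvd:
  assumes "T t" "T u" shows "D (\<lambda>e. t e dvd u e)"
proof -
  have "D (\<lambda>e. (\<lambda>m c. \<exists>q\<in>{0..c}. c = m * q) (e 0) (e 1))" by (intro D_rules)
  from dlt_subst2[OF this assms] show ?thesis
    by (rule dlt_cong) (use T_nonneg[OF assms(1)] T_nonneg[OF assms(2)] dvd_iff_bounded in simp)
qed

lemma inv_mod_iff_bounded:
  assumes "0 < m" shows "inv_mod c m \<longleftrightarrow> (\<exists>u\<in>{0..<m}. m dvd u * c + (1 :: 'a))"
proof
  assume "inv_mod c m"
  then obtain u where u: "m dvd u * c + 1" by (auto simp: inv_mod_def)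
  obtain q r where r: "u = q * m + r" "0 \<le> r" "r < m" using euclid[OF assms] by metis
  have "r * c + 1 = (u * c + 1) - m * (q * c)" unfolding r(1) by (simp add: algebra_simps)
  then have "m dvd r * c + 1" using u by (metis dvd_diff dvd_triv_left)
  then show "\<exists>u\<in>{0..<m}. m dvd u * c + 1" using r by auto
qed (auto simp: inv_mod_def)

lemma bet_iff:
  assumes "0 \<le> a" "0 \<le> b" "0 \<le> i"
  shows "bet a b i r \<longleftrightarrow> 0 \<le> r \<and> r < 1 + (i + 1) * b \<and> (1 + (i + 1) * b) dvd (a - r :: 'a)"
proof -
  let ?m = "1 + (i + 1) * b"
  have m: "1 \<le> ?m" using assms by simp
  have "\<exists>q\<in>{0..a}. a = q * ?m + r" if r: "0 \<le> r" "r < ?m" and d: "?m dvd a - r"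
  proof -
    from d obtain q where q: "a - r = ?m * q" by (elim dvdE)
    then have a: "a = q * ?m + r" by (simp add: algebra_simps)
    have "0 \<le> q"
    proof (rule ccontr)
      assume "\<not> 0 \<le> q"
      then have "q + 1 \<le> 0" using less_iff_le[of q 0] by simp
      then have "(q + 1) * ?m \<le> 0 * ?m" using m by (intro mult_right_mono) auto
      then show False using a r assms(1) by (simp add: algebra_simps)
    qed
    moreover have "q * 1 \<le> q * ?m" using \<open>0 \<le> q\<close> m by (intro mult_left_mono) auto
    then have "q \<le> a" using a r by simp
    ultimately show ?thesis using a by auto
  qed
  moreover have "?m dvd a - r" if "\<exists>q\<in>{0..a}. a = q * ?m + r"
    using that by (metis add_diff_cancel_right' dvd_triv_right)
  ultimately show ?thesis unfolding bet_def by blast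
qed

lemma bet_unique: "bet a b i r \<Longrightarrow> bet a b i r' \<Longrightarrow> r = (r' :: 'a)"
  unfolding bet_def using quotient_unique by metis

lemma bet_le:
  assumes "0 \<le> b" "0 \<le> i" "bet a b i r" shows "r \<le> (a :: 'a)"
proof -
  obtain q where "0 \<le> q" "a = q * (1 + (i + 1) * b) + r" using assms(3) by (auto simp: bet_def)
  moreover have "0 \<le> q * (1 + (i + 1) * b)" using assms \<open>0 \<le> q\<close> by simp
  ultimately show ?thesis by simp
qed

lemma D_bet0: "D (\<lambda>e. bet (e 0) (e 1) (e 2) (e 3))"
  unfolding bet_def by (intro D_rules)

lemmas D_bet = dlt_subst4[OF D_bet0]

end

section \<open>Initial segments and exponentiation\<close>

context rca
begin

text \<open>Covers both the whole nonnegative part and a closed cut, so that the object formulas for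
  beta codes and powers are analysed once for the two structures.\<close>

definition segment :: "'a set \<Rightarrow> bool" where
  "segment U \<longleftrightarrow> U \<subseteq> {0..} \<and> 0 \<in> U \<and> 1 \<in> U \<and> (\<forall>x\<in>U. \<forall>y\<in>U. x + y \<in> U \<and> x * y \<in> U) \<and>
     (\<forall>y\<in>U. \<forall>x\<in>{0..y}. x \<in> U)"

lemma segmentD:
  assumes "segment U"
  shows "x \<in> U \<Longrightarrow> 0 \<le> x" "0 \<in> U" "1 \<in> U" "x \<in> U \<Longrightarrow> y \<in> U \<Longrightarrow> x + y \<in> U"
    "x \<in> U \<Longrightarrow> y \<in> U \<Longrightarrow> x * y \<in> U" "y \<in> U \<Longrightarrow> 0 \<le> x \<Longrightarrow> x \<le> y \<Longrightarrow> x \<in> U"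
  using assms unfolding segment_def by auto

lemma segment_UNIV: "segment {0..}"
  by (simp add: segment_def)

lemma segment_wf: "segment U \<Longrightarrow> \<Y> \<noteq> {} \<Longrightarrow> wf_str (ring_str U \<Y>)"
  by (auto simp: wf_str_def segment_def)

text \<open>The quotient is at most the code \<open>a\<close>, hence present in every initial
  segment containing \<open>a\<close>; so \<open>Beta\<close> is absolute.\<close>

lemma eval_Beta:
  assumes U: "segment U" "\<And>i. e i \<in> U" and "\<Y> \<noteq> {}"
  shows "eval (ring_str U \<Y>) e S (Beta a b i r) \<longleftrightarrow>
    bet (tval (ring_str U \<Y>) e a) (tval (ring_str U \<Y>) e b) (tval (ring_str U \<Y>) e i) (tval (ring_str U \<Y>) e r)"
proof -
  let ?t = "tval (ring_str U \<Y>) e"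
  have t: "?t s \<in> U" for s
    using tval_in[OF segment_wf[OF U(1) assms(3)], of e s] U(2) by simp
  have "(\<exists>q\<in>U. q < ?t a + 1 \<and> ?t a = q * (1 + (?t i + 1) * ?t b) + ?t r) \<longleftrightarrow>
     (\<exists>q\<in>{0..?t a}. ?t a = q * (1 + (?t i + 1) * ?t b) + ?t r)"
    using segmentD(6)[OF U(1) t[of a]] segmentD(1)[OF U(1)] less_plus_one by (metis atLeastAtMost_iff)
  then show ?thesis using segmentD(1)[OF U(1) t[of r]] by (simp add: Beta_def Let_def bet_def)
qed

lemma eval_Power:
  assumes U: "segment U" "\<And>i. e i \<in> U" and "\<Y> \<noteq> {}"
  shows "eval (ring_str U \<Y>) e S (Power x y z) \<longleftrightarrow>
    (\<exists>a\<in>U. \<exists>b\<in>U. pow_code (tval (ring_str U \<Y>) e x) (tval (ring_str U \<Y>) e y) (tval (ring_str U \<Y>) e z) a b)"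
proof -
  let ?M = "ring_str U \<Y>"
  let ?t = "tval ?M e"
  have t: "?t s \<in> U" for s
    using tval_in[OF segment_wf[OF U(1) assms(3)], of e s] U(2) by simp
  have *: "(\<forall>i\<in>U. i < y \<longrightarrow> (\<exists>v\<in>U. v < a + 1 \<and> P i v)) \<longleftrightarrow> (\<forall>i\<in>{0..<y}. \<exists>v\<in>{0..a}. P i v)"
    if "y \<in> U" "a \<in> U" for y a P
  proof -
    have "i \<in> {0..<y} \<longleftrightarrow> i \<in> U \<and> i < y" for i
      using segmentD(6)[OF U(1) that(1), of i] segmentD(1)[OF U(1), of i] by auto
    moreover have "v \<in> {0..a} \<longleftrightarrow> v \<in> U \<and> v < a + 1" for v
      using segmentD(6)[OF U(1) that(2), of v] segmentD(1)[OF U(1), of v] less_plus_one[of v a] by auto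
    ultimately show ?thesis unfolding Ball_def Bex_def by meson
  qed
  have e: "case_nat a f i \<in> U" if "a \<in> U" "\<And>i. f i \<in> U" for a f i
    using that by (rule case_nat_in)
  have "eval ?M (case_nat b (case_nat a e)) S
      (And (Beta (Var 1) (Var 0) Zero One)
        (And
          (AllN (Imp (Less (Var 0) (tlift (tlift (tlift y))))
            (ExN (And (Less (Var 0) (Add (Var 3) One))
              (And (Beta (Var 3) (Var 2) (Var 1) (Var 0))
                   (Beta (Var 3) (Var 2) (Add (Var 1) One) (Mul (Var 0) (tlift (tlift (tlift (tlift x)))))))))))
          (Beta (Var 1) (Var 0) (tlift (tlift y)) (tlift (tlift z)))))
    \<longleftrightarrow> pow_code (?t x) (?t y) (?t z) a b" if "a \<in> U" "b \<in> U" for a b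
    using *[OF t[of y] that(1), of "\<lambda>i v. bet a b i v \<and> bet a b (i + 1) (v * ?t x)"] that
    by (simp add: eval_Beta[OF U(1) _ assms(3)] e U(2) pow_code_def eval_nat_numeral)
  then show ?thesis by (simp add: Power_def Let_def)
qed

lemma eval_exp_axiom:
  assumes U: "segment U" "\<And>i. e i \<in> U" and "\<Y> \<noteq> {}"
  shows "eval (ring_str U \<Y>) e S exp_axiom \<longleftrightarrow>
    (\<forall>x\<in>U. \<forall>y\<in>U. \<exists>z\<in>U. \<exists>a\<in>U. \<exists>b\<in>U. pow_code x y z a b)"
  by (simp add: exp_axiom_def eval_Power[OF U(1) _ assms(3)] U(2) case_nat_in eval_nat_numeral)

lemma pow_code_ex:
  assumes "0 \<le> x" "0 \<le> y"
  shows "\<exists>z\<ge>0. \<exists>a\<ge>0. \<exists>b\<ge>0. pow_code x y z a (b :: 'a)"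
proof -
  obtain Y where Y: "Y \<in> \<X>" using nonempty by blast
  have "eval MM (\<lambda>_. 0) (\<lambda>_. Y) exp_axiom"
    by (rule modelsD[OF RCA]) (simp_all add: RCA0_star_def Y)
  then have "\<forall>x\<in>{0..}. \<forall>y\<in>{0..}. \<exists>z\<in>{0..}. \<exists>a\<in>{0..}. \<exists>b\<in>{0..}. pow_code x y z a (b :: 'a)"
    by (subst (asm) eval_exp_axiom[OF segment_UNIV _ nonempty]) auto
  from this[rule_format, of x y] assms show ?thesis by (simp add: Bex_def)
qed

lemma pow_code_step:
  "pow_code x y z a b \<Longrightarrow> i \<in> {0..<y} \<Longrightarrow> \<exists>v\<in>{0..a}. bet a b i v \<and> bet a b (i + 1) (v * x)"
  by (simp add: pow_code_def)

text \<open>Many pairs code the same sequence, so codes are compared entry by entry. The bound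
  \<open>v \<le> a\<close> keeps the induction formula bounded.\<close>

lemma pow_code_agree:
  assumes "pow_code x y z a b" "pow_code x y' z' a' b'" "y \<le> y'" "0 \<le> y"
    and ab: "0 \<le> a" "0 \<le> b" "0 \<le> a'" "0 \<le> b'" and i: "0 \<le> i" "i \<le> y"
  shows "\<exists>v\<in>{0..a}. bet a b i v \<and> bet a' b' i (v :: 'a)"
  using i
proof (induct i rule: D_induct_le)
  case D
  show ?case by (intro D_rules D_bet ab)
next
  case zero
  then show ?case using assms(1,2) bet_le[of b 0 a 1] ab
    by (auto simp: pow_code_def intro!: bexI[of _ 1])
next
  case (Suc i)
  then obtain v where v: "bet a b i v" "bet a' b' i v" by blast
  moreover obtain w where w: "bet a b i w" "bet a b (i + 1) (w * x)"
    using pow_code_step[OF assms(1), of i] Suc by auto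
  moreover obtain w' where "bet a' b' i w'" "bet a' b' (i + 1) (w' * x)"
    using pow_code_step[OF assms(2), of i] assms(3) Suc by auto
  ultimately have "bet a b (i + 1) (v * x)" "bet a' b' (i + 1) (v * x)"
    using bet_unique by metis+
  moreover from this have "v * x \<in> {0..a}" using bet_le[of b "i + 1" a "v * x"] ab Suc by (auto simp: bet_def)
  ultimately show ?case by blast
qed

lemma pow_code_unique:
  assumes "pow_code x y z a b" "pow_code x y z' a' b'" "0 \<le> y"
    and "0 \<le> a" "0 \<le> b" "0 \<le> a'" "0 \<le> b'"
  shows "z = (z' :: 'a)"
  using pow_code_agree[OF assms(1,2) order_refl assms(3-7) assms(3) order_refl] assms(1,2) bet_unique
  unfolding pow_code_def by metis

definition pw :: "'a \<Rightarrow> 'a \<Rightarrow> 'a" where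
  "pw x y = (THE z. \<exists>a\<ge>0. \<exists>b\<ge>0. pow_code x y z a b)"

lemma pw_eqI: "pow_code x y z a b \<Longrightarrow> 0 \<le> y \<Longrightarrow> 0 \<le> a \<Longrightarrow> 0 \<le> b \<Longrightarrow> pw x y = z"
  unfolding pw_def by (rule the_equality) (auto intro: pow_code_unique)

lemma pw_code:
  assumes "0 \<le> x" "0 \<le> y"
  obtains a b where "0 \<le> a" "0 \<le> b" "pow_code x y (pw x y) a b"
  using pow_code_ex[OF assms] pw_eqI assms(2) by metis

lemma pw_nonneg: "0 \<le> x \<Longrightarrow> 0 \<le> y \<Longrightarrow> 0 \<le> pw x y"
  by (erule (1) pw_code) (auto simp: pow_code_def bet_def)

lemma pw_0: "0 \<le> x \<Longrightarrow> pw x 0 = 1"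
  using pw_code[of x 0] bet_unique unfolding pow_code_def by (metis order_refl)

lemma pw_Suc:
  assumes "0 \<le> x" "0 \<le> y" shows "pw x (y + 1) = pw x y * x"
proof -
  obtain a b where ab: "0 \<le> a" "0 \<le> b" "pow_code x (y + 1) (pw x (y + 1)) a b"
    using pw_code[of x "y + 1"] assms by auto
  obtain v where v: "bet a b y v" "bet a b (y + 1) (v * x)"
    using pow_code_step[OF ab(3), of y] assms by auto
  then have "pow_code x y v a b" using ab(3) unfolding pow_code_def by auto
  then have "pw x y = v" using assms ab by (intro pw_eqI)
  moreover have "pw x (y + 1) = v * x" using v ab(3) bet_unique unfolding pow_code_def by metis
  ultimately show ?thesis by simp
qed

text \<open>The graph is Delta_1: some code ends in \<open>z\<close>, equivalently every code does,
  because codes exist and agree on their last entry. A single stage \<open>w\<close> bounds both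
  components of the code.\<close>

lemma D_pw0: "D (\<lambda>e. pw (e 0) (e 1) = e 2)"
proof (rule D_of_delta1_3)
  have F: "D (\<lambda>e. pow_code (e i) (e j) (e k) (e l) (e m))" for i j k l m
    unfolding pow_code_def by (intro D_rules D_bet)
  show "D (\<lambda>e. \<exists>a\<in>{0..e 3}. \<exists>b\<in>{0..e 3}. pow_code (e 0) (e 1) (e 2) a b)"
    by (intro D_rules F)
  show "D (\<lambda>e. \<forall>a\<in>{0..e 3}. \<forall>b\<in>{0..e 3}. \<forall>z'\<in>{0..e 3}. pow_code (e 0) (e 1) z' a b \<longrightarrow> z' = e 2)"
    by (intro D_rules F)
  fix x y z :: 'a assume xy: "0 \<le> x" "0 \<le> y" and z: "0 \<le> z"
  obtain a b where ab: "0 \<le> a" "0 \<le> b" "pow_code x y (pw x y) a b" by (rule pw_code[OF xy])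
  show "pw x y = z \<longleftrightarrow> (\<exists>w\<ge>0. \<exists>a\<in>{0..w}. \<exists>b\<in>{0..w}. pow_code x y z a b)"
  proof
    assume "pw x y = z"
    then show "\<exists>w\<ge>0. \<exists>a\<in>{0..w}. \<exists>b\<in>{0..w}. pow_code x y z a b" using ab
      by (intro exI[of _ "max a b"] conjI bexI[of _ a] bexI[of _ b]) auto
  qed (use xy pw_eqI in auto)
  show "pw x y = z \<longleftrightarrow> (\<forall>w\<ge>0. \<forall>a\<in>{0..w}. \<forall>b\<in>{0..w}. \<forall>z'\<in>{0..w}. pow_code x y z' a b \<longrightarrow> z' = z)"
  proof
    assume *: "\<forall>w\<ge>0. \<forall>a\<in>{0..w}. \<forall>b\<in>{0..w}. \<forall>z'\<in>{0..w}. pow_code x y z' a b \<longrightarrow> z' = z"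
    have "0 \<le> pw x y" using pw_nonneg xy by simp
    then show "pw x y = z" using *[rule_format, of "max a (max b (pw x y))" a b "pw x y"] ab by simp
  qed (use xy pw_eqI in auto)
qed

lemmas D_pw = dlt_subst3[OF D_pw0]

text \<open>\<open>pw\<close> is not a term, so \<open>dlt_subst\<close> cannot insert it; its graph
  can, read once existentially and once universally. Exponential expressions thereby become usable
  as bounds in induction formulas.\<close>

lemma D_pw_fun:
  assumes "D (\<lambda>e. R (e 0) (e 1))" "0 \<le> x"
  shows "D (\<lambda>e. R (e 0) (pw x (e 0)))"
proof (rule D_of_delta1)
  show "D (\<lambda>e. pw x (e 0) = e 1 \<and> R (e 0) (e 1))" by (intro D_rules D_pw assms)
  show "D (\<lambda>e. pw x (e 0) = e 1 \<longrightarrow> R (e 0) (e 1))" by (intro D_rules D_pw assms)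
qed (use pw_nonneg[OF assms(2)] in auto)

lemma pw_ge_one:
  assumes "1 \<le> x" "0 \<le> y" shows "1 \<le> pw x y"
  using assms(2)
proof (induct y rule: D_induct)
  case D
  show ?case using assms(1) by (intro D_pw_fun) (auto intro!: D_rules)
next
  case zero
  show ?case using assms(1) by (simp add: pw_0)
next
  case (Suc y)
  then have "1 * 1 \<le> pw x y * x" using assms(1) by (intro mult_mono) auto
  then show ?case using Suc assms(1) by (simp add: pw_Suc)
qed

lemma pw_mono_right:
  assumes "1 \<le> x" "0 \<le> y" "y \<le> y'" shows "pw x y \<le> pw x y'"
proof -
  have "y \<le> y' \<longrightarrow> pw x y \<le> pw x y'"
    using order_trans[OF assms(2,3)]
  proof (induct y' rule: D_induct)
    case D
    have "D (\<lambda>e. (\<lambda>y' z. y \<le> y' \<longrightarrow> pw x y \<le> z) (e 0) (e 1))"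
      using assms pw_nonneg[of x y] by (intro D_rules) auto
    from D_pw_fun[OF this] show ?case using assms(1) by simp
  next
    case zero
    then show ?case using assms(2) by auto
  next
    case (Suc z)
    have "pw x z * 1 \<le> pw x z * x" using assms(1) Suc pw_nonneg[of x z] by (intro mult_left_mono) auto
    then have "pw x z \<le> pw x (z + 1)" using Suc assms(1) by (simp add: pw_Suc)
    then show ?case using Suc less_plus_one[of y z] by (cases "y = z + 1") auto
  qed
  then show ?thesis using assms(3) by simp
qed

lemma pw_mono_left:
  assumes "0 \<le> x" "x \<le> x'" "0 \<le> y" shows "pw x y \<le> pw x' y"
proof -
  \<comment> \<open>\<open>D_pw_fun\<close> inserts one of the two powers; the other enters through
    its graph, with its value bounded by the first.\<close>
  have "\<exists>z\<in>{0..pw x' y}. pw x y = z" using assms(3)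
  proof (induct y rule: D_induct)
    case D
    have "D (\<lambda>e. (\<lambda>y w. \<exists>z\<in>{0..w}. pw x y = z) (e 0) (e 1))"
      using assms by (intro D_rules D_pw)
    from D_pw_fun[OF this, of x'] show ?case using assms by simp
  next
    case zero
    show ?case using assms by (simp add: pw_0)
  next
    case (Suc y)
    then have "pw x y * x \<le> pw x' y * x'" using assms pw_nonneg[of x y] by (intro mult_mono) auto
    then show ?case using Suc assms pw_nonneg[of x y] by (simp add: pw_Suc)
  qed
  then show ?thesis by auto
qed

section \<open>Coding by remainders\<close>

lemma D_inv_mod:
  assumes "T t" "T u" shows "D (\<lambda>e. inv_mod (t e) (1 + u e))"
proof -
  have "D (\<lambda>e. (\<lambda>c m. \<exists>r\<in>{0..<1 + m}. (1 + m) dvd r * c + 1) (e 0) (e 1))"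
    by (intro D_rules D_dvd)
  from dlt_subst2[OF this assms] show ?thesis
    by (rule dlt_cong) (use T_nonneg[OF assms(2)] inv_mod_iff_bounded in \<open>simp add: add_pos_nonneg\<close>)
qed

text \<open>Each step multiplies by \<open>k + 1\<close>, so \<open>b\<close> plays the part of a
  factorial. The explicit bound keeps the induction formula bounded, and later it places the
  multiple inside a cut closed under \<open>pw\<close>.\<close>

lemma common_multiple:
  assumes "0 \<le> n"
  shows "\<exists>b. 1 \<le> b \<and> b \<le> pw (n + 1) n \<and> (\<forall>j\<in>{0..n}. 1 \<le> j \<longrightarrow> j dvd b)"
proof -
  have "\<exists>b\<in>{0..pw (n + 1) k}. 1 \<le> b \<and> (\<forall>j\<in>{0..k}. 1 \<le> j \<longrightarrow> j dvd b)" if "0 \<le> k" "k \<le> n" for k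
    using that
  proof (induct k rule: D_induct_le)
    case D
    have "D (\<lambda>e. (\<lambda>k z. \<exists>b\<in>{0..z}. 1 \<le> b \<and> (\<forall>j\<in>{0..k}. 1 \<le> j \<longrightarrow> j dvd b)) (e 0) (e 1))"
      by (intro D_rules D_dvd)
    from D_pw_fun[OF this, of "n + 1"] show ?case using assms by simp
  next
    case zero
    show ?case using assms by (auto simp: pw_0 intro!: bexI[of _ 1])
  next
    case (Suc k)
    then obtain b where b: "b \<le> pw (n + 1) k" "1 \<le> b" "\<forall>j\<in>{0..k}. 1 \<le> j \<longrightarrow> j dvd b" by auto
    have "b * (k + 1) \<le> pw (n + 1) k * (n + 1)" using b Suc by (intro mult_mono) auto
    then have "b * (k + 1) \<le> pw (n + 1) (k + 1)" using Suc assms by (simp add: pw_Suc)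
    moreover have "1 * 1 \<le> b * (k + 1)" using b Suc by (intro mult_mono) auto
    moreover have "j dvd b * (k + 1)" if "j \<in> {0..k + 1}" "1 \<le> j" for j
    proof (cases "j = k + 1")
      case False
      then have "j \<in> {0..k}" using that less_plus_one[of j k] by auto
      then show ?thesis using b(3) that by simp
    qed simp
    ultimately show ?case by (intro bexI[of _ "b * (k + 1)"]) auto
  qed
  from this[of n] show ?thesis using assms by auto
qed

lemma beta_inv:
  assumes "0 \<le> n" "\<forall>j\<in>{0..n}. 1 \<le> j \<longrightarrow> j dvd b" "i \<in> {0..<n}" "j \<in> {0..<n}" "i \<noteq> j"
  shows "inv_mod (1 + (i + 1) * b) (1 + (j + 1) * (b :: 'a))"
proof (rule beta_moduli_coprime)
  show "(j - i) dvd b"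
  proof (cases "i < j")
    case True
    then show ?thesis using assms less_iff_le[of i j] by (intro assms(2)[rule_format]) (auto simp: algebra_simps)
  next
    case False
    then have "(i - j) dvd b" using assms less_iff_le[of j i]
      by (intro assms(2)[rule_format]) (auto simp: algebra_simps)
    then show ?thesis by (metis minus_diff_eq minus_dvd_iff)
  qed
qed

text \<open>Induction on the number \<open>k\<close> of congruences already solved, carrying a
  common multiple \<open>P\<close> of the first \<open>k\<close> moduli, still invertible modulo the
  later ones, and a solution \<open>a\<close> below it. The bound \<open>pw ?B k\<close> keeps the
  statement bounded. Every modulus exceeds \<open>b\<close>, so the values are genuine
  remainders.\<close>

lemma chinese_remainder:
  assumes n: "0 \<le> n" and b: "1 \<le> b" "\<forall>j\<in>{0..n}. 1 \<le> j \<longrightarrow> j dvd b"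
    and F: "D (\<lambda>e. F (e 0) (e 1))" "\<forall>i\<in>{0..<n}. \<exists>v\<in>{0..b}. F i v"
  shows "\<exists>P a. 0 \<le> a \<and> a < P \<and> P \<le> pw (1 + (n + 1) * b) n \<and>
    (\<forall>i\<in>{0..<n}. (1 + (i + 1) * b) dvd P \<and> (\<exists>v\<in>{0..b}. F i v \<and> bet a b i v))"
proof -
  let ?B = "1 + (n + 1) * b"
  have b0: "0 \<le> b" using b by simp
  have B: "1 \<le> ?B" using n b by simp
  let ?C = "\<lambda>k z. \<exists>P\<in>{0..z}. \<exists>a\<in>{0..<P}.
      (\<forall>i\<in>{0..<k}. (1 + (i + 1) * b) dvd P \<and> (\<exists>v\<in>{0..b}. F i v \<and> bet a b i v)) \<and>
      (\<forall>j\<in>{0..<n}. k \<le> j \<longrightarrow> inv_mod P (1 + (j + 1) * b))"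
  have "?C k (pw ?B k)" if "0 \<le> k" "k \<le> n" for k
    using that
  proof (induct k rule: D_induct_le)
    case D
    have "D (\<lambda>e. ?C (e 0) (e 1))"
      by (intro D_rules D_dvd D_bet D_inv_mod dlt_subst2[OF F(1)] b0 n)
    from D_pw_fun[OF this, of ?B] show ?case using B by simp
  next
    case zero
    show ?case using B by (intro bexI[of _ 1] bexI[of _ 0]) (auto simp: pw_0 inv_mod_one)
  next
    case (Suc k)
    then obtain P a where P: "P \<in> {0..pw ?B k}" "a \<in> {0..<P}"
      and Pi: "\<And>i. i \<in> {0..<k} \<Longrightarrow> (1 + (i + 1) * b) dvd P"
      and ai: "\<And>i. i \<in> {0..<k} \<Longrightarrow> \<exists>v\<in>{0..b}. F i v \<and> bet a b i v"
      and Pj: "\<And>j. j \<in> {0..<n} \<Longrightarrow> k \<le> j \<Longrightarrow> inv_mod P (1 + (j + 1) * b)" by blast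
    let ?m = "1 + (k + 1) * b"
    have m: "1 \<le> ?m" "0 < ?m" "?m \<le> ?B" using Suc b0 n
      by (auto intro!: mult_right_mono add_pos_nonneg)
    have kn: "k \<in> {0..<n}" using Suc by simp
    obtain v where v: "v \<in> {0..b}" "F k v" using F(2) kn by blast
    \<comment> \<open>Modulo \<open>?m\<close> the product \<open>u * P\<close> is -1, so adding
      \<open>P * t\<close> with \<open>t\<close> congruent to \<open>u * (a - v)\<close> turns
      \<open>a\<close> into \<open>v\<close>. Taking \<open>t\<close> below \<open>?m\<close> keeps
      the new solution below \<open>P * ?m\<close>, and the earlier remainders survive because their
      moduli divide \<open>P\<close>.\<close>
    obtain u where u: "?m dvd u * P + 1" using Pj[OF kn order_refl] by (auto simp: inv_mod_def)
    obtain q t where t: "u * (a - v) = q * ?m + t" "0 \<le> t" "t < ?m" using euclid[OF m(2)] by metis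
    define a' where "a' = a + P * t"
    have "a' - v = (u * P + 1) * (a - v) - ?m * (P * q)"
    proof -
      have "t = u * (a - v) - q * ?m" using t(1) by simp
      then show ?thesis unfolding a'_def by (simp only:) (simp add: algebra_simps)
    qed
    then have a'v: "?m dvd a' - v" using u by (metis dvd_diff dvd_mult2 dvd_triv_left)
    have P0: "0 < P" using P by auto
    have a'0: "0 \<le> a'" using P P0 t by (simp add: a'_def)
    have "a' < P * ?m"
    proof -
      have "t + 1 \<le> ?m" using t less_iff_le[of t ?m] by simp
      then have "P * (t + 1) \<le> P * ?m" using P0 by (intro mult_left_mono) auto
      then show ?thesis using P unfolding a'_def by (simp add: algebra_simps)
    qed
    moreover have "P * ?m \<le> pw ?B (k + 1)"
    proof -
      have "P * ?m \<le> pw ?B k * ?B" using P m by (intro mult_mono) auto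
      then show ?thesis using Suc B by (simp add: pw_Suc)
    qed
    moreover have "(1 + (i + 1) * b) dvd P * ?m \<and> (\<exists>v\<in>{0..b}. F i v \<and> bet a' b i v)" if i: "i \<in> {0..<k + 1}" for i
    proof (cases "i = k")
      case True
      have "b \<le> (k + 1) * b" using Suc(1) b0 mult_right_mono[of 1 "k + 1" b] by simp
      then have "v < ?m" using v by simp
      then have "bet a' b k v" using a'v v a'0 b0 Suc(1) by (simp add: bet_iff)
      then show ?thesis using True v by auto
    next
      case False
      then have ik: "i \<in> {0..<k}" using i less_plus_one[of i k] by auto
      obtain v where v: "v \<in> {0..b}" "F i v" "bet a b i v" using ai[OF ik] by blast
      have "(1 + (i + 1) * b) dvd a - v" using v(3) P b0 ik by (simp add: bet_iff)
      then have "(1 + (i + 1) * b) dvd (a - v) + P * t" using Pi[OF ik] by simp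
      moreover have "(a - v) + P * t = a' - v" by (simp add: a'_def)
      ultimately have "bet a' b i v" using v(3) a'0 P b0 ik by (simp add: bet_iff)
      then show ?thesis using v Pi[OF ik] by auto
    qed
    moreover have "inv_mod (P * ?m) (1 + (j + 1) * b)" if "j \<in> {0..<n}" "k + 1 \<le> j" for j
      using that by (intro inv_mod_mult Pj beta_inv[OF n b(2)] kn) auto
    moreover have "P * ?m \<in> {0..pw ?B (k + 1)}" "a' \<in> {0..<P * ?m}"
      using calculation(1,2) a'0 by auto
    ultimately show ?case by blast
  qed
  from this[OF n order_refl] obtain P a where "P \<in> {0..pw ?B n}" "a \<in> {0..<P}"
    "\<forall>i\<in>{0..<n}. (1 + (i + 1) * b) dvd P \<and> (\<exists>v\<in>{0..b}. F i v \<and> bet a b i v)" by blast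
  then show ?thesis by (intro exI[of _ P] exI[of _ a]) (simp only: atLeastAtMost_iff atLeastLessThan_iff simp_thms)
qed

text \<open>A pigeonhole principle by divisibility in place of counting. The moduli belonging to the
  images of the arguments below \<open>k\<close> are distinct, hence coprime, and each is at least
  2; multiplied together they give a divisor \<open>c\<close> of \<open>P\<close> with
  \<open>k < c\<close>. At \<open>k = P\<close> this contradicts \<open>c \<le> P\<close>.\<close>

lemma no_injection:
  assumes d: "0 \<le> d" and H: "D (\<lambda>e. H (e 0) (e 1))"
    and P: "0 < P" and b: "1 \<le> b" "\<forall>j\<in>{0..d}. 1 \<le> j \<longrightarrow> j dvd b"
      "\<forall>j\<in>{0..<d}. (1 + (j + 1) * b) dvd P"
    and tot: "\<And>x. x \<in> {0..P} \<Longrightarrow> \<exists>j\<in>{0..<d}. H x j"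
    and inj: "\<And>x x' j. x \<in> {0..P} \<Longrightarrow> x' \<in> {0..P} \<Longrightarrow> j \<in> {0..<d} \<Longrightarrow> H x j \<Longrightarrow> H x' j \<Longrightarrow> x = x'"
  shows False
proof -
  have b0: "0 \<le> b" using b by simp
  have P0: "0 \<le> P" using P by simp
  have "\<exists>c\<in>{0..P}. k < c \<and> c dvd P \<and> (\<forall>j\<in>{0..<d}. (\<forall>x\<in>{0..<k}. \<not> H x j) \<longrightarrow> inv_mod c (1 + (j + 1) * b))"
    if "0 \<le> k" "k \<le> P" for k
    using that
  proof (induct k rule: D_induct_le)
    case D
    show ?case by (intro D_rules D_dvd D_inv_mod dlt_subst2[OF H] b0 P0 d)
  next
    case zero
    show ?case using discrete[OF P] by (intro bexI[of _ 1]) (auto simp: inv_mod_one)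
  next
    case (Suc k)
    then obtain c where c: "c \<in> {0..P}" "k < c" "c dvd P"
      "\<And>j. j \<in> {0..<d} \<Longrightarrow> (\<forall>x\<in>{0..<k}. \<not> H x j) \<Longrightarrow> inv_mod c (1 + (j + 1) * b)" by blast
    have kP: "k \<in> {0..P}" using Suc by simp
    obtain j where j: "j \<in> {0..<d}" "H k j" using tot[OF kP] by blast
    let ?m = "1 + (j + 1) * b"
    have "inv_mod c ?m"
    proof (rule c(4)[OF j(1)], intro ballI notI)
      fix x assume "x \<in> {0..<k}" "H x j"
      then show False using inj[of x k j] kP j by auto
    qed
    moreover obtain q where q: "P = c * q" using c(3) by (elim dvdE)
    ultimately have "?m dvd q" using b(3) j(1) inv_mod_cancel by metis
    then have dvd: "c * ?m dvd P" unfolding q by (rule mult_dvd_mono[OF dvd_refl])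
    have "0 < c" using c(2) Suc(1) by simp
    have "b \<le> (j + 1) * b" using j(1) b0 mult_right_mono[of 1 "j + 1" b] by simp
    then have "2 \<le> ?m" using b(1) by linarith
    then have "c * 2 \<le> c * ?m" using \<open>0 < c\<close> by (intro mult_left_mono) auto
    moreover have "k + 1 \<le> c" "1 \<le> c" using c(2) less_iff_le[of k c] Suc(1) by auto
    moreover from this have "k + 1 < c * 2" by linarith
    ultimately have "k + 1 < c * ?m" by linarith
    moreover have "c * ?m \<in> {0..P}"
    proof -
      have "0 \<le> c * ?m" using \<open>0 < c\<close> b0 j(1) by simp
      then obtain r where r: "r \<in> {0..P}" "P = c * ?m * r" using dvd P0 dvd_iff_bounded by blast
      have "1 \<le> r" using r P discrete[of r] by (cases "r = 0") auto
      then have "c * ?m * 1 \<le> c * ?m * r" using \<open>0 \<le> c * ?m\<close> by (intro mult_left_mono)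
      then show ?thesis using \<open>0 \<le> c * ?m\<close> unfolding r(2)[symmetric] by simp
    qed
    moreover have "inv_mod (c * ?m) (1 + (i + 1) * b)"
      if i: "i \<in> {0..<d}" "\<forall>x\<in>{0..<k + 1}. \<not> H x i" for i
    proof (rule inv_mod_mult)
      show "inv_mod c (1 + (i + 1) * b)" using i by (intro c(4)) auto
      have "k \<in> {0..<k + 1}" using Suc(1) by simp
      then have "j \<noteq> i" using i(2) j(2) by blast
      then show "inv_mod ?m (1 + (i + 1) * b)" by (rule beta_inv[OF d b(2) j(1) i(1)])
    qed
    ultimately show ?case using dvd by blast
  qed
  from this[of P] P0 show False by auto
qed

text \<open>Two disjoint \<open>\<Sigma>\<^sub>1\<close> sets can be separated below \<open>d\<close>: at every stage some code below a fixed bound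
  works, and by collection one code works at all stages.\<close>

lemma separation:
  assumes d: "0 \<le> d" and W: "D (\<lambda>e. W (e 0) (e 1))" and V: "D (\<lambda>e. V (e 0) (e 1))"
    and disj: "\<And>t w w'. t \<in> {0..<d} \<Longrightarrow> 0 \<le> w \<Longrightarrow> 0 \<le> w' \<Longrightarrow> W t w \<Longrightarrow> V t w' \<Longrightarrow> False"
  shows "\<exists>Y\<in>\<X>. \<forall>t\<in>{0..<d}. \<forall>w\<ge>0. (W t w \<longrightarrow> t \<in> Y) \<and> (V t w \<longrightarrow> t \<notin> Y)"
proof -
  obtain b where b: "1 \<le> b" "\<forall>j\<in>{0..d}. 1 \<le> j \<longrightarrow> j dvd b" using common_multiple[OF d] by blast
  have b0: "0 \<le> b" using b by simp
  let ?E = "pw (1 + (d + 1) * b) d"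
  define bad where "bad a w \<longleftrightarrow> (\<exists>t\<in>{0..<d}. (\<exists>w'\<in>{0..w}. W t w') \<and> \<not> bet a b t 1 \<or> (\<exists>w'\<in>{0..w}. V t w') \<and> \<not> bet a b t 0)" for a w
  have Dbad: "D (\<lambda>e. bad (e 0) (e 1))"
    unfolding bad_def by (intro D_rules D_bet dlt_subst2[OF W] dlt_subst2[OF V] b0 d)
  have good: "\<exists>a\<in>{0..<?E}. \<not> bad a w" if w: "0 \<le> w" for w
  proof -
    let ?F = "\<lambda>t v. if \<exists>w'\<in>{0..w}. W t w' then v = 1 else v = 0"
    have "D (\<lambda>e. ((\<exists>w'\<in>{0..w}. W (e 0) w') \<longrightarrow> e 1 = 1) \<and> (\<not> (\<exists>w'\<in>{0..w}. W (e 0) w') \<longrightarrow> e 1 = 0))"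
      by (intro D_rules dlt_subst2[OF W] w)
    then have "D (\<lambda>e. ?F (e 0) (e 1))" by (rule dlt_cong) auto
    moreover have "\<forall>t\<in>{0..<d}. \<exists>v\<in>{0..b}. ?F t v"
    proof
      fix t
      show "\<exists>v\<in>{0..b}. ?F t v"
        by (cases "\<exists>w'\<in>{0..w}. W t w'") (use b in \<open>force intro: bexI[of _ 1]\<close>, use b0 in \<open>force intro: bexI[of _ 0]\<close>)
    qed
    ultimately obtain P a where a: "0 \<le> a" "a < P" "P \<le> ?E"
      "\<And>t. t \<in> {0..<d} \<Longrightarrow> \<exists>v\<in>{0..b}. ?F t v \<and> bet a b t v"
      using chinese_remainder[OF d b, of ?F] by blast
    have "\<not> bad a w" unfolding bad_def
    proof (intro notI, elim bexE disjE conjE)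
      fix t w' assume t: "t \<in> {0..<d}" and w': "w' \<in> {0..w}" "W t w'" "\<not> bet a b t 1"
      then have "\<exists>w'\<in>{0..w}. W t w'" by blast
      then show False using a(4)[OF t] w'(3) by auto
    next
      fix t w' assume t: "t \<in> {0..<d}" and w': "w' \<in> {0..w}" "V t w'" "\<not> bet a b t 0"
      then have "\<not> (\<exists>w'\<in>{0..w}. W t w')" using disj[OF t] by auto
      then show False using a(4)[OF t] w' by auto
    qed
    then show ?thesis using a by auto
  qed
  have "\<exists>a\<in>{0..<?E}. \<forall>w\<ge>0. \<not> bad a w"
  proof (rule ccontr)
    assume "\<not> ?thesis"
    moreover have "0 \<le> ?E" using pw_nonneg d b0 by simp
    ultimately obtain w where w: "0 \<le> w" "\<forall>a\<in>{0..<?E}. \<exists>y\<in>{0..w}. bad a y"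
      using collection[OF Dbad, of ?E] by blast
    obtain a where a: "a \<in> {0..<?E}" "\<not> bad a w" using good[OF w(1)] by blast
    then obtain y where "y \<in> {0..w}" "bad a y" using w by blast
    \<comment> \<open>A later stage can only make more codes bad, so the stage \<open>y\<close> may
      be raised to \<open>w\<close>.\<close>
    then have "bad a w" unfolding bad_def by (meson atLeastAtMost_iff order_trans)
    then show False using a by blast
  qed
  then obtain a where a: "0 \<le> a" "\<And>w. 0 \<le> w \<Longrightarrow> \<not> bad a w" by auto
  have "D (\<lambda>e. bet a b (e 0) 1)" by (intro D_rules D_bet a b0)
  then obtain Y where Y: "Y \<in> \<X>" "\<forall>x\<ge>0. x \<in> Y \<longleftrightarrow> bet a b x 1"
    using comprehension[of "\<lambda>x. bet a b x 1"] by blast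
  show ?thesis
  proof (intro bexI[OF _ Y(1)] ballI allI impI conjI)
    fix t w :: 'a assume t: "t \<in> {0..<d}" and w: "0 \<le> w"
    have "w \<in> {0..w}" using w by simp
    then have ok: "W t w \<Longrightarrow> bet a b t 1" "V t w \<Longrightarrow> bet a b t 0"
      using a(2)[OF w] t unfolding bad_def by blast+
    show "t \<in> Y" if "W t w" using ok(1) that t Y(2) by simp
    show "t \<notin> Y" if "V t w"
    proof
      assume "t \<in> Y"
      then have "bet a b t 1" using Y(2) t by simp
      moreover have "bet a b t 0" using ok(2) that .
      ultimately show False using bet_unique by fastforce
    qed
  qed
qed

end

section \<open>Definable cuts\<close>

context rca
begin

text \<open>\<open>K x w\<close> reads: \<open>x\<close> has entered the cut by stage
  \<open>w\<close>. Monotonicity in \<open>w\<close> lets several stages be replaced by their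
  maximum; the last clause makes the cut proper.\<close>

definition sigma_cut :: "('a \<Rightarrow> 'a \<Rightarrow> bool) \<Rightarrow> bool" where
  "sigma_cut K \<longleftrightarrow> D (\<lambda>e. K (e 0) (e 1)) \<and>
     (\<forall>x y w. 0 \<le> x \<longrightarrow> x \<le> y \<longrightarrow> 0 \<le> w \<longrightarrow> K y w \<longrightarrow> K x w) \<and>
     (\<forall>x w w'. 0 \<le> x \<longrightarrow> 0 \<le> w \<longrightarrow> w \<le> w' \<longrightarrow> K x w \<longrightarrow> K x w') \<and>
     (\<exists>w\<ge>0. K 0 w) \<and>
     (\<forall>x w. 0 \<le> x \<longrightarrow> 0 \<le> w \<longrightarrow> K x w \<longrightarrow> (\<exists>w'\<ge>0. K (x + 1) w')) \<and>
     (\<exists>d\<ge>0. \<forall>w\<ge>0. \<not> K d w)"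

definition cut_set :: "('a \<Rightarrow> 'a \<Rightarrow> bool) \<Rightarrow> 'a set" where
  "cut_set K = {x. 0 \<le> x \<and> (\<exists>w\<ge>0. K x w)}"

lemma sigma_cutI:
  assumes "D (\<lambda>e. K (e 0) (e 1))"
    and "\<And>x y w. 0 \<le> x \<Longrightarrow> x \<le> y \<Longrightarrow> 0 \<le> w \<Longrightarrow> K y w \<Longrightarrow> K x w"
    and "\<And>x w w'. 0 \<le> x \<Longrightarrow> 0 \<le> w \<Longrightarrow> w \<le> w' \<Longrightarrow> K x w \<Longrightarrow> K x w'"
    and "\<exists>w\<ge>0. K 0 w"
    and "\<And>x w. 0 \<le> x \<Longrightarrow> 0 \<le> w \<Longrightarrow> K x w \<Longrightarrow> \<exists>w'\<ge>0. K (x + 1) w'"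
    and "0 \<le> d" "\<And>w. 0 \<le> w \<Longrightarrow> \<not> K d w"
  shows "sigma_cut K"
  unfolding sigma_cut_def using assms by blast

lemma
  assumes "sigma_cut K"
  shows sigma_cut_D: "D (\<lambda>e. K (e 0) (e 1))"
    and sigma_cut_mono: "0 \<le> x \<Longrightarrow> 0 \<le> w \<Longrightarrow> w \<le> w' \<Longrightarrow> K x w \<Longrightarrow> K x w'"
    and sigma_cut_anti: "0 \<le> x \<Longrightarrow> x \<le> y \<Longrightarrow> 0 \<le> w \<Longrightarrow> K y w \<Longrightarrow> K x w"
    and cut_zero: "0 \<in> cut_set K"
    and cut_Suc: "x \<in> cut_set K \<Longrightarrow> x + 1 \<in> cut_set K"
    and cut_down: "y \<in> cut_set K \<Longrightarrow> 0 \<le> x \<Longrightarrow> x \<le> y \<Longrightarrow> x \<in> cut_set K"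
    and cut_nonneg: "x \<in> cut_set K \<Longrightarrow> 0 \<le> x"
    and cut_proper: "\<exists>d\<ge>0. d \<notin> cut_set K"
proof -
  show "D (\<lambda>e. K (e 0) (e 1))" using assms unfolding sigma_cut_def by blast
  show "0 \<le> x \<Longrightarrow> 0 \<le> w \<Longrightarrow> w \<le> w' \<Longrightarrow> K x w \<Longrightarrow> K x w'"
    using assms unfolding sigma_cut_def by blast
  show *: "0 \<le> x \<Longrightarrow> x \<le> y \<Longrightarrow> 0 \<le> w \<Longrightarrow> K y w \<Longrightarrow> K x w" for x y w
    using assms unfolding sigma_cut_def by blast
  show "0 \<in> cut_set K" using assms unfolding sigma_cut_def cut_set_def by simp
  show "x + 1 \<in> cut_set K" if "x \<in> cut_set K"
  proof -
    from that obtain w where w: "0 \<le> x" "0 \<le> w" "K x w" unfolding cut_set_def by blast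
    then have "\<exists>w'\<ge>0. K (x + 1) w'" using assms unfolding sigma_cut_def by blast
    then show ?thesis using w(1) unfolding cut_set_def by simp
  qed
  show "x \<in> cut_set K" if "y \<in> cut_set K" "0 \<le> x" "x \<le> y"
  proof -
    from that(1) obtain w where "0 \<le> w" "K y w" unfolding cut_set_def by blast
    then show ?thesis using *[OF that(2,3)] that(2) unfolding cut_set_def by blast
  qed
  show "x \<in> cut_set K \<Longrightarrow> 0 \<le> x" unfolding cut_set_def by blast
  have "\<exists>d\<ge>0. \<forall>w\<ge>0. \<not> K d w" using assms unfolding sigma_cut_def by (elim conjE)
  then show "\<exists>d\<ge>0. d \<notin> cut_set K" unfolding cut_set_def by blast
qed

lemma cut_less: "sigma_cut K \<Longrightarrow> x \<in> cut_set K \<Longrightarrow> 0 \<le> d \<Longrightarrow> d \<notin> cut_set K \<Longrightarrow> x < d"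
  using cut_down[of K x d] by (cases "x < d") auto

text \<open>Quantifying over all \<open>x'\<close> up to \<open>x\<close> forces downward closure, a
  common bound on the witnesses gives monotonicity in the stage, and the failure at \<open>d\<close>
  gives properness.\<close>

lemma sigma_cut_of_failure:
  assumes \<theta>: "D (\<lambda>e. \<theta> (e 0) (e 1))" and z: "\<exists>y\<ge>0. \<theta> 0 y"
    and s: "\<And>x. 0 \<le> x \<Longrightarrow> \<exists>y\<ge>0. \<theta> x y \<Longrightarrow> \<exists>y\<ge>0. \<theta> (x + 1) y"
    and f: "0 \<le> d" "\<not> (\<exists>y\<ge>0. \<theta> d y)"
  shows "sigma_cut (\<lambda>x w. \<forall>x'\<in>{0..x}. \<exists>y\<in>{0..w}. \<theta> x' y)" (is "sigma_cut ?K")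
proof (rule sigma_cutI)
  show "D (\<lambda>e. ?K (e 0) (e 1))" by (intro D_rules dlt_subst2[OF \<theta>])
  obtain y where "0 \<le> y" "\<theta> 0 y" using z by blast
  then show "\<exists>w\<ge>0. ?K 0 w" by (intro exI[of _ y]) auto
  show "0 \<le> d" by fact
  show "\<not> ?K d w" if "0 \<le> w" for w
  proof
    assume "?K d w"
    then have "\<exists>y\<in>{0..w}. \<theta> d y" using f(1) by simp
    then show False using f(2) by auto
  qed
  show "?K x w" if "0 \<le> x" "x \<le> y" "?K y w" for x y w using that by auto
  show "?K x w'" if w: "w \<le> w'" "?K x w" for x w w'
  proof
    fix x' assume "x' \<in> {0..x}"
    then obtain y where "y \<in> {0..w}" "\<theta> x' y" using w(2) by blast
    then show "\<exists>y\<in>{0..w'}. \<theta> x' y" using w(1) by (intro bexI[of _ y]) auto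
  qed
  show "\<exists>w'\<ge>0. ?K (x + 1) w'" if x: "0 \<le> x" "0 \<le> w" "?K x w" for x w
  proof -
    have "x \<in> {0..x}" using x(1) by simp
    then have "\<exists>y\<in>{0..w}. \<theta> x y" using x(3) by blast
    then have "\<exists>y\<ge>0. \<theta> x y" by auto
    then obtain y where y: "0 \<le> y" "\<theta> (x + 1) y" using s[OF x(1)] by blast
    have "\<exists>v\<in>{0..max w y}. \<theta> x' v" if x': "x' \<in> {0..x + 1}" for x'
    proof (cases "x' = x + 1")
      case True
      then show ?thesis using y by (intro bexI[of _ y]) auto
    next
      case False
      then have "x' \<in> {0..x}" using x' less_plus_one[of x' x] by auto
      then obtain v where "v \<in> {0..w}" "\<theta> x' v" using x(3) by blast
      then show ?thesis by (intro bexI[of _ v]) auto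
    qed
    then show ?thesis using x(2) y(1) by (intro exI[of _ "max w y"]) auto
  qed
qed

text \<open>A beta code for \<open>k\<close> iterations of
  \<open>v \<mapsto> pw (v + 2) (v + 2)\<close> from 0. One iteration dominates sum, product and
  power of arguments up to \<open>v\<close>, by \<open>pw_big\<close>. Exponentiation is total but
  its iteration need not be, so the lengths that have a code may form a proper cut.\<close>

definition hyper :: "'a \<Rightarrow> 'a \<Rightarrow> 'a \<Rightarrow> bool" where
  "hyper a b k \<longleftrightarrow> bet a b 0 0 \<and> (\<forall>i\<in>{0..<k}. \<exists>v\<in>{0..a}. \<exists>v'\<in>{0..a}.
     bet a b i v \<and> bet a b (i + 1) v' \<and> pw (v + 2) (v + 2) = v')"

lemma hyper_step:
  "hyper a b k \<Longrightarrow> i \<in> {0..<k} \<Longrightarrow> \<exists>v\<in>{0..a}. bet a b i v \<and> bet a b (i + 1) (pw (v + 2) (v + 2))"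
  unfolding hyper_def by blast

lemma bet_nonneg: "bet a b i r \<Longrightarrow> 0 \<le> r"
  by (simp add: bet_def)

lemma bet_ex:
  assumes "0 \<le> a" "0 \<le> b" "0 \<le> i" shows "\<exists>r\<in>{0..a}. bet a b i (r :: 'a)"
proof -
  have "0 < 1 + (i + 1) * b" using assms by (intro add_pos_nonneg) auto
  from euclid_nonneg[OF assms(1) this] obtain q r where
    "q \<in> {0..a}" "r \<in> {0..<1 + (i + 1) * b}" "a = q * (1 + (i + 1) * b) + r" by blast
  then have r: "bet a b i r" unfolding bet_def by auto
  then have "r \<in> {0..a}" using bet_le[OF assms(2,3) r] by (simp add: bet_def)
  then show ?thesis using r by blast
qed

text \<open>The remainders of \<open>a\<close> leave no freedom for a further entry, so the old
  entries and the new value are coded afresh with a larger \<open>b'\<close>.\<close>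

lemma hyper_extend:
  assumes h: "hyper a b k" and nn: "0 \<le> a" "0 \<le> b" "0 \<le> k"
  shows "\<exists>a'\<ge>0. \<exists>b'\<ge>0. hyper a' b' (k + 1)"
proof -
  obtain h where hk: "h \<in> {0..a}" "bet a b k h" using bet_ex[OF nn] by blast
  define h' where "h' = pw (h + 2) (h + 2)"
  have h'0: "0 \<le> h'" unfolding h'_def using hk by (intro pw_nonneg) auto
  have n: "0 \<le> k + 2" using nn by simp
  obtain b0 where b0: "1 \<le> b0" "\<forall>j\<in>{0..k + 2}. 1 \<le> j \<longrightarrow> j dvd b0"
    using common_multiple[OF n] by blast
  \<comment> \<open>The factor \<open>a + h' + 1\<close> makes \<open>b'\<close> exceed the old
    entries, which are at most \<open>a\<close>, as well as the new one; the factor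
    \<open>b0\<close> makes the moduli coprime.\<close>
  define b' where "b' = b0 * (a + h' + 1)"
  have b': "a + h' + 1 \<le> b'" "\<forall>j\<in>{0..k + 2}. 1 \<le> j \<longrightarrow> j dvd b'"
    using b0 nn h'0 mult_right_mono[of 1 b0 "a + h' + 1"] by (auto simp: b'_def)
  have b'0: "0 \<le> b'" "1 \<le> b'" using b'(1) nn h'0 by auto
  let ?F = "\<lambda>i v. (i \<le> k \<and> bet a b i v) \<or> (i = k + 1 \<and> v = h')"
  have "D (\<lambda>e. ?F (e 0) (e 1))" by (intro D_rules D_bet nn h'0) (use nn in auto)
  moreover have "\<exists>v\<in>{0..b'}. ?F i v" if i: "i \<in> {0..<k + 2}" for i
  proof (cases "i \<le> k")
    case True
    have "0 \<le> i" using i by simp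
    then obtain r where "r \<in> {0..a}" "bet a b i r" using bet_ex[OF nn(1,2)] by blast
    then show ?thesis using True b'(1) h'0 by (intro bexI[of _ r]) auto
  next
    case False
    then have "i = k + 1" using i less_plus_one[of i "k + 1"] less_iff_le[of k i] by auto
    then show ?thesis using b'(1) h'0 nn by (intro bexI[of _ h']) auto
  qed
  ultimately obtain P a' where a': "0 \<le> a'" "\<And>i. i \<in> {0..<k + 2} \<Longrightarrow> \<exists>v\<in>{0..b'}. ?F i v \<and> bet a' b' i v"
    using chinese_remainder[OF n b'0(2) b'(2), of ?F] by blast
  have old: "bet a' b' i v" if i: "0 \<le> i" "i \<le> k" "bet a b i v" for i v
  proof -
    have "i \<in> {0..<k + 2}" using i by simp
    then obtain u where u: "?F i u" "bet a' b' i u" using a'(2) by blast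
    then have "bet a b i u" using i by auto
    then show ?thesis using u bet_unique i(3) by metis
  qed
  have "\<exists>u. ?F (k + 1) u \<and> bet a' b' (k + 1) u" using a'(2)[of "k + 1"] nn by auto
  then have new: "bet a' b' (k + 1) h'" by auto
  have "hyper a' b' (k + 1)"
    unfolding hyper_def
  proof (intro conjI ballI)
    show "bet a' b' 0 0" using h nn by (intro old) (auto simp: hyper_def)
    fix i assume i: "i \<in> {0..<k + 1}"
    have "\<exists>v. bet a' b' i v \<and> bet a' b' (i + 1) (pw (v + 2) (v + 2))"
    proof (cases "i = k")
      case True
      then show ?thesis using new old[OF nn(3) order_refl hk(2)] unfolding h'_def by blast
    next
      case False
      then have ik: "i \<in> {0..<k}" using i less_plus_one[of i k] by auto
      then obtain v where v: "bet a b i v" "bet a b (i + 1) (pw (v + 2) (v + 2))"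
        using hyper_step[OF h] by blast
      have "i + 1 \<le> k" using ik less_iff_le[of i k] by auto
      then show ?thesis using old[of i v] old[of "i + 1"] v ik by auto
    qed
    then obtain v where v: "bet a' b' i v" "bet a' b' (i + 1) (pw (v + 2) (v + 2))" by blast
    have i0: "0 \<le> i" "0 \<le> i + 1" using i by auto
    have "v \<in> {0..a'}" "pw (v + 2) (v + 2) \<in> {0..a'}"
      using bet_le[OF b'0(1) i0(1) v(1)] bet_le[OF b'0(1) i0(2) v(2)] bet_nonneg v by auto
    then show "\<exists>v\<in>{0..a'}. \<exists>v'\<in>{0..a'}. bet a' b' i v \<and> bet a' b' (i + 1) v' \<and> pw (v + 2) (v + 2) = v'"
      using v by auto
  qed
  then show ?thesis using a' b'0 by blast
qed

lemma hyper_anti: "hyper a b k \<Longrightarrow> l \<le> k \<Longrightarrow> hyper a b l"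
  unfolding hyper_def by auto

lemma D_hyper0: "D (\<lambda>e. hyper (e 0) (e 1) (e 2))"
  unfolding hyper_def by (intro D_rules D_bet D_pw)

lemmas D_hyper = dlt_subst3[OF D_hyper0]

text \<open>With the code made part of the witness, each element of the cut brings a sequence of
  iterates of that length; closure under successor is \<open>hyper_extend\<close>.\<close>

lemma sigma_cut_hyper:
  assumes K: "sigma_cut K"
  shows "sigma_cut (\<lambda>k w. K k w \<and> (\<exists>a\<in>{0..w}. \<exists>b\<in>{0..w}. hyper a b k))" (is "sigma_cut ?K")
proof -
  obtain d where d: "0 \<le> d" "d \<notin> cut_set K" using cut_proper[OF K] by blast
  show ?thesis
  proof (rule sigma_cutI)
    show "D (\<lambda>e. ?K (e 0) (e 1))" by (intro D_rules D_hyper dlt_subst2[OF sigma_cut_D[OF K]])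
    show "?K x w" if "0 \<le> x" "x \<le> y" "0 \<le> w" "?K y w" for x y w
      using that sigma_cut_anti[OF K] hyper_anti by blast
    show "?K x w'" if "0 \<le> x" "0 \<le> w" "w \<le> w'" "?K x w" for x w w'
    proof -
      from that(4) obtain a b where "a \<in> {0..w}" "b \<in> {0..w}" "hyper a b x" by blast
      moreover from this that(3) have "a \<in> {0..w'}" "b \<in> {0..w'}" by auto
      ultimately show ?thesis using that sigma_cut_mono[OF K] by blast
    qed
    obtain w where "0 \<le> w" "K 0 w" using cut_zero[OF K] unfolding cut_set_def by blast
    moreover have "hyper 0 0 0" by (simp add: hyper_def bet_def)
    moreover have "0 \<in> {0..w}" using \<open>0 \<le> w\<close> by simp
    ultimately show "\<exists>w\<ge>0. ?K 0 w" by blast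
    show "0 \<le> d" by fact
    show "\<not> ?K d w" if "0 \<le> w" for w using d that unfolding cut_set_def by blast
    show "\<exists>w'\<ge>0. ?K (x + 1) w'" if x: "0 \<le> x" "0 \<le> w" "?K x w" for x w
    proof -
      obtain u where u: "0 \<le> u" "K (x + 1) u"
        using cut_Suc[OF K, of x] x unfolding cut_set_def by blast
      obtain a b where "hyper a b x" "0 \<le> a" "0 \<le> b" using x(3) by auto
      then obtain a' b' where ab: "0 \<le> a'" "0 \<le> b'" "hyper a' b' (x + 1)"
        using hyper_extend x(1) by blast
      let ?w = "max u (max a' b')"
      have "K (x + 1) ?w" using sigma_cut_mono[OF K _ u(1) _ u(2)] x(1) by auto
      moreover have "a' \<in> {0..?w}" "b' \<in> {0..?w}" using ab by auto
      moreover have "0 \<le> ?w" using u(1) by simp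
      ultimately show ?thesis using ab(3) by blast
    qed
  qed
qed

text \<open>Meant for \<open>g\<close> adding a fixed element of the cut, multiplying by it, or
  raising it to a power: a value that escapes \<open>K\<close> at \<open>c\<close> produces a cut
  that \<open>c\<close> escapes.\<close>

lemma sigma_cut_preimage:
  assumes K: "sigma_cut K" and g: "D (\<lambda>e. g (e 0) = e 1)"
    and "\<And>x. 0 \<le> x \<Longrightarrow> 0 \<le> g x" "\<And>x y. 0 \<le> x \<Longrightarrow> x \<le> y \<Longrightarrow> g x \<le> g y"
    and "g 0 \<in> cut_set K" "\<And>x. 0 \<le> x \<Longrightarrow> g x \<in> cut_set K \<Longrightarrow> g (x + 1) \<in> cut_set K"
    and c: "0 \<le> c" "g c \<notin> cut_set K"
  shows "\<exists>K'. sigma_cut K' \<and> c \<notin> cut_set K'"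
proof -
  let ?K = "\<lambda>x w. \<exists>z\<in>{0..w}. g x = z \<and> K z w"
  have in_cut: "(\<exists>w\<ge>0. ?K x w) \<longleftrightarrow> g x \<in> cut_set K" if "0 \<le> x" for x
  proof
    assume "g x \<in> cut_set K"
    then obtain w where "0 \<le> w" "K (g x) w" unfolding cut_set_def by blast
    then have "K (g x) (max w (g x))" using sigma_cut_mono[OF K] assms(3)[OF that] by simp
    then show "\<exists>w\<ge>0. ?K x w" using assms(3)[OF that] by (intro exI[of _ "max w (g x)"]) auto
  qed (auto simp: cut_set_def)
  have "sigma_cut ?K"
  proof (rule sigma_cutI)
    show "D (\<lambda>e. ?K (e 0) (e 1))"
      by (intro D_rules dlt_subst2[OF sigma_cut_D[OF K]] dlt_subst2[OF g, simplified])
    show "?K x w" if "0 \<le> x" "x \<le> y" "0 \<le> w" "?K y w" for x y w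
    proof -
      have "g x \<le> g y" "0 \<le> g x" using that assms(3,4) by auto
      then show ?thesis using that sigma_cut_anti[OF K, of "g x" "g y" w] by auto
    qed
    show "?K x w'" if "0 \<le> x" "0 \<le> w" "w \<le> w'" "?K x w" for x w w'
      using that sigma_cut_mono[OF K, of "g x" w w'] assms(3) by auto
    show "\<exists>w\<ge>0. ?K 0 w" using in_cut[of 0] assms(5) by simp
    show "\<exists>w'\<ge>0. ?K (x + 1) w'" if "0 \<le> x" "0 \<le> w" "?K x w" for x w
      using in_cut[of x] in_cut[of "x + 1"] assms(6)[of x] that by auto
    show "0 \<le> c" by fact
    show "\<not> ?K c w" if "0 \<le> w" for w using in_cut[OF c(1)] c(2) that by blast
  qed
  moreover have "c \<notin> cut_set ?K" using in_cut[OF c(1)] c(2) by (auto simp: cut_set_def)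
  ultimately show ?thesis by blast
qed

lemma pw_big:
  assumes "0 \<le> v" "x \<in> {0..v}" "y \<in> {0..v}"
  shows "x + y \<le> pw (v + 2) (v + 2)" "x * y \<le> pw (v + 2) (v + 2)" "pw x y \<le> pw (v + 2) (v + 2)"
    "v + 1 \<le> pw (v + 2) (v + 2)"
proof -
  have "pw (v + 2) 1 = v + 2" using pw_Suc[of "v + 2" 0] pw_0[of "v + 2"] assms by simp
  moreover have "pw (v + 2) (1 + 1) = pw (v + 2) 1 * (v + 2)" using assms by (intro pw_Suc) auto
  ultimately have "pw (v + 2) 2 = (v + 2) * (v + 2)" by simp
  moreover have "pw (v + 2) 2 \<le> pw (v + 2) (v + 2)" using assms by (intro pw_mono_right) auto
  ultimately have sq: "(v + 2) * (v + 2) \<le> pw (v + 2) (v + 2)" by simp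
  have "x * y \<le> (v + 2) * (v + 2)" using assms by (intro mult_mono) auto
  then show "x * y \<le> pw (v + 2) (v + 2)" using sq by linarith
  have "x + y \<le> 2 * (v + 2)" "v + 1 \<le> 2 * (v + 2)" "2 * (v + 2) \<le> (v + 2) * (v + 2)"
    using assms mult_right_mono[of 2 "v + 2" "v + 2"] by auto
  then show "x + y \<le> pw (v + 2) (v + 2)" "v + 1 \<le> pw (v + 2) (v + 2)" using sq by linarith+
  have "pw x y \<le> pw (v + 2) y" using assms by (intro pw_mono_left) auto
  also have "\<dots> \<le> pw (v + 2) (v + 2)" using assms by (intro pw_mono_right) auto
  finally show "pw x y \<le> pw (v + 2) (v + 2)" .
qed

text \<open>Induction along the code; a single iteration increases by \<open>pw_big\<close>. This
  allows two elements below different iterates to be compared with the iterate at the larger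
  index.\<close>

lemma hyper_mono:
  assumes h: "hyper a b c" and nn: "0 \<le> a" "0 \<le> b" "0 \<le> k"
    and l: "k \<le> l" "l \<le> c" "bet a b k u" "bet a b l v"
  shows "u \<le> v"
proof -
  have u: "0 \<le> u" using l by (simp add: bet_def)
  have "k \<le> l \<longrightarrow> (\<exists>v\<in>{0..a}. bet a b l v \<and> u \<le> v)"
    using order_trans[OF nn(3) l(1)] l(2)
  proof (induct l rule: D_induct_le)
    case D
    show ?case by (intro D_rules D_bet nn u)
  next
    case zero
    then show ?case using nn l(3) bet_le[OF nn(2), of k a u] u by auto
  next
    case (Suc l)
    show ?case
    proof (cases "k = l + 1")
      case True
      then show ?thesis using l(3) bet_le[OF nn(2,3) l(3)] u by auto
    next
      case False
      show ?thesis
      proof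
        assume "k \<le> l + 1"
        then have "k \<le> l" using False less_plus_one[of k l] by auto
        then obtain v where v: "bet a b l v" "u \<le> v" using Suc by blast
        moreover obtain v' where v': "v' \<in> {0..a}" "bet a b l v'" "bet a b (l + 1) (pw (v' + 2) (v' + 2))"
          using hyper_step[OF h, of l] Suc by auto
        ultimately have "v = v'" using bet_unique by blast
        moreover have "v' + 1 \<le> pw (v' + 2) (v' + 2)" using v'(1) pw_big(4)[of v' 0 0] by auto
        moreover have "pw (v' + 2) (v' + 2) \<le> a" using bet_le[OF nn(2) _ v'(3)] Suc(1) by simp
        ultimately show "\<exists>v\<in>{0..a}. bet a b (l + 1) v \<and> u \<le> v"
          using v v' u by (intro bexI[of _ "pw (v' + 2) (v' + 2)"]) auto
      qed
    qed
  qed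
  then show ?thesis using l bet_unique by blast
qed

text \<open>If a cut on which the iterates of \<open>v \<mapsto> (v + 2) ^ (v + 2)\<close> exist is not closed under addition,
  multiplication and exponentiation, it has a proper sub-cut bounded by one of its elements \<open>c\<close>;
  the iterates along the sub-cut are then bounded and generate a closed cut.\<close>

lemma closed_cut_from_bounded:
  assumes K: "sigma_cut K" and c: "0 \<le> c" "c \<notin> cut_set K" and h: "hyper a b c" and ab: "0 \<le> a" "0 \<le> b"
  shows "\<exists>K'. sigma_cut K' \<and> (\<forall>x\<in>cut_set K'. \<forall>y\<in>cut_set K'.
    x + y \<in> cut_set K' \<and> x * y \<in> cut_set K' \<and> pw x y \<in> cut_set K')"
proof -
  \<comment> \<open>The numbers below an iterate whose index lies in \<open>K\<close>. As
    \<open>c\<close> is beyond \<open>K\<close>, the code contains a further iterate after each of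
    these.\<close>
  let ?K = "\<lambda>x w. \<exists>k\<in>{0..w}. \<exists>h\<in>{0..w}. bet a b k h \<and> x \<le> h \<and> K k w"
  have in_cut: "x \<in> cut_set ?K \<longleftrightarrow> 0 \<le> x \<and> (\<exists>k h. k \<in> cut_set K \<and> bet a b k h \<and> x \<le> h)" for x
  proof
    assume "0 \<le> x \<and> (\<exists>k h. k \<in> cut_set K \<and> bet a b k h \<and> x \<le> h)"
    then obtain k h where kh: "0 \<le> x" "k \<in> cut_set K" "bet a b k h" "x \<le> h" by blast
    then obtain w where w: "0 \<le> w" "K k w" "0 \<le> k" unfolding cut_set_def by blast
    have "0 \<le> h" using kh(3) by (simp add: bet_def)
    let ?w = "max w (max k h)"
    have "K k ?w" using sigma_cut_mono[OF K w(3,1) _ w(2)] by simp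
    moreover have "k \<in> {0..?w}" "h \<in> {0..?w}" "0 \<le> ?w" using w \<open>0 \<le> h\<close> by auto
    ultimately show "x \<in> cut_set ?K" using kh unfolding cut_set_def by blast
  next
    assume "x \<in> cut_set ?K"
    then obtain w k h where kh: "0 \<le> x" "0 \<le> w" "k \<in> {0..w}" "bet a b k h" "x \<le> h" "K k w"
      unfolding cut_set_def by blast
    then have "k \<in> cut_set K" unfolding cut_set_def by (simp, blast)
    then show "0 \<le> x \<and> (\<exists>k h. k \<in> cut_set K \<and> bet a b k h \<and> x \<le> h)" using kh by blast
  qed
  have step: "\<exists>v. v \<in> {0..a} \<and> bet a b k v \<and> bet a b (k + 1) (pw (v + 2) (v + 2))" if "k \<in> cut_set K" for k
    using hyper_step[OF h, of k] cut_less[OF K that c] cut_nonneg[OF K that] by auto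
  have cut: "sigma_cut ?K"
  proof (rule sigma_cutI)
    show "D (\<lambda>e. ?K (e 0) (e 1))" by (intro D_rules D_bet dlt_subst2[OF sigma_cut_D[OF K]] ab)
    show "?K x w" if "x \<le> y" "?K y w" for x y w using that by (meson order_trans)
    show "?K x w'" if "w \<le> w'" "0 \<le> w" "?K x w" for x w w'
    proof -
      from that(3) obtain k h where kh: "k \<in> {0..w}" "h \<in> {0..w}" "bet a b k h" "x \<le> h" "K k w" by blast
      then have "k \<in> {0..w'}" "h \<in> {0..w'}" "K k w'" using that sigma_cut_mono[OF K, of k w w'] by auto
      then show ?thesis using kh by blast
    qed
    have "0 \<in> cut_set ?K" unfolding in_cut using cut_zero[OF K] h by (auto simp: hyper_def)
    then show "\<exists>w\<ge>0. ?K 0 w" unfolding cut_set_def by blast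
    show "\<exists>w'\<ge>0. ?K (x + 1) w'" if x: "0 \<le> x" "0 \<le> w" "?K x w" for x w
    proof -
      have "x \<in> cut_set ?K" using x unfolding cut_set_def by blast
      then obtain k h where kh: "k \<in> cut_set K" "bet a b k h" "x \<le> h" unfolding in_cut by blast
      obtain v where v: "v \<in> {0..a}" "bet a b k v" "bet a b (k + 1) (pw (v + 2) (v + 2))" using step[OF kh(1)] by blast
      then have "h = v" using kh(2) bet_unique by blast
      moreover have "v + 1 \<le> pw (v + 2) (v + 2)" using v(1) pw_big(4)[of v 0 0] by auto
      ultimately have "x + 1 \<in> cut_set ?K"
        unfolding in_cut using x(1) kh(3) v(3) cut_Suc[OF K kh(1)]
        by (intro conjI exI[of _ "k + 1"] exI[of _ "pw (v + 2) (v + 2)"]) auto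
      then show ?thesis unfolding cut_set_def by blast
    qed
    \<comment> \<open>Entries of a beta code are at most \<open>a\<close>, so the new cut cannot
      reach \<open>a + 1\<close>.\<close>
    show "0 \<le> a + 1" using ab by simp
    show "\<not> ?K (a + 1) w" if "0 \<le> w" for w
    proof
      assume "?K (a + 1) w"
      then obtain k h where "0 \<le> k" "bet a b k h" "a + 1 \<le> h" by auto
      then show False using bet_le[OF ab(2), of k a h] by auto
    qed
  qed
  have "x + y \<in> cut_set ?K \<and> x * y \<in> cut_set ?K \<and> pw x y \<in> cut_set ?K"
    if xy: "x \<in> cut_set ?K" "y \<in> cut_set ?K" for x y
  proof -
    obtain k u where k: "0 \<le> x" "k \<in> cut_set K" "bet a b k u" "x \<le> u" using xy(1) unfolding in_cut by blast
    obtain l v where l: "0 \<le> y" "l \<in> cut_set K" "bet a b l v" "y \<le> v" using xy(2) unfolding in_cut by blast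
    have "max k l \<in> cut_set K" using k(2) l(2) by (simp add: max_def)
    then obtain z where z: "max k l \<in> cut_set K" "z \<in> {0..a}" "bet a b (max k l) z"
      "bet a b (max k l + 1) (pw (z + 2) (z + 2))" using step by blast
    have "max k l \<le> c" using cut_less[OF K z(1) c] by simp
    then have "u \<le> z" "v \<le> z"
      using hyper_mono[OF h ab _ _ _ k(3) z(3)] hyper_mono[OF h ab _ _ _ l(3) z(3)]
        cut_nonneg[OF K k(2)] cut_nonneg[OF K l(2)] by auto
    then have "x \<in> {0..z}" "y \<in> {0..z}" "0 \<le> z" using k l z by auto
    from pw_big(1-3)[OF this(3,1,2)] show ?thesis
      unfolding in_cut using k l cut_Suc[OF K z(1)] z(4) pw_nonneg by auto
  qed
  then show ?thesis using cut by blast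
qed

lemma closed_cut:
  assumes "sigma_cut K0"
  shows "\<exists>K. sigma_cut K \<and> (\<forall>x\<in>cut_set K. \<forall>y\<in>cut_set K.
    x + y \<in> cut_set K \<and> x * y \<in> cut_set K \<and> pw x y \<in> cut_set K)"
proof -
  define K where "K = (\<lambda>k w. K0 k w \<and> (\<exists>a\<in>{0..w}. \<exists>b\<in>{0..w}. hyper a b k))"
  have K: "sigma_cut K" unfolding K_def by (rule sigma_cut_hyper[OF assms])
  \<comment> \<open>Any cut that omits some element \<open>c\<close> of \<open>K\<close> suffices,
    because membership of \<open>c\<close> in \<open>K\<close> carries a code of \<open>c\<close>
    iterations.\<close>
  have small: ?thesis if c: "sigma_cut K'" "c \<in> cut_set K" "c \<notin> cut_set K'" for K' c
  proof -
    obtain a b where "0 \<le> a" "0 \<le> b" "hyper a b c" using c(2) unfolding cut_set_def K_def by auto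
    then show ?thesis using closed_cut_from_bounded[OF c(1) _ c(3)] cut_nonneg[OF K c(2)] by blast
  qed
  let ?J = "cut_set K"
  have nn: "0 \<le> x" if "x \<in> ?J" for x using cut_nonneg[OF K that] .
  show ?thesis
  \<comment> \<open>The order of the cases matters: closure under addition gives the successor step
    for the preimage under multiplication, and closure under multiplication gives it for
    powers.\<close>
  proof (cases "\<forall>x\<in>?J. \<forall>y\<in>?J. x + y \<in> ?J")
    case False
    then obtain c1 c2 where c: "c1 \<in> ?J" "c2 \<in> ?J" "c1 + c2 \<notin> ?J" by blast
    have "\<exists>K'. sigma_cut K' \<and> c2 \<notin> cut_set K'"
    proof (rule sigma_cut_preimage[OF K, of "\<lambda>k. c1 + k"])
      show "D (\<lambda>e. c1 + e 0 = e 1)" by (intro D_rules nn c)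
      show "c1 + x \<in> ?J \<Longrightarrow> c1 + (x + 1) \<in> ?J" for x using cut_Suc[OF K, of "c1 + x"] by (simp add: add.assoc)
    qed (use c nn in auto)
    then show ?thesis using small c by blast
  next
    case plus: True
    show ?thesis
    proof (cases "\<forall>x\<in>?J. \<forall>y\<in>?J. x * y \<in> ?J")
      case False
      then obtain c1 c2 where c: "c1 \<in> ?J" "c2 \<in> ?J" "c1 * c2 \<notin> ?J" by blast
      have "\<exists>K'. sigma_cut K' \<and> c2 \<notin> cut_set K'"
      proof (rule sigma_cut_preimage[OF K, of "\<lambda>k. c1 * k"])
        show "D (\<lambda>e. c1 * e 0 = e 1)" by (intro D_rules nn c)
        show "c1 * x \<in> ?J \<Longrightarrow> c1 * (x + 1) \<in> ?J" for x using plus c(1) by (simp add: distrib_left)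
        show "c1 * x \<le> c1 * y" if "x \<le> y" for x y using that nn[OF c(1)] by (rule mult_left_mono)
      qed (use c nn cut_zero[OF K] in auto)
      then show ?thesis using small c by blast
    next
      case times: True
      show ?thesis
      proof (cases "\<forall>x\<in>?J. \<forall>y\<in>?J. pw x y \<in> ?J")
        case False
        then obtain c1 c2 where c: "c1 \<in> ?J" "c2 \<in> ?J" "pw c1 c2 \<notin> ?J" by blast
        \<comment> \<open>The raised base makes powers monotone in the exponent even when
          \<open>c1\<close> is 0, and the larger power still escapes the cut.\<close>
        let ?c = "c1 + 1"
        have c1: "?c \<in> ?J" "0 \<le> ?c" "1 \<le> ?c" using cut_Suc[OF K c(1)] nn[OF c(1)] by auto
        have "pw c1 c2 \<le> pw ?c c2" using nn c by (intro pw_mono_left) auto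
        then have "pw ?c c2 \<notin> ?J"
          using c(3) cut_down[OF K, of "pw ?c c2" "pw c1 c2"] pw_nonneg nn c(1,2) by blast
        have "\<exists>K'. sigma_cut K' \<and> c2 \<notin> cut_set K'"
        proof (rule sigma_cut_preimage[OF K, of "\<lambda>k. pw ?c k"])
          show "D (\<lambda>e. pw ?c (e 0) = e 1)" by (intro D_rules D_pw nn c)
          show "pw ?c 0 \<in> ?J" using cut_Suc[OF K cut_zero[OF K]] by (simp add: pw_0 c1)
          show "pw ?c x \<in> ?J \<Longrightarrow> pw ?c (x + 1) \<in> ?J" if "0 \<le> x" for x
            using times c1 that by (simp add: pw_Suc)
          show "pw ?c x \<le> pw ?c y" if "0 \<le> x" "x \<le> y" for x y using that c1 by (intro pw_mono_right)
          show "0 \<le> pw ?c x" if "0 \<le> x" for x using that c1 by (intro pw_nonneg)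
        qed (use c nn \<open>pw ?c c2 \<notin> ?J\<close> in auto)
        then show ?thesis using small c by blast
      next
        case True
        then show ?thesis using K plus times by blast
      qed
    qed
  qed
qed

end

section \<open>A closed cut with the traces of sets is a model of weak Koenig's lemma\<close>

context rca
begin

section \<open>Powers of two and prefixes of tree nodes\<close>

lemma two_dvd_or_odd: "2 dvd (q :: 'a) \<or> (\<exists>k. q = 2 * k + 1)"
proof -
  obtain k r :: 'a where k: "q = k * 2 + r" "0 \<le> r" "r < 2" using euclid[of 2 q] by auto
  have "r = 0 \<or> r = 1"
    using k(2,3) less_plus_one[of r 1] less_iff_le[of 0 r] by (cases "r = 0") auto
  then show ?thesis using k(1) by (auto simp: mult.commute)
qed

text \<open>The powers of two, recognised by having no odd divisor except 1. The definition is
  bounded and mentions no exponent; a prefix is fixed by the power itself.\<close>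

definition pow2 :: "'a \<Rightarrow> bool" where
  "pow2 e \<longleftrightarrow> 1 \<le> e \<and> (\<forall>q\<in>{0..e}. q dvd e \<longrightarrow> q = 1 \<or> 2 dvd q)"

lemma pow2D: "pow2 e \<Longrightarrow> q \<in> {0..e} \<Longrightarrow> q dvd e \<Longrightarrow> q = 1 \<or> 2 dvd q"
  unfolding pow2_def by simp

lemma D_pow2_0: "D (\<lambda>e. pow2 (e 0))"
  unfolding pow2_def by (intro D_rules D_dvd)

lemmas D_pow2 = dlt_subst1[OF D_pow2_0]

lemma pow2_one: "pow2 1"
proof -
  have "q = 1" if "q \<in> {0..1}" "q dvd 1" for q :: 'a
  proof -
    have "q \<noteq> 0" using that(2) by auto
    then have "1 \<le> q" using that(1) discrete[of q] by auto
    then show ?thesis using that(1) by auto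
  qed
  then show ?thesis unfolding pow2_def by auto
qed

lemma pow2_double:
  assumes "pow2 e" shows "pow2 (2 * e)"
  unfolding pow2_def
proof (intro conjI ballI impI)
  have e: "1 \<le> e" using assms by (simp add: pow2_def)
  then show "1 \<le> 2 * e" by simp
  fix q assume q: "q \<in> {0..2 * e}" "q dvd 2 * e"
  show "q = 1 \<or> 2 dvd q"
  proof (rule disjCI)
    assume "\<not> 2 dvd q"
    then obtain k where k: "q = 2 * k + 1" using two_dvd_or_odd by blast
    have "e = q * e - k * (2 * e)" unfolding k by (simp add: algebra_simps)
    then have d: "q dvd e" using q(2) by (metis dvd_diff dvd_mult dvd_triv_left)
    have "0 \<le> q" using q(1) by simp
    then obtain r where r: "r \<in> {0..e}" "e = q * r" using d e dvd_iff_bounded[of q e] by auto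
    have "1 \<le> r" using r e discrete[of r] by (cases "r = 0") auto
    then have "q * 1 \<le> q * r" using \<open>0 \<le> q\<close> by (intro mult_left_mono)
    then have "q \<in> {0..e}" using r(2) \<open>0 \<le> q\<close> by simp
    then show "q = 1" using pow2D[OF assms _ d] \<open>\<not> 2 dvd q\<close> by blast
  qed
qed

lemma pow2_half:
  assumes "pow2 e" "e \<noteq> 1"
  obtains f where "e = 2 * f" "pow2 f" "1 \<le> f" "f < e"
proof -
  have e: "1 \<le> e" using assms by (simp add: pow2_def)
  then have "e \<in> {0..e}" by simp
  then have "2 dvd e" using pow2D[OF assms(1) _ dvd_refl] assms(2) by blast
  then obtain f where f: "e = 2 * f" by (elim dvdE)
  have "0 < f" using e unfolding f by simp
  then have f1: "1 \<le> f" by (rule discrete)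
  have "pow2 f" unfolding pow2_def
  proof (intro conjI ballI impI)
    fix q assume "q \<in> {0..f}" "q dvd f"
    then have "q \<in> {0..e}" "q dvd e" using f f1 by auto
    then show "q = 1 \<or> 2 dvd q" by (rule pow2D[OF assms(1)])
  qed (rule f1)
  then show thesis using f f1 by (intro that) auto
qed

text \<open>Halving both powers reduces the claim to a smaller pair, until the smaller power is 1.
  The larger one is quantified below a fixed \<open>e\<close> to keep the induction formula
  bounded.\<close>

lemma pow2_gap:
  assumes "pow2 e'" "pow2 e" "e' < e" shows "2 * e' \<le> e"
proof -
  have e0: "0 \<le> e" "0 \<le> e'" using assms by (auto simp: pow2_def)
  have "\<forall>e''\<in>{0..e}. pow2 e'' \<longrightarrow> pow2 e' \<longrightarrow> e' < e'' \<longrightarrow> 2 * e' \<le> e''" using e0(2)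
  proof (induct e' rule: D_strong_induct)
    case D
    show ?case by (intro D_rules D_pow2 e0)
  next
    case (less e')
    show ?case
    proof (intro ballI impI)
      fix e'' assume *: "e'' \<in> {0..e}" "pow2 e''" "pow2 e'" "e' < e''"
      have "e'' \<noteq> 1" using * by (auto simp: pow2_def)
      then obtain f where f: "e'' = 2 * f" "pow2 f" "1 \<le> f" "f < e''" using pow2_half *(2) by blast
      show "2 * e' \<le> e''"
      proof (cases "e' = 1")
        case True
        then show ?thesis using f by simp
      next
        case False
        then obtain f' where f': "e' = 2 * f'" "pow2 f'" "1 \<le> f'" "f' < e'" using pow2_half *(3) by blast
        have "f \<in> {0..e}" "f' < f" "0 \<le> f'" using f f' * by auto
        then have "2 * f' \<le> f" using less(2)[of f'] f' f by blast
        then show ?thesis using f f' by simp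
      qed
    qed
  qed
  then show ?thesis using assms e0 by auto
qed

lemma pow2_below:
  assumes "1 \<le> s" shows "\<exists>e\<in>{0..s}. pow2 e \<and> s < 2 * e"
proof -
  have s: "0 \<le> s" using assms by simp
  have "1 \<le> s \<longrightarrow> (\<exists>e\<in>{0..s}. pow2 e \<and> s < 2 * e)" using s
  proof (induct s rule: D_induct)
    case D
    show ?case by (intro D_rules D_pow2)
  next
    case (Suc s)
    show ?case
    proof (cases "s = 0")
      case True
      then show ?thesis using pow2_one by (intro impI bexI[of _ 1]) auto
    next
      case False
      then have "1 \<le> s" using Suc(1) discrete[of s] by auto
      then obtain e where e: "e \<in> {0..s}" "pow2 e" "s < 2 * e" using Suc by blast
      show ?thesis
      proof (cases "s + 1 = 2 * e")
        case True
        have "1 \<le> e" using e(2) by (simp add: pow2_def)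
        then show ?thesis using True e pow2_double[OF e(2)] by (intro impI bexI[of _ "2 * e"]) auto
      next
        case False
        then have "s + 1 < 2 * e" using e(3) less_iff_le[of s "2 * e"] by auto
        then show ?thesis using e by (intro impI bexI[of _ e]) auto
      qed
    qed
  qed simp
  then show ?thesis using assms by simp
qed

text \<open>\<open>at e n s\<close>: the node \<open>n\<close> is the prefix of the node \<open>s\<close> obtained by deleting \<open>log\<^sub>2 e\<close> digits.\<close>

definition at :: "'a \<Rightarrow> 'a \<Rightarrow> 'a \<Rightarrow> bool" where
  "at e n s \<longleftrightarrow> pow2 e \<and> n * e \<le> s \<and> s < (n + 1) * e"

lemma D_at0: "D (\<lambda>e. at (e 0) (e 1) (e 2))"
  unfolding at_def by (intro D_rules D_pow2)

lemmas D_at = dlt_subst3[OF D_at0]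

lemma at_parent: "at e (2 * n) s \<or> at e (2 * n + 1) s \<Longrightarrow> at (2 * e) n s"
  using pow2_double unfolding at_def by (auto simp: algebra_simps pow2_def)

lemma at_child:
  assumes "at (2 * f) n s" "pow2 f" shows "at f (2 * n) s \<or> at f (2 * n + 1) s"
proof (cases "s < (2 * n + 1) * f")
  case True
  then show ?thesis using assms unfolding at_def by (auto simp: algebra_simps)
next
  case False
  then show ?thesis using assms unfolding at_def by (auto simp: algebra_simps)
qed

lemma at_one: "at 1 n s \<longleftrightarrow> n = s"
  unfolding at_def using pow2_one less_plus_one[of s n] by auto

text \<open>The two levels might differ. Comparing the intervals gives \<open>e' < e\<close>, hence
  \<open>2 * e' \<le> e\<close>, and then \<open>s < (n + 1) * (2 * e') \<le> (n + 1) * e \<le> (2 *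
  n) * e \<le> s\<close>, where the third inequality uses \<open>1 \<le> n\<close>.\<close>

lemma at_exclusive:
  assumes "1 \<le> n" "at e (2 * n) s" "at e' (2 * n + 1) s" shows False
proof -
  have "(2 * n + 1) * e' \<le> s" "s < (2 * n + 1) * e" using assms unfolding at_def by simp_all
  then have "(2 * n + 1) * e' < (2 * n + 1) * e" by (rule order_le_less_trans)
  then have "e' < e" by (rule mult_left_less_imp_less) (use assms(1) in simp)
  then have "2 * e' \<le> e" using pow2_gap assms unfolding at_def by blast
  then have "(n + 1) * (2 * e') \<le> (n + 1) * e" using assms(1) by (intro mult_left_mono) auto
  moreover have "(n + 1) * e \<le> (2 * n) * e" using assms unfolding at_def pow2_def by (intro mult_right_mono) auto
  moreover have "s < (n + 1) * (2 * e')" using assms(3) unfolding at_def by (simp add: algebra_simps)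
  ultimately show False using assms(2) unfolding at_def by linarith
qed

lemma at_le: "at e n s \<Longrightarrow> 0 \<le> n \<Longrightarrow> n \<le> s"
  using mult_left_mono[of 1 e n] unfolding at_def pow2_def by simp

lemma at_level_le:
  assumes "at e n s" "1 \<le> n" shows "e \<in> {0..s}"
proof -
  have e: "0 \<le> e" "n * e \<le> s" using assms(1) by (auto simp: at_def pow2_def)
  then have "1 * e \<le> n * e" using assms(2) by (intro mult_right_mono)
  then show ?thesis using e by simp
qed

lemma D_eval:
  assumes "delta0 p" "\<And>X. S X \<in> \<X>" shows "D (\<lambda>e. eval MM e S p)"
  unfolding dlt_def
proof (intro exI conjI allI impI)
  show "delta0 (substN (\<lambda>i. Var (2 * i)) p)" using assms(1) by (rule delta0_substN)
  show "(0 :: 'a) \<in> universe MM" by simp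
  show "S X \<in> sets MM" for X using assms by simp
  show "eval MM e S p \<longleftrightarrow> eval MM (mix e (\<lambda>_. 0)) S (substN (\<lambda>i. Var (2 * i)) p)" for e
    by (simp add: eval_substN)
qed

end

lemma models_uclI:
  assumes "\<And>q. q \<in> \<Gamma> \<Longrightarrow> \<exists>p. q = ucl p \<and>
    (\<forall>e S. (\<forall>i. e i \<in> universe M) \<longrightarrow> (\<forall>X. S X \<in> sets M) \<longrightarrow> eval M e S p)"
  shows "models M \<Gamma>"
  unfolding models_def
proof (intro ballI allI impI)
  fix q and e :: "nat \<Rightarrow> 'a" and S :: "nat \<Rightarrow> 'a set"
  assume q: "q \<in> \<Gamma>" and e: "\<forall>i. e i \<in> universe M" "\<forall>X. S X \<in> sets M"
  from assms[OF q] obtain p where p: "q = ucl p"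
    "\<forall>e S. (\<forall>i. e i \<in> universe M) \<longrightarrow> (\<forall>X. S X \<in> sets M) \<longrightarrow> eval M e S p" by blast
  have "eval M e S (ucl p) \<longleftrightarrow>
    (\<forall>e S. (\<forall>i. e i \<in> universe M) \<longrightarrow> (\<forall>X. S X \<in> sets M) \<longrightarrow> eval M e S p)"
    using e by (intro eval_ucl) simp_all
  then show "eval M e S q" using p by simp
qed

section \<open>Absoluteness and the axioms in the cut\<close>

locale closed_cut_model = rca +
  fixes K :: "'a \<Rightarrow> 'a \<Rightarrow> bool"
  assumes cut: "sigma_cut K"
    and closed: "\<forall>x\<in>cut_set K. \<forall>y\<in>cut_set K. x + y \<in> cut_set K \<and> x * y \<in> cut_set K \<and> pw x y \<in> cut_set K"
begin

definition U :: "'a set" where "U = cut_set K"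

abbreviation UM :: "'a str" where "UM \<equiv> ring_str U ((\<lambda>Y. Y \<inter> U) ` \<X>)"

lemmas U_nonneg = cut_nonneg[OF cut, folded U_def]
  and U_zero = cut_zero[OF cut, folded U_def]
  and U_Suc = cut_Suc[OF cut, folded U_def]
  and U_down = cut_down[OF cut, folded U_def]
  and U_less = cut_less[OF cut, folded U_def]
  and U_proper = cut_proper[OF cut, folded U_def]

lemma U_one: "1 \<in> U"
  using U_Suc[OF U_zero] by simp

lemma U_add: "x \<in> U \<Longrightarrow> y \<in> U \<Longrightarrow> x + y \<in> U"
  and U_mult: "x \<in> U \<Longrightarrow> y \<in> U \<Longrightarrow> x * y \<in> U"
  and U_pw: "x \<in> U \<Longrightarrow> y \<in> U \<Longrightarrow> pw x y \<in> U"
  using closed unfolding U_def by simp_all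

lemma U_segment: "segment U"
  unfolding segment_def
proof (intro conjI ballI subsetI)
  show "x \<in> U" if "y \<in> U" "x \<in> {0..y}" for x y using U_down[OF that(1)] that(2) by simp
qed (simp_all add: U_nonneg U_zero U_one U_add U_mult)

lemma UM_sets: "(\<lambda>Y. Y \<inter> U) ` \<X> \<noteq> {}"
  using nonempty by simp

lemma UM_wf: "wf_str UM"
  using segment_wf[OF U_segment UM_sets] .

lemma tval_UM: "tval UM e t = tval MM e t"
  by (induction t) auto

lemma tval_U: "(\<And>i. e i \<in> U) \<Longrightarrow> tval MM e t \<in> U"
  using tval_in[OF UM_wf, of e t] by (simp add: tval_UM)

text \<open>A bounded quantifier with its bound in \<open>U\<close> has the same range in both
  structures, because \<open>U\<close> is downward closed, and sets are tested only at elements of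
  \<open>U\<close>.\<close>

lemma absolute:
  "delta0 p \<Longrightarrow> (\<And>i. e i \<in> U) \<Longrightarrow> eval UM e (\<lambda>X. S X \<inter> U) p \<longleftrightarrow> eval MM e S p"
proof (induction arbitrary: e rule: delta0.induct)
  case (6 p t)
  have "eval UM (case_nat x e) (\<lambda>X. S X \<inter> U) p \<longleftrightarrow> eval MM (case_nat x e) S p" if "x \<in> U" for x
    using that 6 by (intro 6) (simp add: case_nat_in)
  moreover have "0 \<le> x \<and> x < tval MM e t \<Longrightarrow> x \<in> U" for x
    using U_down[OF tval_U[of e t]] 6 by auto
  ultimately show ?case using U_nonneg by (simp add: tval_UM) (meson atLeast_iff)
qed (simp_all add: tval_UM tval_U)

lemma UM_choose:
  assumes "\<And>X. S' X \<in> sets UM"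
  obtains S where "\<And>X. S X \<in> \<X>" "S' = (\<lambda>X. S X \<inter> U)"
proof -
  have "\<forall>X. \<exists>Y. Y \<in> \<X> \<and> S' X = Y \<inter> U" using assms by auto
  then obtain S where "\<forall>X. S X \<in> \<X> \<and> S' X = S X \<inter> U" by metis
  then show thesis using that[of S] by auto
qed

lemma UM_basic: "models UM basic_axioms"
proof (rule models_uclI)
  fix q assume q: "q \<in> basic_axioms"
  then obtain p where p: "q = ucl p" "delta0 p"
    unfolding basic_axioms_eq basic_fms_def by (force intro: delta0.intros)
  have "eval UM e' S' p" if uni: "\<forall>i. e' i \<in> universe UM" "\<forall>X. S' X \<in> sets UM" for e' S'
  proof -
    have e': "\<forall>i. e' i \<in> U" and S': "\<forall>X. S' X \<in> (\<lambda>Y. Y \<inter> U) ` \<X>" using uni by simp_all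
    obtain R where R: "\<And>X. R X \<in> \<X>" "S' = (\<lambda>X. R X \<inter> U)" using UM_choose[of S'] S' by auto
    have "eval MM e' R p"
      by (rule models_ucl[OF basic]) (use q p R e' U_nonneg in auto)
    then show ?thesis unfolding R(2) using absolute[OF p(2)] e' by simp
  qed
  then show "\<exists>p. q = ucl p \<and> (\<forall>e S. (\<forall>i. e i \<in> universe UM) \<longrightarrow> (\<forall>X. S X \<in> sets UM) \<longrightarrow> eval UM e S p)"
    using p(1) by blast
qed

lemma UM_induction: "models UM (induction delta0)"
proof (rule models_uclI)
  fix q assume q: "q \<in> induction delta0"
  then obtain p where p: "q = ucl (ind_axiom p)" "delta0 p" unfolding induction_def by auto
  have "eval UM e' S' (ind_axiom p)" if uni: "\<forall>i. e' i \<in> universe UM" "\<forall>X. S' X \<in> sets UM" for e' S'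
  proof -
    have e': "\<forall>i. e' i \<in> U" and S': "\<forall>X. S' X \<in> (\<lambda>Y. Y \<inter> U) ` \<X>" using uni by simp_all
    obtain R where R: "\<And>X. R X \<in> \<X>" "S' = (\<lambda>X. R X \<inter> U)" using UM_choose[of S'] S' by auto
    define P where "P x = eval MM (case_nat x e') R p" for x
    have ev: "eval UM (case_nat x e') S' p \<longleftrightarrow> P x" if "x \<in> U" for x
      unfolding R(2) P_def using absolute[OF p(2)] e' that by (simp add: case_nat_in)
    have DP: "D (\<lambda>e. P (e 0))"
    proof -
      have *: "D (\<lambda>e. eval MM (\<lambda>i. (case i of 0 \<Rightarrow> (\<lambda>e. e 0) | Suc j \<Rightarrow> (\<lambda>e. e' j)) e) R p)"
        using e' U_nonneg by (intro dlt_subst[OF D_eval[OF p(2) R(1)]]) (auto split: nat.split intro!: D_rules)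
      have eqv: "(\<lambda>i. (case i of 0 \<Rightarrow> (\<lambda>e. e 0) | Suc j \<Rightarrow> (\<lambda>e. e' j)) e) = case_nat (e 0) e'" for e
        by (rule ext) (simp split: nat.split)
      show ?thesis unfolding P_def by (rule dlt_cong[OF *]) (simp only: eqv)
    qed
    have **: "(\<lambda>i. tval UM (case_nat x e') (case i of 0 \<Rightarrow> Add (Var 0) One | Suc i \<Rightarrow> Var (Suc i)))
      = case_nat (x + 1) e'" for x
      by (rule ext) (auto split: nat.split)
    \<comment> \<open>The step hypothesis is given only inside \<open>U\<close>, so the induction in
      the full model is cut off at \<open>n\<close>.\<close>
    have "P n" if "P 0" "\<And>x. x \<in> U \<Longrightarrow> P x \<Longrightarrow> P (x + 1)" "n \<in> U" for n
      using U_nonneg[OF that(3)] order_refl[of n]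
    proof (induct rule: D_induct_le[where n = n])
      case (Suc x)
      then show ?case using that(2) U_down[OF that(3), of x] by auto
    qed (use DP that in auto)
    then show ?thesis
      by (simp add: ind_axiom_def eval_instN eval_substN ** ev U_zero U_Suc)
  qed
  then show "\<exists>p. q = ucl p \<and> (\<forall>e S. (\<forall>i. e i \<in> universe UM) \<longrightarrow> (\<forall>X. S X \<in> sets UM) \<longrightarrow> eval UM e S p)"
    using p(1) by blast
qed

text \<open>Besides the power itself, a code for it must lie in \<open>U\<close>. This is where the
  explicit bounds of \<open>common_multiple\<close> and \<open>chinese_remainder\<close> are used:
  they are powers of elements of \<open>U\<close>.\<close>

lemma UM_exp: "eval UM e S exp_axiom" if "\<And>i. e i \<in> U"
proof -
  have "\<exists>z\<in>U. \<exists>a\<in>U. \<exists>b\<in>U. pow_code x y z a b" if xy: "x \<in> U" "y \<in> U" for x y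
  proof -
    note nn = xy[THEN U_nonneg]
    \<comment> \<open>A common bound for the \<open>y + 1\<close> entries \<open>pw x i\<close>; the
      base is raised by one so that powers increase with the exponent even when \<open>x\<close> is
      0.\<close>
    let ?V = "pw (x + 1) y" and ?n = "y + 1"
    have n: "0 \<le> ?n" using nn by simp
    obtain b0 where b0: "1 \<le> b0" "b0 \<le> pw (?n + 1) ?n" "\<forall>j\<in>{0..?n}. 1 \<le> j \<longrightarrow> j dvd b0"
      using common_multiple[OF n] by blast
    have V: "1 \<le> ?V" using nn by (intro pw_ge_one) auto
    define b where "b = b0 * ?V"
    have "1 * 1 \<le> b0 * ?V" using b0(1) V by (intro mult_mono) auto
    moreover have "1 * ?V \<le> b0 * ?V" using b0(1) V by (intro mult_right_mono) auto
    ultimately have b: "1 \<le> b" "?V \<le> b" "\<forall>j\<in>{0..?n}. 1 \<le> j \<longrightarrow> j dvd b"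
      using b0(3) by (auto simp: b_def)
    have "b0 \<in> U" using b0 xy by (intro U_down[OF U_pw _ b0(2)] U_add U_one) auto
    then have bU: "b \<in> U" unfolding b_def using xy by (intro U_mult U_pw U_add U_one)
    have val: "pw x i \<in> {0..b}" if "i \<in> {0..<?n}" for i
    proof -
      have "i \<le> y" "0 \<le> i" using that less_plus_one[of i y] by auto
      then have "pw x i \<le> pw (x + 1) i" "pw (x + 1) i \<le> ?V"
        using nn by (auto intro!: pw_mono_left pw_mono_right)
      then show ?thesis using b(2) pw_nonneg[OF nn(1) \<open>0 \<le> i\<close>] by auto
    qed
    have "D (\<lambda>e. pw x (e 0) = e 1)" by (intro D_rules D_pw nn)
    moreover have "\<forall>i\<in>{0..<?n}. \<exists>v\<in>{0..b}. pw x i = v" using val by auto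
    ultimately obtain P a where a: "0 \<le> a" "a < P" "P \<le> pw (1 + (?n + 1) * b) ?n"
      "\<And>i. i \<in> {0..<?n} \<Longrightarrow> \<exists>v\<in>{0..b}. pw x i = v \<and> bet a b i v"
      using chinese_remainder[OF n b(1,3), of "\<lambda>i v. pw x i = v"] by blast
    have "pw (1 + (?n + 1) * b) ?n \<in> U" using bU xy by (intro U_pw U_add U_mult U_one)
    then have aU: "a \<in> U" using a(1-3) by (intro U_down[of _ a]) auto
    have bet: "bet a b i (pw x i)" if "0 \<le> i" "i \<le> y" for i
      using a(4)[of i] that less_plus_one[of i y] by auto
    have "pow_code x y (pw x y) a b"
      unfolding pow_code_def
    proof (intro conjI ballI)
      show "bet a b 0 1" using bet[of 0] nn by (simp add: pw_0)
      show "bet a b y (pw x y)" using bet[of y] nn by simp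
      fix i assume i: "i \<in> {0..<y}"
      then have "i + 1 \<le> y" "0 \<le> i" "i \<le> y" using less_iff_le[of i y] by auto
      then have "bet a b i (pw x i)" "bet a b (i + 1) (pw x i * x)"
        using bet[of i] bet[of "i + 1"] nn by (auto simp: pw_Suc)
      moreover have "0 \<le> b" using b(1) by simp
      ultimately show "\<exists>v\<in>{0..a}. bet a b i v \<and> bet a b (i + 1) (v * x)"
        using bet_le[of b i a "pw x i"] bet_nonneg \<open>0 \<le> i\<close> by (intro bexI[of _ "pw x i"]) auto
    qed
    then show ?thesis using aU bU U_pw[OF xy] by blast
  qed
  then show ?thesis by (subst eval_exp_axiom[OF U_segment that UM_sets]) blast
qed

lemma UM_comprehension: "models UM delta1_comprehension"
proof (rule models_uclI)
  fix q assume q: "q \<in> delta1_comprehension"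
  then obtain p0 q0 where p: "delta0 p0" "delta0 q0"
    "q = ucl (Imp (AllN (Iff (ExN p0) (AllN q0))) (ExS (AllN (Iff (Mem (Var 0) 0) (liftS (ExN p0))))))"
    unfolding delta1_comprehension_def sigma1_def pi1_def by auto
  have "eval UM e' S' (Imp (AllN (Iff (ExN p0) (AllN q0))) (ExS (AllN (Iff (Mem (Var 0) 0) (liftS (ExN p0))))))" if uni: "\<forall>i. e' i \<in> universe UM" "\<forall>X. S' X \<in> sets UM" for e' S'
  proof -
    have e': "\<forall>i. e' i \<in> U" and S': "\<forall>X. S' X \<in> (\<lambda>Y. Y \<inter> U) ` \<X>" using uni by simp_all
    obtain R where R: "\<And>X. R X \<in> \<X>" "S' = (\<lambda>X. R X \<inter> U)" using UM_choose[of S'] S' by auto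
    define P where "P r x y = eval MM (case_nat y (case_nat x e')) R r" for r x y
    have ev: "eval UM (case_nat y (case_nat x e')) S' r \<longleftrightarrow> P r x y" if "x \<in> U" "y \<in> U" "delta0 r" for x y r
      unfolding R(2) P_def using absolute[OF that(3)] e' that by (simp add: case_nat_in)
    have DP: "D (\<lambda>e. P r (e 0) (e 1))" if "delta0 r" for r
    proof -
      let ?\<tau> = "\<lambda>i. case i of 0 \<Rightarrow> (\<lambda>e. e 1) | Suc j \<Rightarrow> (case j of 0 \<Rightarrow> (\<lambda>e. e 0) | Suc j \<Rightarrow> (\<lambda>e. e' j))"
      have *: "D (\<lambda>e. eval MM (\<lambda>i. ?\<tau> i e) R r)"
        using e' U_nonneg by (intro dlt_subst[OF D_eval[OF that R(1)]]) (auto split: nat.split intro!: D_rules)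
      have eqv: "(\<lambda>i. ?\<tau> i e) = case_nat (e 1) (case_nat (e 0) e')" for e
        by (rule ext) (simp split: nat.split)
      show ?thesis unfolding P_def by (rule dlt_cong[OF *]) (simp only: eqv)
    qed
    show "eval UM e' S' (Imp (AllN (Iff (ExN p0) (AllN q0))) (ExS (AllN (Iff (Mem (Var 0) 0) (liftS (ExN p0))))))"
      (is "eval UM e' S' (Imp ?A ?B)")
    proof (subst eval.simps(5), rule impI)
      assume "eval UM e' S' ?A"
      then have eq: "(\<exists>y\<in>U. P p0 x y) \<longleftrightarrow> (\<forall>y\<in>U. P q0 x y)" if "x \<in> U" for x
        using that ev p(1,2) by auto
      obtain d where d: "0 \<le> d" "d \<notin> U" using U_proper by blast
      \<comment> \<open>A \<open>d\<close> beyond \<open>U\<close> makes the existential quantifier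
        bounded. A witness \<open>y\<close> found outside \<open>U\<close> does no harm: the
        universal form then holds on all of \<open>U\<close>, so a witness inside \<open>U\<close>
        exists too.\<close>
      have "D (\<lambda>e. \<exists>y\<in>{0..d}. P p0 (e 0) y \<and> (\<forall>z\<in>{0..y}. P q0 (e 0) z))"
        by (intro D_rules dlt_subst2[OF DP[OF p(1)]] dlt_subst2[OF DP[OF p(2)]] d)
      then obtain Y where Y: "Y \<in> \<X>" "\<forall>x\<ge>0. x \<in> Y \<longleftrightarrow> (\<exists>y\<in>{0..d}. P p0 x y \<and> (\<forall>z\<in>{0..y}. P q0 x z))"
        using comprehension[of "\<lambda>x. \<exists>y\<in>{0..d}. P p0 x y \<and> (\<forall>z\<in>{0..y}. P q0 x z)"] by blast
      have Yx: "x \<in> Y \<longleftrightarrow> (\<exists>y\<in>U. P p0 x y)" if x: "x \<in> U" for x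
      proof
        assume "x \<in> Y"
        then obtain y where y: "y \<in> {0..d}" "P p0 x y" "\<forall>z\<in>{0..y}. P q0 x z"
          using Y(2) U_nonneg[OF x] by blast
        show "\<exists>y\<in>U. P p0 x y"
        proof (cases "y \<in> U")
          case False
          have "P q0 x z" if "z \<in> U" for z
            using U_less[OF that _ False] U_nonneg[OF that] y by auto
          then show ?thesis using eq[OF x] by blast
        qed (use y in blast)
      next
        assume "\<exists>y\<in>U. P p0 x y"
        then obtain y where y: "y \<in> U" "P p0 x y" by blast
        then have "\<forall>z\<in>U. P q0 x z" using eq[OF x] by blast
        then have "\<forall>z\<in>{0..y}. P q0 x z" using U_down[OF y(1)] by auto
        moreover have "y \<in> {0..d}" using U_less[OF y(1) d] U_nonneg[OF y(1)] by auto
        ultimately show "x \<in> Y" using Y(2) U_nonneg[OF x] y(2) by blast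
      qed
      have "eval UM e' (case_nat (Y \<inter> U) S') (AllN (Iff (Mem (Var 0) 0) (liftS (ExN p0))))"
        using ev[OF _ _ p(1)] Yx by auto
      moreover have "Y \<inter> U \<in> sets UM" using Y(1) by simp
      ultimately show "eval UM e' S' ?B" unfolding eval.simps by blast
    qed
  qed
  then show "\<exists>p. q = ucl p \<and> (\<forall>e S. (\<forall>i. e i \<in> universe UM) \<longrightarrow> (\<forall>X. S X \<in> sets UM) \<longrightarrow> eval UM e S p)"
    using p(3) by blast
qed

text \<open>If \<open>Q\<close> held nowhere beyond \<open>U\<close>, it would be closed under
  successor, and bounded induction would carry it past the cut.\<close>

lemma overspill:
  assumes "D (\<lambda>e. Q (e 0))" "\<And>x. x \<in> U \<Longrightarrow> Q x"
  shows "\<exists>x\<ge>0. x \<notin> U \<and> Q x"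
proof (rule ccontr)
  assume no: "\<not> ?thesis"
  obtain d where d: "0 \<le> d" "d \<notin> U" using U_proper by blast
  have "Q d" using d(1)
  proof (induct d rule: D_induct)
    case (Suc x)
    then have "x \<in> U" using no by blast
    then show ?case using assms(2) U_Suc by blast
  qed (use assms U_zero in auto)
  then show False using no d by blast
qed

text \<open>Arbitrarily large nodes in the cut have all their prefixes in the tree. Overspill yields
  a node \<open>s\<close> beyond \<open>U\<close> with this property, and the prefixes of
  \<open>s\<close> inside \<open>U\<close> form the branch. The node is sought below
  \<open>d\<close> so that the overspilled statement is bounded.\<close>

lemma UM_branch:
  assumes Z: "Z \<in> \<X>" and pos: "\<And>x. x \<in> U \<Longrightarrow> x \<in> Z \<Longrightarrow> 0 < x"
    and tree: "\<And>x. x \<in> U \<Longrightarrow> 0 < x \<Longrightarrow> 2 * x \<in> Z \<or> 2 * x + 1 \<in> Z \<Longrightarrow> x \<in> Z"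
    and inf: "\<And>x. x \<in> U \<Longrightarrow> \<exists>y\<in>U. x < y \<and> y \<in> Z"
  shows "\<exists>B\<in>\<X>. (\<forall>x\<in>U. x \<in> B \<longrightarrow> x \<in> Z \<and> 0 < x) \<and> 1 \<in> B \<and>
    (\<forall>x\<in>U. 0 < x \<longrightarrow> 2 * x \<in> B \<or> 2 * x + 1 \<in> B \<longrightarrow> x \<in> B) \<and>
    (\<forall>x\<in>U. x \<in> B \<longrightarrow> (2 * x \<in> B \<longleftrightarrow> 2 * x + 1 \<notin> B))"
proof -
  obtain d where d: "0 \<le> d" "d \<notin> U" using U_proper by blast
  let ?Q = "\<lambda>x. \<exists>s\<in>{0..d}. x < s \<and> (\<forall>n\<in>{0..s}. \<forall>e\<in>{0..s}. 1 \<le> n \<longrightarrow> at e n s \<longrightarrow> n \<in> Z)"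
  have Q: "?Q x" if x: "x \<in> U" for x
  proof -
    obtain s where s: "s \<in> U" "x < s" "s \<in> Z" using inf[OF x] by blast
    have s0: "0 \<le> s" using s U_nonneg by auto
    \<comment> \<open>Strong induction on the level \<open>e\<close> walks from \<open>s\<close>
      towards the root, one parent at a time.\<close>
    have "\<forall>n\<in>{0..s}. 1 \<le> n \<longrightarrow> at e n s \<longrightarrow> n \<in> Z" if "0 \<le> e" for e
      using that
    proof (induct e rule: D_strong_induct)
      case D
      show ?case by (intro D_rules D_at D_mem Z s0)
    next
      case (less e)
      show ?case
      proof (intro ballI impI)
        fix n assume n: "n \<in> {0..s}" "1 \<le> n" "at e n s"
        show "n \<in> Z"
        proof (cases "e = 1")
          case True
          then show ?thesis using n at_one s by auto
        next
          case False
          then obtain f where f: "e = 2 * f" "pow2 f" "1 \<le> f" "f < e"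
            using pow2_half n(3) unfolding at_def by blast
          have IH: "m \<in> Z" if "at f m s" "1 \<le> m" for m
            using less(2)[of f] f at_le[OF that(1)] that by auto
          have "at f (2 * n) s \<or> at f (2 * n + 1) s" using at_child n(3) f by blast
          then have "2 * n \<in> Z \<or> 2 * n + 1 \<in> Z" using IH n(2) by auto
          moreover have "n \<in> U" using U_down[OF s(1)] n(1) by simp
          ultimately show ?thesis using tree n(2) by auto
        qed
      qed
    qed
    moreover have "s \<in> {0..d}" using U_less[OF s(1) d] s0 by simp
    ultimately show ?thesis using s(2) by (intro bexI[of _ s]) auto
  qed
  have "D (\<lambda>e. ?Q (e 0))" by (intro D_rules D_at D_mem Z d)
  from overspill[of ?Q, OF this Q] obtain x s where x: "0 \<le> x" "x \<notin> U" and s: "s \<in> {0..d}" "x < s"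
    and pre: "\<And>n e. n \<in> {0..s} \<Longrightarrow> e \<in> {0..s} \<Longrightarrow> 1 \<le> n \<Longrightarrow> at e n s \<Longrightarrow> n \<in> Z" by blast
  have sU: "s \<notin> U" using U_down[of s x] x s by auto
  have s0: "0 \<le> s" using s by simp
  have "D (\<lambda>e. 1 \<le> e 0 \<and> (\<exists>f\<in>{0..s}. at f (e 0) s))" by (intro D_rules D_at s0)
  then obtain B where B: "B \<in> \<X>" "\<forall>n\<ge>0. n \<in> B \<longleftrightarrow> 1 \<le> n \<and> (\<exists>f\<in>{0..s}. at f n s)"
    using comprehension[of "\<lambda>n. 1 \<le> n \<and> (\<exists>f\<in>{0..s}. at f n s)"] by blast
  have inB: "n \<in> B \<longleftrightarrow> 1 \<le> n \<and> (\<exists>f. at f n s)" if "0 \<le> n" for n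
  proof
    assume "1 \<le> n \<and> (\<exists>f. at f n s)"
    then obtain f where f: "1 \<le> n" "at f n s" by blast
    show "n \<in> B" using B(2) that f at_level_le[OF f(2,1)] by blast
  qed (use B(2) that in blast)
  show ?thesis
  proof (intro bexI[OF _ B(1)] conjI ballI impI)
    fix n assume n: "n \<in> U" "n \<in> B"
    then have n1: "1 \<le> n" using inB U_nonneg by blast
    then show "0 < n" by simp
    obtain f where f: "at f n s" using inB n U_nonneg by blast
    have "n \<in> {0..s}" using at_le[OF f] n1 by simp
    then show "n \<in> Z" by (rule pre[OF _ at_level_le[OF f n1] n1 f])
    \<comment> \<open>A prefix in \<open>U\<close> differs from \<open>s\<close>, so one more digit
      of \<open>s\<close> prolongs it; \<open>at_exclusive\<close> shows that only one child arises
      in this way.\<close>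
    have "f \<noteq> 1" using f at_one n(1) sU by auto
    then obtain g where g: "f = 2 * g" "pow2 g" using pow2_half f unfolding at_def by blast
    then have "at g (2 * n) s \<or> at g (2 * n + 1) s" using at_child f by blast
    then show "2 * n \<in> B \<longleftrightarrow> 2 * n + 1 \<notin> B"
      using inB[of "2 * n"] inB[of "2 * n + 1"] n1 at_exclusive[OF n1] by auto
  next
    have "1 \<le> s" using discrete[of s] s(2) x(1) by auto
    from pow2_below[OF this] obtain e where "pow2 e" "e \<le> s" "s < 2 * e" by auto
    then have "at e 1 s" by (simp add: at_def)
    then show "1 \<in> B" using inB[of 1] by auto
  next
    fix n assume n: "n \<in> U" "0 < n" "2 * n \<in> B \<or> 2 * n + 1 \<in> B"
    then have "\<exists>f. at f (2 * n) s \<or> at f (2 * n + 1) s" using inB[of "2 * n"] inB[of "2 * n + 1"] by auto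
    then obtain f where "at (2 * f) n s" using at_parent by blast
    then show "n \<in> B" using inB[of n] n(2) discrete[of n] by auto
  qed
qed

lemma UM_wkl: "eval UM e S wkl_axiom"
proof -
  have "eval UM e (case_nat (Y \<inter> U) S) (Imp (And (Binary_tree 0) (Infinite 0)) (ExS (Branch 0 1)))"
    if Y: "Y \<in> \<X>" for Y
  proof (subst eval.simps(5), rule impI)
    assume *: "eval UM e (case_nat (Y \<inter> U) S) (And (Binary_tree 0) (Infinite 0))"
    have two1: "2 * x \<in> U" if "x \<in> U" for x
      unfolding mult_2 by (rule U_add[OF that that])
    note two = two1 U_Suc[OF two1]
    have "\<exists>B\<in>\<X>. (\<forall>x\<in>U. x \<in> B \<longrightarrow> x \<in> Y \<and> 0 < x) \<and> 1 \<in> B \<and>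
      (\<forall>x\<in>U. 0 < x \<longrightarrow> 2 * x \<in> B \<or> 2 * x + 1 \<in> B \<longrightarrow> x \<in> B) \<and>
      (\<forall>x\<in>U. x \<in> B \<longrightarrow> (2 * x \<in> B \<longleftrightarrow> 2 * x + 1 \<notin> B))"
    proof (rule UM_branch[OF Y])
      show "0 < x" if "x \<in> U" "x \<in> Y" for x
        using * that by (auto simp: Binary_tree_def)
      show "x \<in> Y" if "x \<in> U" "0 < x" "2 * x \<in> Y \<or> 2 * x + 1 \<in> Y" for x
        using * that two[OF that(1)] by (auto simp: Binary_tree_def child0_def child1_def)
      show "\<exists>y\<in>U. x < y \<and> y \<in> Y" if "x \<in> U" for x
        using * that by (auto simp: Infinite_def)
    qed
    then obtain B where B: "B \<in> \<X>" "\<forall>x\<in>U. x \<in> B \<longrightarrow> x \<in> Y \<and> 0 < x" "1 \<in> B"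
      "\<forall>x\<in>U. 0 < x \<longrightarrow> 2 * x \<in> B \<or> 2 * x + 1 \<in> B \<longrightarrow> x \<in> B"
      "\<forall>x\<in>U. x \<in> B \<longrightarrow> (2 * x \<in> B \<longleftrightarrow> 2 * x + 1 \<notin> B)" by blast
    have b2: "\<forall>x\<in>U. x \<in> B \<longrightarrow> x \<in> Y" and b3: "\<forall>x\<in>U. x \<in> B \<longrightarrow> 0 < x" using B(2) by blast+
    have b4: "\<forall>x\<in>U. 0 < x \<longrightarrow> 2 * x \<notin> B \<and> 2 * x + 1 \<notin> B \<or> x \<in> B" using B(4) by blast
    have b5: "\<forall>x\<in>U. x \<in> B \<longrightarrow> (2 * x \<in> B \<longrightarrow> 2 * x + 1 \<notin> B) \<and> (2 * x + 1 \<in> B \<or> 2 * x \<in> B)"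
      using B(5) by blast
    have "eval UM e (case_nat (B \<inter> U) (case_nat (Y \<inter> U) S)) (Branch 0 1)"
      by (simp add: Branch_def Binary_tree_def child0_def child1_def two U_one B(3))
        (intro conjI; (rule b2 | rule b3 | rule b4 | rule b5))
    moreover have "B \<inter> U \<in> sets UM" using B(1) by simp
    ultimately show "eval UM e (case_nat (Y \<inter> U) S) (ExS (Branch 0 1))" unfolding eval.simps by blast
  qed
  then show ?thesis unfolding wkl_axiom_def by auto
qed

lemma UM_WKL0_star: "models UM WKL0_star"
  using UM_basic UM_induction UM_comprehension UM_exp UM_wkl
  unfolding models_def WKL0_star_def RCA0_star_def by auto

end

section \<open>A copy of the cut inside the model\<close>

fun tup :: "'a::linordered_idom list \<Rightarrow> 'a" where
  "tup [] = 0"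
| "tup [t] = t"
| "tup (t # u # us) = pr t (tup (u # us))"

lemma tval_pair [simp]: "tval (ring_str V \<Y>) e (pair s t) = pr (tval (ring_str V \<Y>) e s) (tval (ring_str V \<Y>) e t)"
  by (simp add: pair_def pr_def)

lemma tval_tuple [simp]: "tval (ring_str V \<Y>) e (tuple ts) = tup (map (tval (ring_str V \<Y>) e) ts)"
  by (induction ts rule: tuple.induct) auto

primrec nval :: "(nat \<Rightarrow> 'a::linordered_idom) \<Rightarrow> so_tm \<Rightarrow> 'a" where
  "nval v (SVar i) = v i"
| "nval v Const = 0"
| "nval v (App s) = nval v s + 1"

context rca
begin

lemma tup_nonneg: "\<forall>x\<in>set xs. 0 \<le> x \<Longrightarrow> 0 \<le> tup (xs :: 'a list)"
  by (induction xs rule: tup.induct) (auto intro: pr_nonneg)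

lemma tup_inj:
  "length xs = length ys \<Longrightarrow> \<forall>x\<in>set xs. 0 \<le> x \<Longrightarrow> \<forall>y\<in>set ys. 0 \<le> y \<Longrightarrow> tup xs = tup (ys :: 'a list) \<Longrightarrow> xs = ys"
proof (induction xs arbitrary: ys rule: tup.induct)
  case (2 t)
  then show ?case by (cases ys) auto
next
  case (3 t u us)
  then obtain t' u' us' where ys: "ys = t' # u' # us'" by (cases ys; cases "tl ys") auto
  have "0 \<le> tup (u # us)" "0 \<le> tup (u' # us')" using 3 ys by (auto intro!: tup_nonneg)
  then have "t = t'" "tup (u # us) = tup (u' # us')"
    using pr_inj[of t "tup (u # us)" t' "tup (u' # us')"] 3 ys by auto
  then show ?case using 3(1)[of "u' # us'"] 3(2-4) ys by auto
qed simp

lemma pr_mono: "0 \<le> x \<Longrightarrow> 0 \<le> y \<Longrightarrow> x \<le> x' \<Longrightarrow> y \<le> y' \<Longrightarrow> pr x y \<le> pr x' (y' :: 'a)"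
  unfolding pr_def by (intro add_mono mult_mono) auto

lemma D_eval2:
  assumes "delta0 q" "\<And>X. S X \<in> \<X>" "\<And>i. 0 \<le> e i"
  shows "D (\<lambda>f. eval MM (case_nat (f 1) (case_nat (f 0) e)) S q)"
proof -
  let ?\<tau> = "\<lambda>i. case i of 0 \<Rightarrow> (\<lambda>f. f 1) | Suc j \<Rightarrow> (case j of 0 \<Rightarrow> (\<lambda>f. f 0) | Suc j \<Rightarrow> (\<lambda>f. e j))"
  have *: "D (\<lambda>f. eval MM (\<lambda>i. ?\<tau> i f) S q)"
    using assms(3) by (intro dlt_subst[OF D_eval[OF assms(1,2)]]) (auto split: nat.split intro!: D_rules)
  have eqv: "(\<lambda>i. ?\<tau> i f) = case_nat (f 1) (case_nat (f 0) e)" for f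
    by (rule ext) (simp split: nat.split)
  show ?thesis by (rule dlt_cong[OF *]) (simp only: eqv)
qed

end

context closed_cut_model
begin

definition witness :: "'a \<Rightarrow> 'a" where
  "witness i = (THE s. 0 \<le> s \<and> K i s \<and> (\<forall>s'\<in>{0..<s}. \<not> K i s'))"

text \<open>The element \<open>i\<close> of the cut is represented by the pair of \<open>i\<close> and its least witness, so that
  the range of \<open>\<alpha>\<close> is a set of the model.\<close>

definition \<alpha> :: "'a \<Rightarrow> 'a" where "\<alpha> i = pr i (witness i)"

text \<open>The graph of \<open>\<alpha>\<close> in bounded form: a pair is at least as large as its
  witness component, and leastness only looks below that.\<close>

definition repr :: "'a \<Rightarrow> 'a \<Rightarrow> bool" where
  "repr x i \<longleftrightarrow> (\<exists>s\<in>{0..x}. x = pr i s \<and> K i s \<and> (\<forall>s'\<in>{0..<s}. \<not> K i s'))"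

lemma least_unique:
  assumes "0 \<le> s" "K i s" "\<forall>s'\<in>{0..<s}. \<not> K i s'" "0 \<le> t" "K i t" "\<forall>s'\<in>{0..<t}. \<not> K i s'"
  shows "s = t"
  using assms by (meson atLeastLessThan_iff linorder_neqE)

lemma witness_eqI:
  assumes "0 \<le> s" "K i s" "\<forall>s'\<in>{0..<s}. \<not> K i s'" shows "witness i = s"
  unfolding witness_def by (rule the_equality) (use assms least_unique in blast)+

lemma witness:
  assumes "i \<in> U" shows "0 \<le> witness i" "K i (witness i)" "\<forall>s'\<in>{0..<witness i}. \<not> K i s'"
proof -
  obtain w where w: "0 \<le> i" "0 \<le> w" "K i w" using assms unfolding U_def cut_set_def by blast
  have "D (\<lambda>e. K i (e 0))" by (intro D_rules dlt_subst2[OF sigma_cut_D[OF cut]] w)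
  from least_witness[of "K i", OF this w(2,3)]
  obtain s where s: "0 \<le> s" "K i s" "\<forall>s'\<in>{0..<s}. \<not> K i s'" by metis
  then show "0 \<le> witness i" "K i (witness i)" "\<forall>s'\<in>{0..<witness i}. \<not> K i s'"
    using witness_eqI[OF s] by simp_all
qed

lemma repr_iff:
  assumes "0 \<le> i" shows "repr x i \<longleftrightarrow> i \<in> U \<and> x = \<alpha> i"
proof
  assume "repr x i"
  then obtain s where s: "0 \<le> s" "x = pr i s" "K i s" "\<forall>s'\<in>{0..<s}. \<not> K i s'" unfolding repr_def by auto
  then have "i \<in> U" unfolding U_def cut_set_def using assms by blast
  then show "i \<in> U \<and> x = \<alpha> i" using witness_eqI[OF s(1,3,4)] s(2) by (simp add: \<alpha>_def)
next
  assume i: "i \<in> U \<and> x = \<alpha> i"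
  then have "witness i \<in> {0..x}" using witness(1) pr_ge[OF assms] by (simp add: \<alpha>_def)
  then show "repr x i" unfolding repr_def using witness i by (intro bexI[of _ "witness i"]) (auto simp: \<alpha>_def)
qed

lemma D_repr0: "D (\<lambda>e. repr (e 0) (e 1))"
  unfolding repr_def by (intro D_rules T_pr dlt_subst2[OF sigma_cut_D[OF cut]])

lemmas D_repr = dlt_subst2[OF D_repr0]

lemma \<alpha>_ge: "i \<in> U \<Longrightarrow> i \<le> \<alpha> i"
  unfolding \<alpha>_def using pr_ge U_nonneg witness(1) by blast

lemma \<alpha>_nonneg: "i \<in> U \<Longrightarrow> 0 \<le> \<alpha> i"
  using \<alpha>_ge U_nonneg order_trans by blast

lemma \<alpha>_inj: "i \<in> U \<Longrightarrow> j \<in> U \<Longrightarrow> \<alpha> i = \<alpha> j \<Longrightarrow> i = j"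
  unfolding \<alpha>_def using pr_inj U_nonneg witness(1) by blast

lemma tup_U: "set xs \<subseteq> U \<Longrightarrow> tup xs \<in> U"
  by (induction xs rule: tup.induct) (auto simp: U_zero pr_def intro!: U_add U_mult)

text \<open>\<open>SA\<close> and \<open>SF\<close> are the universe and the graph of a copy, along \<open>\<beta>\<close>, of the successor structure
  on the cut.\<close>

definition copy :: "'a set \<Rightarrow> ('a \<Rightarrow> 'a) \<Rightarrow> 'a set \<Rightarrow> 'a set \<Rightarrow> bool" where
  "copy V \<beta> SA SF \<longleftrightarrow> (\<forall>k\<in>U. \<beta> k \<in> V) \<and> (\<forall>x\<in>V. x \<in> SA \<longleftrightarrow> (\<exists>k\<in>U. x = \<beta> k)) \<and>
     (\<forall>k\<in>U. \<forall>y\<in>V. pr (\<beta> k) y \<in> SF \<longleftrightarrow> y = \<beta> (k + 1))"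

lemma
  assumes "copy V \<beta> SA SF"
  shows copy_in: "k \<in> U \<Longrightarrow> \<beta> k \<in> V"
    and copy_univ: "x \<in> V \<Longrightarrow> x \<in> SA \<longleftrightarrow> (\<exists>k\<in>U. x = \<beta> k)"
    and copy_graph: "k \<in> U \<Longrightarrow> y \<in> V \<Longrightarrow> pr (\<beta> k) y \<in> SF \<longleftrightarrow> y = \<beta> (k + 1)"
  using assms unfolding copy_def by simp_all

lemma nval_U: "so_tm_wf n s \<Longrightarrow> (\<And>i. i < n \<Longrightarrow> v i \<in> U) \<Longrightarrow> nval v s \<in> U"
  by (induction s) (auto intro: U_zero U_Suc)

section \<open>Evaluating terms, atoms and relations in a copy of the cut\<close>

context
  fixes V :: "'a set" and \<Y> :: "'a set set" and \<beta> :: "'a \<Rightarrow> 'a"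
  assumes V: "segment V" and Y: "\<Y> \<noteq> {}"
begin

lemma tval_V: "(\<And>i. e i \<in> V) \<Longrightarrow> tval (ring_str V \<Y>) e t \<in> V"
  using tval_in[OF segment_wf[OF V Y], of e t] by simp

text \<open>Stated for general \<open>V\<close> and \<open>\<beta>\<close> because it is used twice:
  along \<open>\<alpha>\<close> in the full model and along the identity in the cut.\<close>

lemma eval_Value:
  assumes "so_tm_wf n s" "\<And>i. i < n \<Longrightarrow> v i \<in> U"
  shows "(\<And>i. e i \<in> V) \<Longrightarrow> copy V \<beta> SA (S F) \<Longrightarrow> (\<And>i. i < n \<Longrightarrow> tval (ring_str V \<Y>) e (en i) = \<beta> (v i)) \<Longrightarrow>
    tval (ring_str V \<Y>) e c = \<beta> 0 \<Longrightarrow> eval (ring_str V \<Y>) e S (Value F c en s y) \<longleftrightarrow> tval (ring_str V \<Y>) e y = \<beta> (nval v s)"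
  using assms(1)
proof (induction s arbitrary: e c en y)
  case (SVar i)
  then show ?case by auto
next
  case Const
  then show ?case by auto
next
  case (App s)
  let ?k = "nval v s"
  have k: "?k \<in> U" using nval_U[of n s v] App.prems(5) assms(2) by simp
  have IH: "eval (ring_str V \<Y>) (case_nat z e) S (Value F (tlift c) (\<lambda>i. tlift (en i)) s (Var 0)) \<longleftrightarrow> z = \<beta> ?k"
    if "z \<in> V" for z
    using App.IH[of "case_nat z e" "\<lambda>i. tlift (en i)" "tlift c" "Var 0"] App.prems that
    by (simp add: case_nat_in)
  have "eval (ring_str V \<Y>) e S (Value F c en (App s) y) \<longleftrightarrow> (\<exists>z\<in>V. z = \<beta> ?k \<and> pr z (tval (ring_str V \<Y>) e y) \<in> S F)"
    using IH by simp
  also have "\<dots> \<longleftrightarrow> pr (\<beta> ?k) (tval (ring_str V \<Y>) e y) \<in> S F"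
    using copy_in[OF App.prems(2) k] by blast
  also have "\<dots> \<longleftrightarrow> tval (ring_str V \<Y>) e y = \<beta> (?k + 1)"
    by (rule copy_graph[OF App.prems(2) k tval_V[OF App.prems(1)]])
  finally show ?case by simp
qed

lemma eval_Holds:
  assumes "\<And>i. i < n \<Longrightarrow> v i \<in> U"
  shows "\<forall>t\<in>set ts. so_tm_wf n t \<Longrightarrow> (\<And>i. e i \<in> V) \<Longrightarrow> copy V \<beta> SA (S F) \<Longrightarrow>
    (\<And>i. i < n \<Longrightarrow> tval (ring_str V \<Y>) e (en i) = \<beta> (v i)) \<Longrightarrow> tval (ring_str V \<Y>) e c = \<beta> 0 \<Longrightarrow>
    eval (ring_str V \<Y>) e S (Holds R F c en us ts) \<longleftrightarrow> tup (map (tval (ring_str V \<Y>) e) us @ map (\<lambda>t. \<beta> (nval v t)) ts) \<in> S R"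
proof (induction ts arbitrary: e c en us)
  case (Cons t ts)
  let ?k = "nval v t"
  have t: "so_tm_wf n t" using Cons.prems(1) by simp
  have k: "?k \<in> U" using nval_U[OF t] assms by blast
  have Vt: "eval (ring_str V \<Y>) (case_nat z e) S (Value F (tlift c) (\<lambda>i. tlift (en i)) t (Var 0)) \<longleftrightarrow> z = \<beta> ?k"
    if "z \<in> V" for z
    using eval_Value[OF t assms, where e = "case_nat z e" and SA = SA and S = S and F = F
      and en = "\<lambda>i. tlift (en i)" and c = "tlift c" and y = "Var 0"] Cons.prems that
    by (simp add: case_nat_in)
  have H: "eval (ring_str V \<Y>) (case_nat z e) S (Holds R F (tlift c) (\<lambda>i. tlift (en i)) (map tlift us @ [Var 0]) ts) \<longleftrightarrow>
    tup (map (tval (ring_str V \<Y>) e) us @ z # map (\<lambda>t. \<beta> (nval v t)) ts) \<in> S R" if "z \<in> V" for z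
    using Cons.IH[of "case_nat z e" "\<lambda>i. tlift (en i)" "tlift c" "map tlift us @ [Var 0]"] Cons.prems that
    by (simp add: case_nat_in comp_def)
  have "eval (ring_str V \<Y>) e S (Holds R F c en us (t # ts)) \<longleftrightarrow>
    (\<exists>z\<in>V. z = \<beta> ?k \<and> tup (map (tval (ring_str V \<Y>) e) us @ z # map (\<lambda>t. \<beta> (nval v t)) ts) \<in> S R)"
    using Vt H by simp
  also have "\<dots> \<longleftrightarrow> tup (map (tval (ring_str V \<Y>) e) us @ \<beta> ?k # map (\<lambda>t. \<beta> (nval v t)) ts) \<in> S R"
    using copy_in[OF Cons.prems(3) k] by blast
  finally show ?case by simp
qed simp

lemma eval_Tuple_ext:
  "(\<And>i. e i \<in> V) \<Longrightarrow> copy V \<beta> (S A) SF \<Longrightarrow>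
   eval (ring_str V \<Y>) e S (Tuple_ext A k us x) \<longleftrightarrow>
     (\<exists>ii. length ii = k \<and> set ii \<subseteq> U \<and> tval (ring_str V \<Y>) e x = tup (map (tval (ring_str V \<Y>) e) us @ map \<beta> ii))"
proof (induction k arbitrary: e us x)
  case (Suc k)
  have IH: "eval (ring_str V \<Y>) (case_nat z e) S (Tuple_ext A k (map tlift us @ [Var 0]) (tlift x)) \<longleftrightarrow>
    (\<exists>ii. length ii = k \<and> set ii \<subseteq> U \<and> tval (ring_str V \<Y>) e x = tup (map (tval (ring_str V \<Y>) e) us @ z # map \<beta> ii))" if "z \<in> V" for z
    using Suc.IH[of "case_nat z e" "map tlift us @ [Var 0]" "tlift x"] Suc.prems that
    by (simp add: case_nat_in comp_def)
  have "eval (ring_str V \<Y>) e S (Tuple_ext A (Suc k) us x) \<longleftrightarrow>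
    (\<exists>z\<in>V. z \<in> S A \<and> (\<exists>ii. length ii = k \<and> set ii \<subseteq> U \<and> tval (ring_str V \<Y>) e x = tup (map (tval (ring_str V \<Y>) e) us @ z # map \<beta> ii)))"
    using IH by simp
  also have "\<dots> \<longleftrightarrow> (\<exists>j\<in>U. \<exists>ii. length ii = k \<and> set ii \<subseteq> U \<and> tval (ring_str V \<Y>) e x = tup (map (tval (ring_str V \<Y>) e) us @ \<beta> j # map \<beta> ii))"
    using copy_univ[OF Suc.prems(2)] copy_in[OF Suc.prems(2)] by blast
  also have "\<dots> \<longleftrightarrow> (\<exists>ii. length ii = Suc k \<and> set ii \<subseteq> U \<and> tval (ring_str V \<Y>) e x = tup (map (tval (ring_str V \<Y>) e) us @ map \<beta> ii))"
    (is "?l \<longleftrightarrow> ?r")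
  proof
    assume ?l
    then obtain j js where "j \<in> U" "length js = k" "set js \<subseteq> U"
      "tval (ring_str V \<Y>) e x = tup (map (tval (ring_str V \<Y>) e) us @ \<beta> j # map \<beta> js)" by blast
    then show ?r by (intro exI[of _ "j # js"]) simp
  next
    assume ?r
    then obtain js where js: "length js = Suc k" "set js \<subseteq> U" "tval (ring_str V \<Y>) e x = tup (map (tval (ring_str V \<Y>) e) us @ map \<beta> js)" by blast
    then obtain j js' where "js = j # js'" by (cases js) auto
    then show ?l using js by auto
  qed
  finally show ?case .
qed simp

lemma eval_Relation_on:
  assumes "\<And>i. e i \<in> V" "copy V \<beta> (S A) SF"
  shows "eval (ring_str V \<Y>) e S (Relation_on k R A) \<longleftrightarrow>
    (\<forall>x\<in>V. x \<in> S R \<longrightarrow> (\<exists>ii. length ii = k \<and> set ii \<subseteq> U \<and> x = tup (map \<beta> ii)))"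
  using eval_Tuple_ext[where A = A and S = S and SF = SF and e = "case_nat _ e" and k = k and us = "[]"
    and x = "Var 0", OF _ assms(2)] assms(1)
  by (simp add: Relation_on_def case_nat_in)

end

text \<open>\<open>proj k x t\<close>: \<open>x\<close> is the tuple of the representatives of the \<open>k\<close> entries of the tuple \<open>t\<close>.\<close>

primrec proj :: "nat \<Rightarrow> 'a \<Rightarrow> 'a \<Rightarrow> bool" where
  "proj 0 x t \<longleftrightarrow> x = 0 \<and> t = 0"
| "proj (Suc k) x t \<longleftrightarrow> k = 0 \<and> repr x t \<or> k \<noteq> 0 \<and>
     (\<exists>a\<in>{0..x}. \<exists>x'\<in>{0..x}. \<exists>i\<in>{0..t}. \<exists>t'\<in>{0..t}. x = pr a x' \<and> t = pr i t' \<and> repr a i \<and> proj k x' t')"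

text \<open>A separating set may contain numbers of the cut that code no \<open>k\<close>-tuple;
  this filter removes them, so that the trace is a \<open>k\<close>-ary relation.\<close>

primrec is_tup :: "nat \<Rightarrow> 'a \<Rightarrow> bool" where
  "is_tup 0 t \<longleftrightarrow> t = 0"
| "is_tup (Suc k) t \<longleftrightarrow> k = 0 \<or> k \<noteq> 0 \<and> (\<exists>i\<in>{0..t}. \<exists>t'\<in>{0..t}. t = pr i t' \<and> is_tup k t')"

lemma D_proj0: "D (\<lambda>e. proj k (e 0) (e 1))"
proof (induction k)
  case 0
  show ?case by (simp only: proj.simps) (intro D_rules)
next
  case (Suc k)
  show ?case unfolding proj.simps by (intro D_rules D_repr T_pr dlt_subst2[OF Suc])
qed

lemma D_is_tup0: "D (\<lambda>e. is_tup k (e 0))"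
proof (induction k)
  case 0
  show ?case by (simp only: is_tup.simps) (intro D_rules)
next
  case (Suc k)
  show ?case unfolding is_tup.simps by (intro D_rules T_pr dlt_subst1[OF Suc])
qed

lemma map_\<alpha>_nonneg: "set ii \<subseteq> U \<Longrightarrow> 0 \<le> tup (map \<alpha> ii)"
  using \<alpha>_nonneg by (intro tup_nonneg) auto

lemma tup_Cons: "length xs = Suc k \<Longrightarrow> tup (x # xs) = pr x (tup xs)"
  by (cases xs) auto

lemma proj_iff:
  "0 \<le> x \<Longrightarrow> 0 \<le> t \<Longrightarrow> proj k x t \<longleftrightarrow> (\<exists>ii. length ii = k \<and> set ii \<subseteq> U \<and> x = tup (map \<alpha> ii) \<and> t = tup ii)"
proof (induction k arbitrary: x t)
  case (Suc k)
  show ?case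
  proof (cases k)
    case 0
    have "(\<exists>ii. length ii = Suc 0 \<and> set ii \<subseteq> U \<and> x = tup (map \<alpha> ii) \<and> t = tup ii) \<longleftrightarrow> t \<in> U \<and> x = \<alpha> t"
      (is "?l \<longleftrightarrow> ?r")
    proof
      assume ?r
      then show ?l by (intro exI[of _ "[t]"]) simp
    qed (auto simp: length_Suc_conv)
    then show ?thesis using 0 repr_iff[OF Suc.prems(2)] by simp
  next
    case (Suc l)
    show ?thesis
    proof
      have k0: "k \<noteq> 0" using Suc by simp
      assume "proj (Suc k) x t"
      then obtain a x' i t' where *: "a \<in> {0..x}" "x' \<in> {0..x}" "i \<in> {0..t}" "t' \<in> {0..t}"
        "x = pr a x'" "t = pr i t'" "repr a i" "proj k x' t'"
        using k0 unfolding proj.simps by blast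
      then obtain js where js: "length js = k" "set js \<subseteq> U" "x' = tup (map \<alpha> js)" "t' = tup js"
        using Suc.IH[of x' t'] by auto
      have "i \<in> U" "a = \<alpha> i" using * repr_iff[of i a] by auto
      then show "\<exists>ii. length ii = Suc k \<and> set ii \<subseteq> U \<and> x = tup (map \<alpha> ii) \<and> t = tup ii"
        using * js Suc by (intro exI[of _ "i # js"]) (simp add: tup_Cons[where k = l])
    next
      assume "\<exists>ii. length ii = Suc k \<and> set ii \<subseteq> U \<and> x = tup (map \<alpha> ii) \<and> t = tup ii"
      then obtain i js where js: "length js = k" "i \<in> U" "set js \<subseteq> U" "x = tup (map \<alpha> (i # js))" "t = tup (i # js)"
        by (auto simp: length_Suc_conv)
      have nn: "0 \<le> tup js" "0 \<le> tup (map \<alpha> js)" "0 \<le> i" "0 \<le> \<alpha> i"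
        using U_nonneg[OF js(2)] \<alpha>_nonneg[OF js(2)] U_nonneg[OF tup_U[OF js(3)]] map_\<alpha>_nonneg[OF js(3)]
        by simp_all
      have eq: "x = pr (\<alpha> i) (tup (map \<alpha> js))" "t = pr i (tup js)"
        using js Suc by (simp_all add: tup_Cons[where k = l])
      have "proj k (tup (map \<alpha> js)) (tup js)" using Suc.IH nn js by blast
      moreover have "repr (\<alpha> i) i" using repr_iff nn js by blast
      moreover have "\<alpha> i \<in> {0..x}" "tup (map \<alpha> js) \<in> {0..x}" "i \<in> {0..t}" "tup js \<in> {0..t}"
        using pr_ge nn eq by auto
      ultimately show "proj (Suc k) x t" using eq Suc unfolding proj.simps by blast
    qed
  qed
qed simp

lemma is_tup_iff: "t \<in> U \<Longrightarrow> is_tup k t \<longleftrightarrow> (\<exists>ii. length ii = k \<and> set ii \<subseteq> U \<and> t = tup ii)"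
proof (induction k arbitrary: t)
  case (Suc k)
  show ?case
  proof (cases k)
    case 0
    have "\<exists>ii. length ii = Suc 0 \<and> set ii \<subseteq> U \<and> t = tup ii"
      using Suc.prems by (intro exI[of _ "[t]"]) simp
    then show ?thesis using 0 by simp
  next
    case (Suc l)
    show ?thesis
    proof
      have k0: "k \<noteq> 0" using Suc by simp
      assume "is_tup (Suc k) t"
      then obtain i t' where *: "i \<in> {0..t}" "t' \<in> {0..t}" "t = pr i t'" "is_tup k t'"
        using k0 unfolding is_tup.simps by blast
      have U: "i \<in> U" "t' \<in> U" using * U_down[OF Suc.prems] by auto
      then obtain js where js: "length js = k" "set js \<subseteq> U" "t' = tup js" using Suc.IH * by blast
      then show "\<exists>ii. length ii = Suc k \<and> set ii \<subseteq> U \<and> t = tup ii"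
        using * U Suc by (intro exI[of _ "i # js"]) (simp add: tup_Cons[where k = l])
    next
      assume "\<exists>ii. length ii = Suc k \<and> set ii \<subseteq> U \<and> t = tup ii"
      then obtain i js where js: "length js = k" "i \<in> U" "set js \<subseteq> U" "t = tup (i # js)"
        by (auto simp: length_Suc_conv)
      have eq: "t = pr i (tup js)" using js Suc by (simp add: tup_Cons[where k = l])
      have "is_tup k (tup js)" using Suc.IH[OF tup_U[OF js(3)]] js by blast
      moreover have "i \<in> {0..t}" "tup js \<in> {0..t}"
        using pr_ge[of i "tup js"] U_nonneg js(2) U_nonneg[OF tup_U[OF js(3)]] eq by auto
      ultimately show "is_tup (Suc k) t" using eq Suc unfolding is_tup.simps by blast
    qed
  qed
qed simp

section \<open>Relations on the copy and traces on the cut\<close>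

definition corr :: "nat \<Rightarrow> 'a set \<Rightarrow> 'a set \<Rightarrow> bool" where
  "corr k R R' \<longleftrightarrow> (\<forall>ii. length ii = k \<longrightarrow> set ii \<subseteq> U \<longrightarrow> (tup (map \<alpha> ii) \<in> R \<longleftrightarrow> tup ii \<in> R'))"

text \<open>That the tuple of representatives lies in \<open>R\<close>, and that it lies outside
  \<open>R\<close>, are both Sigma_1 conditions on \<open>t\<close>, the tuple being the witness.
  They are complementary only for tuples from \<open>U\<close>, so comprehension does not apply, but
  separation below \<open>d\<close> gives a set with the right trace.\<close>

lemma corr_down:
  assumes R: "R \<in> \<X>"
  shows "\<exists>Y\<in>\<X>. corr k R (Y \<inter> U) \<and> (\<forall>t\<in>U. t \<in> Y \<inter> U \<longrightarrow> (\<exists>ii. length ii = k \<and> set ii \<subseteq> U \<and> t = tup ii))"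
proof -
  obtain d where d: "0 \<le> d" "d \<notin> U" using U_proper by blast
  have W: "D (\<lambda>e. (\<lambda>t x. x \<in> R \<and> proj k x t) (e 0) (e 1))"
    by (intro D_rules D_mem R dlt_subst2[OF D_proj0])
  have W': "D (\<lambda>e. (\<lambda>t x. x \<notin> R \<and> proj k x t) (e 0) (e 1))"
    by (intro D_rules D_mem R dlt_subst2[OF D_proj0])
  have disj: "False" if w: "t \<in> {0..<d}" "0 \<le> w" "0 \<le> w'" "w \<in> R \<and> proj k w t" "w' \<notin> R \<and> proj k w' t" for t w w'
  proof -
    obtain ii where L: "length ii = k" "set ii \<subseteq> U" "w = tup (map \<alpha> ii)" "t = tup ii"
      using w proj_iff[of w t k] by auto
    obtain js where js: "length js = k" "set js \<subseteq> U" "w' = tup (map \<alpha> js)" "t = tup js"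
      using w proj_iff[of w' t k] by auto
    have "ii = js" using tup_inj[of ii js] L js U_nonneg by auto
    then show False using L js w by simp
  qed
  have "\<exists>Y\<in>\<X>. \<forall>t\<in>{0..<d}. \<forall>w\<ge>0. (w \<in> R \<and> proj k w t \<longrightarrow> t \<in> Y) \<and> (w \<notin> R \<and> proj k w t \<longrightarrow> t \<notin> Y)"
    by (rule separation[OF d(1) W W']) (rule disj; assumption)
  then obtain Y where Y: "Y \<in> \<X>"
    "\<forall>t\<in>{0..<d}. \<forall>w\<ge>0. (w \<in> R \<and> proj k w t \<longrightarrow> t \<in> Y) \<and> (w \<notin> R \<and> proj k w t \<longrightarrow> t \<notin> Y)"
    by blast
  have "D (\<lambda>e. e 0 \<in> Y \<and> is_tup k (e 0))" by (intro D_rules D_mem Y dlt_subst1[OF D_is_tup0])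
  then obtain Y' where Y': "Y' \<in> \<X>" "\<forall>t\<ge>0. t \<in> Y' \<longleftrightarrow> t \<in> Y \<and> is_tup k t"
    using comprehension[of "\<lambda>t. t \<in> Y \<and> is_tup k t"] by blast
  have "corr k R (Y' \<inter> U)" unfolding corr_def
  proof (intro allI impI)
    fix ii assume L: "length ii = k" "set ii \<subseteq> U"
    let ?t = "tup ii" and ?x = "tup (map \<alpha> ii)"
    have t: "?t \<in> U" "0 \<le> ?t" "?t \<in> {0..<d}" and x: "0 \<le> ?x"
      using tup_U[OF L(2)] U_nonneg U_less[OF _ d] map_\<alpha>_nonneg[OF L(2)] by auto
    have "proj k ?x ?t" using proj_iff[OF x t(2)] L by blast
    then have "?x \<in> R \<longleftrightarrow> ?t \<in> Y" using Y(2) t(3) x by blast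
    moreover have "is_tup k ?t" using is_tup_iff[OF t(1)] L by blast
    ultimately show "?x \<in> R \<longleftrightarrow> ?t \<in> Y' \<inter> U" using Y'(2) t by blast
  qed
  moreover have "\<exists>ii. length ii = k \<and> set ii \<subseteq> U \<and> t = tup ii" if "t \<in> U" "t \<in> Y' \<inter> U" for t
    using that Y'(2) U_nonneg is_tup_iff by blast
  ultimately show ?thesis using Y'(1) by blast
qed

lemma tup_le: "set ii \<subseteq> U \<Longrightarrow> tup ii \<le> tup (map \<alpha> ii)"
proof (induction ii rule: tup.induct)
  case (3 t u us)
  then have "tup (u # us) \<le> tup (map \<alpha> (u # us))" "0 \<le> tup (u # us)"
    using U_nonneg tup_U[of "u # us"] by auto
  then show ?case using 3(2) \<alpha>_ge U_nonneg by (auto intro!: pr_mono)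
qed (auto simp: \<alpha>_ge)

text \<open>Each entry is at most its representative, so \<open>t\<close> is bounded by the tuple of
  representatives, and plain comprehension suffices in this direction.\<close>

lemma corr_up:
  assumes Y: "Y \<in> \<X>"
  shows "\<exists>R\<in>\<X>. corr k R (Y \<inter> U) \<and> (\<forall>x\<ge>0. x \<in> R \<longrightarrow> (\<exists>ii. length ii = k \<and> set ii \<subseteq> U \<and> x = tup (map \<alpha> ii)))"
proof -
  have "D (\<lambda>e. \<exists>t\<in>{0..e 0}. proj k (e 0) t \<and> t \<in> Y)" by (intro D_rules D_mem Y dlt_subst2[OF D_proj0])
  then obtain R where R: "R \<in> \<X>" "\<forall>x\<ge>0. x \<in> R \<longleftrightarrow> (\<exists>t\<in>{0..x}. proj k x t \<and> t \<in> Y)"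
    using comprehension[of "\<lambda>x. \<exists>t\<in>{0..x}. proj k x t \<and> t \<in> Y"] by blast
  have "corr k R (Y \<inter> U)" unfolding corr_def
  proof (intro allI impI)
    fix ii assume L: "length ii = k" "set ii \<subseteq> U"
    let ?t = "tup ii" and ?x = "tup (map \<alpha> ii)"
    have t: "?t \<in> U" "0 \<le> ?t" "?t \<in> {0..?x}" and x: "0 \<le> ?x"
      using tup_U[OF L(2)] U_nonneg tup_le[OF L(2)] map_\<alpha>_nonneg[OF L(2)] by auto
    show "?x \<in> R \<longleftrightarrow> ?t \<in> Y \<inter> U"
    proof
      assume "?x \<in> R"
      then obtain t where t': "t \<in> {0..?x}" "proj k ?x t" "t \<in> Y" using R(2) x by blast
      then obtain js where js: "length js = k" "set js \<subseteq> U" "?x = tup (map \<alpha> js)" "t = tup js"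
        using proj_iff[OF x, of t k] by auto
      have "map \<alpha> ii = map \<alpha> js"
        using tup_inj[of "map \<alpha> ii" "map \<alpha> js"] L js \<alpha>_nonneg by auto
      moreover have "inj_on \<alpha> (set ii \<union> set js)" using L(2) js(2) \<alpha>_inj by (intro inj_onI) blast
      ultimately have "ii = js" by (rule map_inj_on)
      then show "?t \<in> Y \<inter> U" using js t' t by simp
    next
      assume "?t \<in> Y \<inter> U"
      moreover have "proj k ?x ?t" using proj_iff[OF x t(2)] L by blast
      ultimately show "?x \<in> R" using R(2) x t(3) by blast
    qed
  qed
  moreover have "\<exists>ii. length ii = k \<and> set ii \<subseteq> U \<and> x = tup (map \<alpha> ii)" if x: "0 \<le> x" "x \<in> R" for x
  proof -
    obtain t where "t \<in> {0..x}" "proj k x t" using R(2) x by blast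
    then show ?thesis using proj_iff[OF x(1), of t k] by auto
  qed
  ultimately show ?thesis using R(1) by blast
qed

text \<open>A back-and-forth argument: individuals match along \<open>\<alpha>\<close>, relations
  under \<open>corr\<close>. At a relation quantifier, truth passes from the model to the cut by
  \<open>corr_up\<close> and back by \<open>corr_down\<close>.\<close>

lemma Sat_transfer:
  "so_wf n ks p \<Longrightarrow> (\<And>i. 0 \<le> e i) \<Longrightarrow> (\<And>i. e' i \<in> U) \<Longrightarrow> (\<And>i. i < n \<Longrightarrow> e i = \<alpha> (e' i)) \<Longrightarrow>
   (\<And>i. i < length ks \<Longrightarrow> corr (ks ! i) (S i) (S' i)) \<Longrightarrow>
   copy {0..} \<alpha> (S A) (S F) \<Longrightarrow> copy U (\<lambda>i. i) (S' A) (S' F) \<Longrightarrow>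
   tval MM e c = \<alpha> 0 \<Longrightarrow> tval UM e' c' = 0 \<Longrightarrow>
   eval MM e S (Sat A F c p) \<longleftrightarrow> eval UM e' S' (Sat A F c' p)"
proof (induction p arbitrary: n ks e e' S S' A F c c')
  case SFalsum
  then show ?case by simp
next
  case (SEq s t)
  have M: "eval MM (case_nat z e) S (Value F (tlift c) (\<lambda>i. Var (Suc i)) s (Var 0)) \<longleftrightarrow> z = \<alpha> (nval e' s)"
    if "0 \<le> z" "so_tm_wf n s" for z s
  proof -
    have nn: "case_nat z e i \<in> {0..}" for i using that SEq.prems(2) by (simp split: nat.split)
    have "eval MM (case_nat z e) S (Value F (tlift c) (\<lambda>i. Var (Suc i)) s (Var 0)) \<longleftrightarrow>
        tval MM (case_nat z e) (Var 0) = \<alpha> (nval e' s)"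
      by (rule eval_Value[where n = n and SA = "S A", OF segment_UNIV nonempty that(2)])
        (use nn SEq.prems in simp_all)
    then show ?thesis by simp
  qed
  have N: "eval UM (case_nat z e') S' (Value F (tlift c') (\<lambda>i. Var (Suc i)) s (Var 0)) \<longleftrightarrow> z = nval e' s"
    if "z \<in> U" "so_tm_wf n s" for z s
  proof -
    have nn: "case_nat z e' i \<in> U" for i using that SEq.prems(3) by (simp split: nat.split)
    have "eval UM (case_nat z e') S' (Value F (tlift c') (\<lambda>i. Var (Suc i)) s (Var 0)) \<longleftrightarrow>
        tval UM (case_nat z e') (Var 0) = nval e' s"
      by (rule eval_Value[where n = n and SA = "S' A" and \<beta> = "\<lambda>i. i", OF U_segment UM_sets that(2)])
        (use nn SEq.prems in simp_all)
    then show ?thesis by simp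
  qed
  have st: "so_tm_wf n s" "so_tm_wf n t" using SEq.prems(1) by simp_all
  have k: "nval e' s \<in> U" "nval e' t \<in> U" using nval_U st SEq.prems(3) by blast+
  have "eval MM e S (Sat A F c (SEq s t)) \<longleftrightarrow> (\<exists>z\<in>{0..}. z = \<alpha> (nval e' s) \<and> z = \<alpha> (nval e' t))"
    using M[OF _ st(1)] M[OF _ st(2)] by simp
  also have "\<dots> \<longleftrightarrow> nval e' s = nval e' t" using k \<alpha>_nonneg \<alpha>_inj by auto
  also have "\<dots> \<longleftrightarrow> (\<exists>z\<in>U. z = nval e' s \<and> z = nval e' t)" using k by auto
  also have "\<dots> \<longleftrightarrow> eval UM e' S' (Sat A F c' (SEq s t))"
    using N[OF _ st(1)] N[OF _ st(2)] by simp
  finally show ?case .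
next
  case (SRel R ts)
  have ts: "\<forall>t\<in>set ts. so_tm_wf n t" "R < length ks" "length ts = ks ! R" using SRel.prems(1) by simp_all
  have "eval MM e S (Sat A F c (SRel R ts)) \<longleftrightarrow> tup (map (\<lambda>t. \<alpha> (nval e' t)) ts) \<in> S R"
    using eval_Holds[OF segment_UNIV nonempty _ ts(1), where v = e' and e = e and \<beta> = \<alpha> and SA = "S A"
      and S = S and F = F and en = Var and c = c and R = R and us = "[]"] SRel.prems by simp
  also have "\<dots> \<longleftrightarrow> tup (map \<alpha> (map (nval e') ts)) \<in> S R" by (simp add: comp_def)
  also have "\<dots> \<longleftrightarrow> tup (map (nval e') ts) \<in> S' R"
  proof -
    have "nval e' t \<in> U" if "t \<in> set ts" for t
      using nval_U[of n t e'] ts(1) that SRel.prems(3) by simp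
    then have "set (map (nval e') ts) \<subseteq> U" by auto
    moreover have "length (map (nval e') ts) = ks ! R" using ts(3) by simp
    ultimately show ?thesis using SRel.prems(5)[OF ts(2)] unfolding corr_def by blast
  qed
  also have "\<dots> \<longleftrightarrow> eval UM e' S' (Sat A F c' (SRel R ts))"
    using eval_Holds[OF U_segment UM_sets _ ts(1), where v = e' and e = e' and \<beta> = "\<lambda>i. i" and SA = "S' A"
      and S = S' and F = F and en = Var and c = c' and R = R and us = "[]"] SRel.prems by simp
  finally show ?case .
next
  case (SImp p q)
  have wf: "so_wf n ks p" "so_wf n ks q" using SImp.prems(1) by simp_all
  have "eval MM e S (Sat A F c p) \<longleftrightarrow> eval UM e' S' (Sat A F c' p)"
    by (rule SImp.IH(1)[OF wf(1)]) (use SImp.prems(2-) in simp_all)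
  moreover have "eval MM e S (Sat A F c q) \<longleftrightarrow> eval UM e' S' (Sat A F c' q)"
    by (rule SImp.IH(2)[OF wf(2)]) (use SImp.prems(2-) in simp_all)
  ultimately show ?case by simp
next
  case (SAll p)
  have IH: "eval MM (case_nat (\<alpha> k) e) S (Sat A F (tlift c) p) \<longleftrightarrow>
      eval UM (case_nat k e') S' (Sat A F (tlift c') p)" if k: "k \<in> U" for k
  proof (rule SAll.IH)
    show "so_wf (Suc n) ks p" using SAll.prems(1) by simp
    show "0 \<le> case_nat (\<alpha> k) e i" for i using SAll.prems(2) \<alpha>_nonneg[OF k] by (simp split: nat.split)
    show "case_nat k e' i \<in> U" for i using SAll.prems(3) k by (simp split: nat.split)
    show "case_nat (\<alpha> k) e i = \<alpha> (case_nat k e' i)" if "i < Suc n" for i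
      using SAll.prems(4) that by (simp split: nat.split)
  qed (use SAll.prems in simp_all)
  have "eval MM e S (Sat A F c (SAll p)) \<longleftrightarrow>
     (\<forall>x\<in>{0..}. x \<in> S A \<longrightarrow> eval MM (case_nat x e) S (Sat A F (tlift c) p))" by simp
  also have "\<dots> \<longleftrightarrow> (\<forall>k\<in>U. eval MM (case_nat (\<alpha> k) e) S (Sat A F (tlift c) p))"
    using copy_univ[OF SAll.prems(6)] copy_in[OF SAll.prems(6)] by blast
  also have "\<dots> \<longleftrightarrow> (\<forall>k\<in>U. eval UM (case_nat k e') S' (Sat A F (tlift c') p))" using IH by blast
  also have "\<dots> \<longleftrightarrow> (\<forall>k\<in>U. k \<in> S' A \<longrightarrow> eval UM (case_nat k e') S' (Sat A F (tlift c') p))"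
    using copy_univ[OF SAll.prems(7)] by blast
  also have "\<dots> \<longleftrightarrow> eval UM e' S' (Sat A F c' (SAll p))" by simp
  finally show ?case .
next
  case (SAllR k p)
  have rel: "eval MM e (case_nat R S) (Relation_on k 0 (Suc A)) \<longleftrightarrow>
     (\<forall>x\<ge>0. x \<in> R \<longrightarrow> (\<exists>ii. length ii = k \<and> set ii \<subseteq> U \<and> x = tup (map \<alpha> ii)))" for R
  proof -
    have "eval MM e (case_nat R S) (Relation_on k 0 (Suc A)) \<longleftrightarrow>
      (\<forall>x\<in>{0..}. x \<in> case_nat R S 0 \<longrightarrow> (\<exists>ii. length ii = k \<and> set ii \<subseteq> U \<and> x = tup (map \<alpha> ii)))"
      by (rule eval_Relation_on[where SF = "S F" and \<beta> = \<alpha>, OF segment_UNIV nonempty])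
        (use SAllR.prems(2,6) in simp_all)
    then show ?thesis by (simp add: Ball_def)
  qed
  have rel': "eval UM e' (case_nat R' S') (Relation_on k 0 (Suc A)) \<longleftrightarrow>
     (\<forall>x\<in>U. x \<in> R' \<longrightarrow> (\<exists>ii. length ii = k \<and> set ii \<subseteq> U \<and> x = tup ii))" for R'
  proof -
    have "eval UM e' (case_nat R' S') (Relation_on k 0 (Suc A)) \<longleftrightarrow>
      (\<forall>x\<in>U. x \<in> case_nat R' S' 0 \<longrightarrow> (\<exists>ii. length ii = k \<and> set ii \<subseteq> U \<and> x = tup (map (\<lambda>i. i) ii)))"
      by (rule eval_Relation_on[where SF = "S' F" and \<beta> = "\<lambda>i. i", OF U_segment UM_sets])
        (use SAllR.prems(3,7) in simp_all)
    then show ?thesis by simp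
  qed
  have IH: "eval MM e (case_nat R S) (Sat (Suc A) (Suc F) c p) \<longleftrightarrow>
      eval UM e' (case_nat R' S') (Sat (Suc A) (Suc F) c' p)" if R: "corr k R R'" for R R'
  proof (rule SAllR.IH)
    show "so_wf n (k # ks) p" using SAllR.prems(1) by simp
    show "corr ((k # ks) ! i) (case_nat R S i) (case_nat R' S' i)" if "i < length (k # ks)" for i
      using SAllR.prems(5) that R by (cases i) auto
  qed (use SAllR.prems in simp_all)
  show ?case
  proof
    assume l: "eval MM e S (Sat A F c (SAllR k p))"
    have "eval UM e' (case_nat (Y \<inter> U) S') (Imp (Relation_on k 0 (Suc A)) (Sat (Suc A) (Suc F) c' p))"
      if Y: "Y \<in> \<X>" for Y
    proof -
      obtain R where R: "R \<in> \<X>" "corr k R (Y \<inter> U)"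
        "\<forall>x\<ge>0. x \<in> R \<longrightarrow> (\<exists>ii. length ii = k \<and> set ii \<subseteq> U \<and> x = tup (map \<alpha> ii))" using corr_up[OF Y] by blast
      have "eval MM e (case_nat R S) (Sat (Suc A) (Suc F) c p)" using l R(1,3) rel by simp
      then show ?thesis using IH[OF R(2)] by simp
    qed
    then show "eval UM e' S' (Sat A F c' (SAllR k p))" by simp
  next
    assume r: "eval UM e' S' (Sat A F c' (SAllR k p))"
    have "eval MM e (case_nat R S) (Imp (Relation_on k 0 (Suc A)) (Sat (Suc A) (Suc F) c p))"
      if R: "R \<in> \<X>" for R
    proof -
      obtain Y where Y: "Y \<in> \<X>" "corr k R (Y \<inter> U)"
        "\<forall>t\<in>U. t \<in> Y \<inter> U \<longrightarrow> (\<exists>ii. length ii = k \<and> set ii \<subseteq> U \<and> t = tup ii)" using corr_down[OF R] by blast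
      have "eval UM e' (case_nat (Y \<inter> U) S') (Relation_on k 0 (Suc A))" using Y(3) rel' by blast
      then have "eval UM e' (case_nat (Y \<inter> U) S') (Sat (Suc A) (Suc F) c' p)" using r Y(1) by simp
      then show ?thesis using IH[OF Y(2)] by simp
    qed
    then show "eval MM e S (Sat A F c (SAllR k p))" by simp
  qed
qed

end

section \<open>The copy as a structure of the model, and the contradiction\<close>

context closed_cut_model
begin

text \<open>Each value is some \<open>\<alpha> k\<close> with \<open>k < d\<close>, but nothing yet
  bounds its witness component. Collection bounds the witnesses needed for arguments up to
  \<open>P\<close>, which leaves an injective relation from \<open>{0..P}\<close> to
  \<open>{0..<d}\<close> with a bounded definition.\<close>

lemma no_bijection:
  assumes H: "H \<in> \<X>" and tot: "\<forall>x\<ge>0. \<exists>k\<in>U. pr x (\<alpha> k) \<in> H"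
    and inj: "\<forall>x\<ge>0. \<forall>x'\<ge>0. \<forall>k\<in>U. pr x (\<alpha> k) \<in> H \<longrightarrow> pr x' (\<alpha> k) \<in> H \<longrightarrow> x = x'"
  shows False
proof -
  obtain d where d: "0 \<le> d" "d \<notin> U" using U_proper by blast
  obtain b where b: "1 \<le> b" "\<forall>j\<in>{0..d}. 1 \<le> j \<longrightarrow> j dvd b" using common_multiple[OF d(1)] by blast
  \<comment> \<open>The coded sequence is constantly 0; what is wanted is the common multiple
    \<open>P\<close> of the moduli.\<close>
  have "D (\<lambda>e. (\<lambda>i v. v = 0) (e 0) (e 1))" by (intro D_rules)
  moreover have "\<forall>i\<in>{0..<d}. \<exists>v\<in>{0..b}. v = 0" using b(1) by auto
  ultimately obtain P a where P: "0 \<le> a" "a < P" "\<forall>i\<in>{0..<d}. (1 + (i + 1) * b) dvd P"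
    using chinese_remainder[OF d(1) b, of "\<lambda>i v. v = 0"] by blast
  have P0: "0 < P" using P by simp
  let ?\<theta> = "\<lambda>x s. \<exists>i\<in>{0..<d}. pr x (pr i s) \<in> H \<and> repr (pr i s) i"
  have "D (\<lambda>e. ?\<theta> (e 0) (e 1))" by (intro D_rules D_mem H T_pr D_repr d)
  moreover have "\<forall>x\<in>{0..<P + 1}. \<exists>s\<ge>0. ?\<theta> x s"
  proof
    fix x assume "x \<in> {0..<P + 1}"
    then obtain k where k: "k \<in> U" "pr x (\<alpha> k) \<in> H" using tot by auto
    have "repr (\<alpha> k) k" using repr_iff[OF U_nonneg[OF k(1)]] k(1) by blast
    moreover have "k \<in> {0..<d}" using U_less[OF k(1) d] U_nonneg[OF k(1)] by simp
    ultimately have "?\<theta> x (witness k)" using k(2) unfolding \<alpha>_def by blast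
    then show "\<exists>s\<ge>0. ?\<theta> x s" using witness(1)[OF k(1)] by blast
  qed
  ultimately obtain w where w: "0 \<le> w" "\<forall>x\<in>{0..<P + 1}. \<exists>s\<in>{0..w}. ?\<theta> x s"
    using collection[of ?\<theta> "P + 1"] P0 by auto
  let ?h = "\<lambda>x j. \<exists>s\<in>{0..w}. pr x (pr j s) \<in> H \<and> repr (pr j s) j"
  show False
  proof (rule no_injection[OF d(1) _ P0 b P(3), of ?h])
    show "D (\<lambda>e. ?h (e 0) (e 1))" by (intro D_rules D_mem H T_pr D_repr w)
    show "\<exists>j\<in>{0..<d}. ?h x j" if "x \<in> {0..P}" for x
    proof -
      have "x \<in> {0..<P + 1}" using that less_plus_one[of x P] by simp
      then show ?thesis using w(2) by blast
    qed
    show "x = x'" if x: "x \<in> {0..P}" "x' \<in> {0..P}" "j \<in> {0..<d}" "?h x j" "?h x' j" for x x' j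
    proof -
      have j: "0 \<le> j" using x(3) by simp
      obtain s where s: "pr x (pr j s) \<in> H" "repr (pr j s) j" using x(4) by blast
      obtain s' where s': "pr x' (pr j s') \<in> H" "repr (pr j s') j" using x(5) by blast
      have "j \<in> U" "pr j s = \<alpha> j" "pr j s' = \<alpha> j" using repr_iff[OF j] s(2) s'(2) by blast+
      then show ?thesis using inj s(1) s'(1) x(1,2) by auto
    qed
  qed
qed

text \<open>\<open>copy\<close> only tests pairs whose first entry is a representative. The second
  clause excludes other elements from \<open>F\<close>, as \<open>Function\<close> demands of a
  graph.\<close>

lemma copy_exists: "\<exists>A\<in>\<X>. \<exists>F\<in>\<X>. copy {0..} \<alpha> A F \<and>
  (\<forall>x\<ge>0. x \<in> F \<longrightarrow> (\<exists>k\<in>U. x = pr (\<alpha> k) (\<alpha> (k + 1))))"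
proof -
  have "D (\<lambda>e. \<exists>i\<in>{0..e 0}. repr (e 0) i)" by (intro D_rules D_repr)
  then obtain A where A: "A \<in> \<X>" "\<forall>x\<ge>0. x \<in> A \<longleftrightarrow> (\<exists>i\<in>{0..x}. repr x i)"
    using comprehension[of "\<lambda>x. \<exists>i\<in>{0..x}. repr x i"] by blast
  let ?f = "\<lambda>x. \<exists>a\<in>{0..x}. \<exists>b\<in>{0..x}. \<exists>i\<in>{0..x}. x = pr a b \<and> repr a i \<and> repr b (i + 1)"
  have "D (\<lambda>e. ?f (e 0))" by (intro D_rules D_repr T_pr)
  then obtain F where F: "F \<in> \<X>" "\<forall>x\<ge>0. x \<in> F \<longleftrightarrow> ?f x" using comprehension[of ?f] by blast
  have f: "?f x \<longleftrightarrow> (\<exists>k\<in>U. x = pr (\<alpha> k) (\<alpha> (k + 1)))" for x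
  proof
    assume "?f x"
    then obtain a b i where "0 \<le> i" "x = pr a b" "repr a i" "repr b (i + 1)" by auto
    then show "\<exists>k\<in>U. x = pr (\<alpha> k) (\<alpha> (k + 1))" using repr_iff[of i] repr_iff[of "i + 1"] by auto
  next
    assume "\<exists>k\<in>U. x = pr (\<alpha> k) (\<alpha> (k + 1))"
    then obtain k where k: "k \<in> U" "x = pr (\<alpha> k) (\<alpha> (k + 1))" by blast
    have k0: "0 \<le> k" "k \<le> \<alpha> k" "0 \<le> \<alpha> k" "0 \<le> \<alpha> (k + 1)"
      using U_nonneg \<alpha>_ge \<alpha>_nonneg k(1) U_Suc by auto
    have "repr (\<alpha> k) k" "repr (\<alpha> (k + 1)) (k + 1)"
      using repr_iff[of k] repr_iff[of "k + 1"] k(1) U_Suc[OF k(1)] k0(1) by auto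
    moreover have "\<alpha> k \<in> {0..x}" "\<alpha> (k + 1) \<in> {0..x}" using pr_ge[OF k0(3,4)] k0 k(2) by auto
    moreover have "k \<in> {0..x}" using calculation(3) k0 by auto
    ultimately show "?f x" using k(2) by blast
  qed
  have "copy {0..} \<alpha> A F"
    unfolding copy_def
  proof (intro conjI ballI)
    show "\<alpha> k \<in> {0..}" if "k \<in> U" for k using \<alpha>_nonneg[OF that] by simp
    show "x \<in> A \<longleftrightarrow> (\<exists>k\<in>U. x = \<alpha> k)" if x: "x \<in> {0..}" for x
    proof
      assume "x \<in> A"
      then obtain i where "0 \<le> i" "repr x i" using A(2)[rule_format, of x] x by auto
      then show "\<exists>k\<in>U. x = \<alpha> k" using repr_iff by blast
    next
      assume "\<exists>k\<in>U. x = \<alpha> k"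
      then obtain k where k: "k \<in> U" "x = \<alpha> k" by blast
      then have "repr x k" "k \<in> {0..x}" using repr_iff U_nonneg \<alpha>_ge by auto
      then show "x \<in> A" using A(2)[rule_format, of x] x by auto
    qed
    show "pr (\<alpha> k) y \<in> F \<longleftrightarrow> y = \<alpha> (k + 1)" if k: "k \<in> U" and y: "y \<in> {0..}" for k y
    proof -
      have k0: "0 \<le> \<alpha> k" "0 \<le> y" using \<alpha>_nonneg k y by auto
      have "pr (\<alpha> k) y \<in> F \<longleftrightarrow> (\<exists>l\<in>U. pr (\<alpha> k) y = pr (\<alpha> l) (\<alpha> (l + 1)))"
        using F(2) f pr_nonneg[OF k0] by blast
      also have "\<dots> \<longleftrightarrow> y = \<alpha> (k + 1)"
      proof
        assume "\<exists>l\<in>U. pr (\<alpha> k) y = pr (\<alpha> l) (\<alpha> (l + 1))"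
        then obtain l where l: "l \<in> U" "pr (\<alpha> k) y = pr (\<alpha> l) (\<alpha> (l + 1))" by blast
        have "\<alpha> k = \<alpha> l \<and> y = \<alpha> (l + 1)"
          using l k0 \<alpha>_nonneg U_Suc by (intro pr_inj) auto
        then show "y = \<alpha> (k + 1)" using \<alpha>_inj[OF k l(1)] by simp
      qed (use k in blast)
      finally show ?thesis .
    qed
  qed
  then show ?thesis using A(1) F f by blast
qed

lemma eval_Structure:
  assumes cp: "copy {0..} \<alpha> A F" and F: "\<forall>x\<ge>0. x \<in> F \<longrightarrow> (\<exists>k\<in>U. x = pr (\<alpha> k) (\<alpha> (k + 1)))"
  shows "eval MM (case_nat (\<alpha> 0) e) (case_nat A (case_nat F S)) (Structure 0 1 (Var 0))"
proof -
  have A: "\<alpha> k \<in> A" "0 \<le> \<alpha> k" if "k \<in> U" for k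
    using copy_univ[OF cp] \<alpha>_nonneg[OF that] that by auto
  have f1: "\<forall>x\<in>{0..}. x \<in> F \<longrightarrow> (\<exists>a\<in>{0..}. \<exists>b\<in>{0..}. a \<in> A \<and> b \<in> A \<and> x = pr a b)"
  proof (intro ballI impI)
    fix x :: 'a assume "x \<in> {0..}" "x \<in> F"
    then obtain k where k: "k \<in> U" "x = pr (\<alpha> k) (\<alpha> (k + 1))" using F by auto
    then show "\<exists>a\<in>{0..}. \<exists>b\<in>{0..}. a \<in> A \<and> b \<in> A \<and> x = pr a b"
      using A[OF k(1)] A[OF U_Suc[OF k(1)]] by auto
  qed
  have f2: "\<forall>x\<in>{0..}. x \<in> A \<longrightarrow> (\<exists>y\<in>{0..}. pr x y \<in> F)"
  proof (intro ballI impI)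
    fix x :: 'a assume "x \<in> {0..}" "x \<in> A"
    then obtain k where k: "k \<in> U" "x = \<alpha> k" using copy_univ[OF cp] by blast
    then show "\<exists>y\<in>{0..}. pr x y \<in> F"
      using copy_graph[OF cp k(1)] A(2)[OF U_Suc[OF k(1)]] by auto
  qed
  have f3: "\<forall>x\<in>{0..}. \<forall>y\<in>{0..}. \<forall>z\<in>{0..}. pr x y \<in> F \<longrightarrow> pr x z \<in> F \<longrightarrow> y = z"
  proof (intro ballI impI)
    fix x y z :: 'a assume xyz: "x \<in> {0..}" "y \<in> {0..}" "z \<in> {0..}" "pr x y \<in> F" "pr x z \<in> F"
    then have "0 \<le> pr x y" using pr_nonneg by simp
    then obtain k where k: "k \<in> U" "pr x y = pr (\<alpha> k) (\<alpha> (k + 1))" using F xyz(4) by blast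
    have "x = \<alpha> k \<and> y = \<alpha> (k + 1)"
      using k xyz A(2) U_Suc by (intro pr_inj) auto
    then show "y = z" using copy_graph[OF cp k(1)] xyz by auto
  qed
  have "\<alpha> 0 \<in> A" using A(1)[OF U_zero] .
  then show ?thesis
    using f1 f2 f3 by (simp add: Structure_def Function_def eval_nat_numeral)
qed

theorem no_categorical_sentence:
  assumes \<psi>: "so_sentence \<psi>" and prov: "WKL0_star \<turnstile> Nat_sat \<psi>"
    and e: "\<And>i. 0 \<le> e i" and S: "\<And>X. S X \<in> \<X>"
    and bij: "eval MM e S (Models_bij_Nat \<psi>)"
  shows False
proof -
  obtain A F where A: "A \<in> \<X>" and F: "F \<in> \<X>" and cp: "copy {0..} \<alpha> A F"
    and Fp: "\<forall>x\<ge>0. x \<in> F \<longrightarrow> (\<exists>k\<in>U. x = pr (\<alpha> k) (\<alpha> (k + 1)))" using copy_exists by blast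
  let ?S' = "\<lambda>X. S X \<inter> U"
  have "D (\<lambda>e. True)" by (intro D_rules)
  then obtain Y0 where Y0: "Y0 \<in> \<X>" "\<forall>x\<ge>0. x \<in> Y0" using comprehension[of "\<lambda>_. True"] by blast
  have "D (\<lambda>e. \<exists>i\<in>{0..e 0}. e 0 = pr i (i + 1))" by (intro D_rules T_pr)
  then obtain Y1 where Y1: "Y1 \<in> \<X>" "\<forall>x\<ge>0. x \<in> Y1 \<longleftrightarrow> (\<exists>i\<in>{0..x}. x = pr i (i + 1))"
    using comprehension[of "\<lambda>x. \<exists>i\<in>{0..x}. x = pr i (i + 1)"] by blast
  have Y1': "x \<in> Y1 \<longleftrightarrow> (\<exists>i\<in>U. x = pr i (i + 1))" if x: "x \<in> U" for x
  proof
    assume "x \<in> Y1"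
    then obtain i where "i \<in> {0..x}" "x = pr i (i + 1)" using Y1(2) U_nonneg[OF x] by blast
    then show "\<exists>i\<in>U. x = pr i (i + 1)" using U_down[OF x] by auto
  next
    assume "\<exists>i\<in>U. x = pr i (i + 1)"
    then obtain i where i: "i \<in> U" "x = pr i (i + 1)" by blast
    then have "i \<in> {0..x}" using pr_ge[of i "i + 1"] U_nonneg[OF i(1)] by auto
    then show "x \<in> Y1" using Y1(2) U_nonneg[OF x] i(2) by blast
  qed
  \<comment> \<open>Here the provability hypothesis enters: soundness transfers it to the cut with
    its traces.\<close>
  have "eval UM (\<lambda>_. 0) ?S' (Nat_sat \<psi>)"
    by (rule soundness[OF prov UM_wf])
      (use UM_WKL0_star U_zero S in \<open>auto simp: models_def\<close>)
  moreover have "Y0 \<inter> U \<in> sets UM" "Y1 \<inter> U \<in> sets UM" using Y0 Y1 by auto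
  ultimately have "eval UM (\<lambda>_. 0) (case_nat (Y0 \<inter> U) (case_nat (Y1 \<inter> U) ?S'))
      (Imp (And (All_numbers 0) (Successor_graph 1)) (Sat 0 1 Zero \<psi>))"
    unfolding Nat_sat_def eval.simps by blast
  moreover have "eval UM (\<lambda>_. 0) (case_nat (Y0 \<inter> U) (case_nat (Y1 \<inter> U) ?S')) (All_numbers 0)"
    using Y0(2) U_nonneg by (simp add: All_numbers_def)
  moreover have "eval UM (\<lambda>_. 0) (case_nat (Y0 \<inter> U) (case_nat (Y1 \<inter> U) ?S')) (Successor_graph 1)"
    using Y1' by (simp add: Successor_graph_def)
  ultimately have "eval UM (\<lambda>_. 0) (case_nat (Y0 \<inter> U) (case_nat (Y1 \<inter> U) ?S')) (Sat 0 1 Zero \<psi>)"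
    by simp
  moreover have cpU: "copy U (\<lambda>i. i) (Y0 \<inter> U) (Y1 \<inter> U)"
    unfolding copy_def
  proof (intro conjI ballI)
    show "x \<in> Y0 \<inter> U \<longleftrightarrow> (\<exists>k\<in>U. x = k)" if "x \<in> U" for x using that Y0(2) U_nonneg by auto
    show "pr k y \<in> Y1 \<inter> U \<longleftrightarrow> y = k + 1" if k: "k \<in> U" and y: "y \<in> U" for k y
    proof -
      have "tup [k, y] \<in> U" using k y by (intro tup_U) auto
      then have U: "pr k y \<in> U" by simp
      have "(\<exists>i\<in>U. pr k y = pr i (i + 1)) \<longleftrightarrow> y = k + 1"
      proof
        assume "\<exists>i\<in>U. pr k y = pr i (i + 1)"
        then obtain i where i: "i \<in> U" "pr k y = pr i (i + 1)" by blast
        then have "k = i \<and> y = i + 1" using U_nonneg k y U_Suc by (intro pr_inj) auto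
        then show "y = k + 1" by simp
      qed (use k in blast)
      then show ?thesis using Y1'[OF U] U by blast
    qed
  qed
  \<comment> \<open>A sentence starts with no matched variables, so only the universe, the graph and
    the constant have to correspond.\<close>
  moreover have "eval MM (case_nat (\<alpha> 0) e) (case_nat A (case_nat F S)) (Sat 0 1 (Var 0) \<psi>) \<longleftrightarrow>
     eval UM (\<lambda>_. 0) (case_nat (Y0 \<inter> U) (case_nat (Y1 \<inter> U) ?S')) (Sat 0 1 Zero \<psi>)"
  proof (rule Sat_transfer[of 0 "[]"])
    show "so_wf 0 [] \<psi>" using \<psi> by (simp add: so_sentence_def)
    show "0 \<le> case_nat (\<alpha> 0) e i" for i using e \<alpha>_nonneg[OF U_zero] by (simp split: nat.split)
  qed (use U_zero cp cpU in simp_all)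
  ultimately have sat: "eval MM (case_nat (\<alpha> 0) e) (case_nat A (case_nat F S)) (Sat 0 1 (Var 0) \<psi>)" by blast
  note str = eval_Structure[OF cp Fp, of e S]
  have \<alpha>0: "\<alpha> 0 \<in> universe MM" using \<alpha>_nonneg[OF U_zero] by simp
  have "eval MM e (case_nat F S) (AllS (AllN
       (Imp (Structure 0 1 (Var 0))
         (Imp (Sat 0 1 (Var 0) \<psi>)
           (ExS (ExS (And (All_numbers 1) (Bijection 0 1 2))))))))"
    using bij F unfolding Models_bij_Nat_def by (subst (asm) eval.simps(7)) simp
  then have "eval MM e (case_nat A (case_nat F S)) (AllN
       (Imp (Structure 0 1 (Var 0))
         (Imp (Sat 0 1 (Var 0) \<psi>)
           (ExS (ExS (And (All_numbers 1) (Bijection 0 1 2)))))))"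
    using A by (subst (asm) eval.simps(7)) simp
  then have "eval MM (case_nat (\<alpha> 0) e) (case_nat A (case_nat F S))
       (Imp (Structure 0 1 (Var 0))
         (Imp (Sat 0 1 (Var 0) \<psi>)
           (ExS (ExS (And (All_numbers 1) (Bijection 0 1 2))))))"
    using \<alpha>0 by (subst (asm) eval.simps(6)) blast
  then have "eval MM (case_nat (\<alpha> 0) e) (case_nat A (case_nat F S))
           (ExS (ExS (And (All_numbers 1) (Bijection 0 1 2))))"
    using str sat by (metis eval.simps(5))
  then obtain Z H where H: "H \<in> \<X>"
    and b: "eval MM (case_nat (\<alpha> 0) e) (case_nat H (case_nat Z (case_nat A (case_nat F S))))
        (And (All_numbers 1) (Bijection 0 1 2))" by auto
  have N: "\<forall>x\<in>{0..}. x \<in> Z" using b by (simp add: All_numbers_def)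
  have H1: "\<forall>x\<in>{0..}. x \<in> H \<longrightarrow> (\<exists>a\<in>{0..}. \<exists>b\<in>{0..}. a \<in> Z \<and> b \<in> A \<and> x = pr a b)"
    and H2: "\<forall>x\<in>{0..}. x \<in> Z \<longrightarrow> (\<exists>y\<in>{0..}. pr x y \<in> H)"
    and H3: "\<forall>x\<in>{0..}. \<forall>x'\<in>{0..}. (\<forall>y\<in>{0..}. pr x y \<in> H \<longrightarrow> pr x' y \<notin> H) \<or> x = x'"
    using b by (simp_all add: Bijection_def Function_def eval_nat_numeral)
  show False
  proof (rule no_bijection[OF H]; intro allI impI ballI)
    fix x :: 'a assume x: "0 \<le> x"
    then obtain y where y: "0 \<le> y" "pr x y \<in> H" using H2 N by auto
    then obtain a b where ab: "0 \<le> a" "0 \<le> b" "b \<in> A" "pr x y = pr a b" using H1 pr_nonneg[OF x y(1)] by auto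
    then have "y \<in> A" using pr_inj[OF x y(1) ab(1,2,4)] by simp
    then obtain k where "k \<in> U" "y = \<alpha> k" using copy_univ[OF cp] y(1) by auto
    then show "\<exists>k\<in>U. pr x (\<alpha> k) \<in> H" using y(2) by blast
  next
    fix x x' k assume x: "0 \<le> x" "0 \<le> x'" "k \<in> U" "pr x (\<alpha> k) \<in> H" "pr x' (\<alpha> k) \<in> H"
    then have "x \<in> {0..}" "x' \<in> {0..}" "\<alpha> k \<in> {0..}" using \<alpha>_nonneg by simp_all
    then show "x = x'" using H3 x(4,5) by blast
  qed
qed

end

context rca
begin

theorem sigma1_induction:
  assumes \<psi>: "so_sentence \<psi>" "WKL0_star \<turnstile> Nat_sat \<psi>"
    and e: "\<And>i. 0 \<le> e i" "\<And>X. S X \<in> \<X>" "eval MM e S (Models_bij_Nat \<psi>)"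
  shows "models MM (induction sigma1)"
proof (rule models_uclI)
  fix q assume "q \<in> induction sigma1"
  then obtain r where r: "q = ucl (ind_axiom (ExN r))" "delta0 r"
    unfolding induction_def sigma1_def by blast
  have "eval MM f R (ind_axiom (ExN r))" if uni: "\<forall>i. f i \<in> universe MM" "\<forall>X. R X \<in> sets MM" for f R
  proof -
    have f: "0 \<le> f i" "R X \<in> \<X>" for i X using uni by simp_all
    define \<theta> where "\<theta> x y = eval MM (case_nat y (case_nat x f)) R r" for x y
    have D\<theta>: "D (\<lambda>e. \<theta> (e 0) (e 1))" unfolding \<theta>_def by (rule D_eval2[OF r(2) f(2,1)])
    define P where "P x \<longleftrightarrow> (\<exists>y\<ge>0. \<theta> x y)" for x
    have ev: "eval MM (case_nat x f) R (ExN r) \<longleftrightarrow> P x" for x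
      by (simp add: P_def \<theta>_def Bex_def)
    have P: "P d" if P0: "P 0" and PS: "\<And>x. 0 \<le> x \<Longrightarrow> P x \<Longrightarrow> P (x + 1)" and d: "0 \<le> d" for d
    proof (rule ccontr)
      assume "\<not> P d"
      then have "sigma_cut (\<lambda>x w. \<forall>x'\<in>{0..x}. \<exists>y\<in>{0..w}. \<theta> x' y)"
        using sigma_cut_of_failure[OF D\<theta> _ _ d] P0 PS unfolding P_def by blast
      from closed_cut[OF this] obtain K where "sigma_cut K" "\<forall>x\<in>cut_set K. \<forall>y\<in>cut_set K.
          x + y \<in> cut_set K \<and> x * y \<in> cut_set K \<and> pw x y \<in> cut_set K" by blast
      then interpret closed_cut_model \<X> K by unfold_locales
      show False by (rule no_categorical_sentence[OF \<psi> e])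
    qed
    have **: "(\<lambda>i. tval MM (case_nat x f) (case i of 0 \<Rightarrow> Add (Var 0) One | Suc i \<Rightarrow> Var (Suc i)))
      = case_nat (x + 1) f" for x
      by (rule ext) (auto split: nat.split)
    have "eval MM f R (ind_axiom (ExN r)) \<longleftrightarrow>
        (eval MM (case_nat 0 f) R (ExN r) \<longrightarrow>
          (\<forall>x\<in>{0..}. eval MM (case_nat x f) R (ExN r) \<longrightarrow> eval MM (case_nat (x + 1) f) R (ExN r)) \<longrightarrow>
          (\<forall>x\<in>{0..}. eval MM (case_nat x f) R (ExN r)))"
      unfolding ind_axiom_def eval.simps(5)[of _ _ _ "instN _ _"] eval.simps(5)[of _ _ _ "AllN _"]
        eval.simps(6)[of _ _ _ "Imp _ _"] eval.simps(6)[of _ _ _ "ExN r"]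
        eval.simps(5)[of _ _ _ "ExN r"] eval_instN eval_substN ** by simp
    then show ?thesis unfolding ev using P by auto
  qed
  then show "\<exists>p. q = ucl p \<and> (\<forall>e S. (\<forall>i. e i \<in> universe MM) \<longrightarrow> (\<forall>X. S X \<in> sets MM) \<longrightarrow> eval MM e S p)"
    using r(1) by blast
qed

end

section \<open>The theorem\<close>

text \<open>To reason about a given countermodel with the arithmetic of an ordered ring, its universe is turned
  into a type. The countermodel therefore has to be a global constant; it is a
  counterexample if there is one, and the standard model otherwise.\<close>

definition standard :: "nat str" where
  "standard = \<lparr>universe = UNIV, zeroS = 0, oneS = 1, plusS = (+), timesS = (*), lessS = (<), sets = UNIV\<rparr>"

lemma standard_simps [simp]:
  "universe standard = UNIV" "zeroS standard = 0" "oneS standard = 1" "plusS standard = (+)"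
  "timesS standard = (*)" "lessS standard = (<)" "sets standard = UNIV"
  by (simp_all add: standard_def)

text \<open>The sentence is quantified inside, so that one constant serves all sentences.\<close>

definition counterexample :: "nat str \<Rightarrow> bool" where
  "counterexample M \<longleftrightarrow> wf_str M \<and> models M RCA0_star \<and> \<not> models M RCA0 \<and>
     (\<exists>\<psi> e S. so_sentence \<psi> \<and> (WKL0_star \<turnstile> Nat_sat \<psi>) \<and> (\<forall>i. e i \<in> universe M) \<and>
       (\<forall>X. S X \<in> sets M) \<and> eval M e S (Models_bij_Nat \<psi>))"

definition KM :: "nat str" where
  "KM = (if \<exists>M. counterexample M then SOME M. counterexample M else standard)"

text \<open>The type over \<open>KM\<close> and its ordering are constructed unconditionally, so the
  default value must satisfy the basic axioms and bounded induction too.\<close>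

lemma weak_arith_standard: "weak_arith standard"
proof
  show "wf_str standard" by (simp add: wf_str_def)
  show "models standard basic_axioms"
  proof (rule models_uclI)
    fix q assume "q \<in> basic_axioms"
    then obtain p where p: "q = ucl p" and B: "p \<in> basic_fms"
      unfolding basic_axioms_eq by (rule imageE)
    have "eval standard e S p" for e S
      using B unfolding basic_fms_def by (elim insertE emptyE) auto
    then show "\<exists>p. q = ucl p \<and> (\<forall>e S. (\<forall>i. e i \<in> universe standard) \<longrightarrow> (\<forall>X. S X \<in> sets standard) \<longrightarrow>
        eval standard e S p)" using p by blast
  qed
  show "models standard (induction delta0)"
  proof (rule models_uclI)
    fix q assume "q \<in> induction delta0"
    then obtain p where p: "q = ucl (ind_axiom p)" unfolding induction_def by blast
    have **: "(\<lambda>i. tval standard (case_nat x e) (case i of 0 \<Rightarrow> Add (Var 0) One | Suc i \<Rightarrow> Var (Suc i)))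
      = case_nat (Suc x) e" for x e
      by (rule ext) (auto split: nat.split)
    have "eval standard e S (ind_axiom p)" for e S
    proof -
      define P where "P x = eval standard (case_nat x e) S p" for x
      have "eval standard e S (ind_axiom p) \<longleftrightarrow> (P 0 \<longrightarrow> (\<forall>x. P x \<longrightarrow> P (Suc x)) \<longrightarrow> (\<forall>x. P x))"
        unfolding P_def ind_axiom_def by (simp add: eval_instN eval_substN **)
      moreover have "P 0 \<longrightarrow> (\<forall>x. P x \<longrightarrow> P (Suc x)) \<longrightarrow> P n" for n by (induction n) auto
      ultimately show ?thesis by blast
    qed
    then show "\<exists>p. q = ucl p \<and> (\<forall>e S. (\<forall>i. e i \<in> universe standard) \<longrightarrow> (\<forall>X. S X \<in> sets standard) \<longrightarrow>
        eval standard e S p)" using p by blast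
  qed
qed

lemma counterexample_KM: "counterexample M \<Longrightarrow> counterexample KM"
  unfolding KM_def by (auto intro: someI)

interpretation KM: weak_arith KM
proof (cases "\<exists>M. counterexample M")
  case True
  then have "counterexample KM" using counterexample_KM by blast
  then show "weak_arith KM"
    by unfold_locales (auto simp: counterexample_def models_def RCA0_star_def)
next
  case False
  then show "weak_arith KM" using weak_arith_standard by (simp add: KM_def)
qed

typedef knum = "universe KM"
  using KM.zero_in by blast

setup_lifting type_definition_knum

instantiation knum :: arith_semiring
begin

lift_definition zero_knum :: knum is "zeroS KM" by simp
lift_definition one_knum :: knum is "oneS KM" by simp
lift_definition plus_knum :: "knum \<Rightarrow> knum \<Rightarrow> knum" is "plusS KM" by simp
lift_definition times_knum :: "knum \<Rightarrow> knum \<Rightarrow> knum" is "timesS KM" by simp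
lift_definition less_knum :: "knum \<Rightarrow> knum \<Rightarrow> bool" is "lessS KM" .
definition less_eq_knum :: "knum \<Rightarrow> knum \<Rightarrow> bool" where
  "less_eq_knum x y \<longleftrightarrow> x < y \<or> x = y"

instance
proof
  fix a b c :: knum
  show "a + b + c = a + (b + c)" by transfer (rule KM.add_assoc)
  show "a + b = b + a" by transfer (rule KM.add_commute)
  show "0 + a = a" by transfer (rule KM.zero_add)
  show "a * b * c = a * (b * c)" by transfer (rule KM.mul_assoc)
  show "a * b = b * a" by transfer (rule KM.mul_commute)
  show "1 * a = a" by transfer (rule KM.one_mul)
  show "0 * a = 0" by transfer (rule KM.zero_mul)
  show "a * 0 = 0" by transfer (rule KM.mul_0)
  show "(a + b) * c = a * c + b * c"
    by transfer (simp add: KM.mul_commute[of _ "_ :: nat"] KM.distrib)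
  show "(0 :: knum) \<noteq> 1"
    by transfer (metis KM.Suc_neq_zero KM.zero_add KM.one_in KM.zero_in)
  show "a + 1 \<noteq> 0" by transfer (rule KM.Suc_neq_zero)
  show less: "a < b \<longleftrightarrow> (\<exists>c. b = a + c + 1)" for a b :: knum
    by transfer (simp add: KM.less_iff_add)
  have irrefl: "\<not> a < a" for a :: knum by transfer (rule KM.less_irrefl)
  have trans: "a < b \<Longrightarrow> b < c \<Longrightarrow> a < c" for a b c :: knum by transfer (rule KM.less_trans)
  have linear: "a < b \<or> a = b \<or> b < a" for a b :: knum by transfer (rule KM.less_linear)
  show "a < b \<longleftrightarrow> a \<le> b \<and> \<not> b \<le> a" unfolding less_eq_knum_def using irrefl trans by metis
  show "a \<le> a" by (simp add: less_eq_knum_def)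
  show "a \<le> b \<Longrightarrow> b \<le> c \<Longrightarrow> a \<le> c" unfolding less_eq_knum_def using trans by metis
  show "a \<le> b \<Longrightarrow> b \<le> a \<Longrightarrow> a = b" unfolding less_eq_knum_def using trans irrefl by metis
  show "a \<le> b \<or> b \<le> a" unfolding less_eq_knum_def using linear by metis
qed

end

section \<open>Transport of the countermodel to an ordered ring\<close>

definition kemb :: "nat \<Rightarrow> knum zint" where
  "kemb x = emb (Abs_knum x)"

definition ksets :: "knum zint set set" where
  "ksets = (\<lambda>Y. kemb ` (Y \<inter> universe KM)) ` sets KM"

lemma eval_kemb:
  assumes "\<And>i. e i \<in> universe KM"
  shows "eval (ring_str {0..} ksets) (\<lambda>i. kemb (e i)) (\<lambda>X. kemb ` (S X \<inter> universe KM)) p \<longleftrightarrow> eval KM e S p"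
proof (rule eval_iso[where f = kemb])
  show "inj_on kemb (universe KM)"
    by (rule inj_onI) (simp add: kemb_def Abs_knum_inject)
  show "universe (ring_str {0..} ksets) = kemb ` universe KM"
  proof
    show "universe (ring_str {0..} ksets) \<subseteq> kemb ` universe KM"
    proof
      fix x assume "x \<in> universe (ring_str {0..} ksets)"
      then have "0 \<le> x" by simp
      then obtain a where "x = emb a" by (rule ex_emb)
      then have "x = kemb (Rep_knum a)" by (simp add: kemb_def Rep_knum_inverse)
      then show "x \<in> kemb ` universe KM" using Rep_knum by blast
    qed
  qed (auto simp: kemb_def emb_nonneg)
  have r: "Rep_knum (Abs_knum x) = x" if "x \<in> universe KM" for x using that by (rule Abs_knum_inverse)
  show "zeroS (ring_str {0..} ksets) = kemb (zeroS KM)" "oneS (ring_str {0..} ksets) = kemb (oneS KM)"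
    by (simp_all add: kemb_def flip: zero_knum_def one_knum_def)
  fix x y assume xy: "x \<in> universe KM" "y \<in> universe KM"
  show "plusS (ring_str {0..} ksets) (kemb x) (kemb y) = kemb (plusS KM x y)"
    using xy by (simp add: kemb_def flip: emb_simps(3)) (simp add: plus_knum_def r)
  show "timesS (ring_str {0..} ksets) (kemb x) (kemb y) = kemb (timesS KM x y)"
    using xy by (simp add: kemb_def flip: emb_simps(4)) (simp add: times_knum_def r)
  show "lessS (ring_str {0..} ksets) (kemb x) (kemb y) \<longleftrightarrow> lessS KM x y"
    using xy by (simp add: kemb_def less_knum_def r)
qed (use assms KM.wf in \<open>simp_all add: ksets_def\<close>)

lemma models_kemb: "models (ring_str {0..} ksets) \<Gamma> \<longleftrightarrow> models KM \<Gamma>"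
proof -
  have e: "\<exists>e. (\<forall>i. e i \<in> universe KM) \<and> f = (\<lambda>i. kemb (e i))" if f: "\<forall>i. 0 \<le> f i" for f
  proof -
    have "\<exists>x. x \<in> universe KM \<and> f i = kemb x" for i
    proof -
      obtain a where "f i = emb a" using ex_emb[of "f i"] f by metis
      then show ?thesis using Rep_knum[of a] by (intro exI[of _ "Rep_knum a"]) (simp add: kemb_def Rep_knum_inverse)
    qed
    then obtain e where "\<forall>i. e i \<in> universe KM \<and> f i = kemb (e i)" by metis
    then show ?thesis by (intro exI[of _ e]) auto
  qed
  have S: "\<exists>S. (\<forall>X. S X \<in> sets KM) \<and> R = (\<lambda>X. kemb ` (S X \<inter> universe KM))" if "\<forall>X. R X \<in> ksets" for R :: "nat \<Rightarrow> _"
  proof -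
    have "\<exists>Y. Y \<in> sets KM \<and> R X = kemb ` (Y \<inter> universe KM)" for X using that unfolding ksets_def by blast
    then obtain S where S: "\<forall>X. S X \<in> sets KM \<and> R X = kemb ` (S X \<inter> universe KM)" by metis
    show ?thesis
    proof (intro exI conjI)
      show "\<forall>X. S X \<in> sets KM" using S by simp
      show "R = (\<lambda>X. kemb ` (S X \<inter> universe KM))" using S by (intro ext) simp
    qed
  qed
  have nn: "0 \<le> kemb x" for x by (simp add: kemb_def emb_nonneg)
  have ks: "kemb ` (Y \<inter> universe KM) \<in> ksets" if "Y \<in> sets KM" for Y using that by (simp add: ksets_def)
  show ?thesis
  proof
    assume *: "models (ring_str {0..} ksets) \<Gamma>"
    show "models KM \<Gamma>"
      unfolding models_def
    proof (intro ballI allI impI)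
      fix p and e :: "nat \<Rightarrow> nat" and S :: "nat \<Rightarrow> nat set"
      assume p: "p \<in> \<Gamma>" "\<forall>i. e i \<in> universe KM" "\<forall>X. S X \<in> sets KM"
      have "eval (ring_str {0..} ksets) (\<lambda>i. kemb (e i)) (\<lambda>X. kemb ` (S X \<inter> universe KM)) p"
        by (rule modelsD[OF * p(1)]) (use p(2,3) nn ks in \<open>simp_all only: ring_str_simps atLeast_iff\<close>)
      then show "eval KM e S p" using eval_kemb[of e S p] p(2) by blast
    qed
  next
    assume *: "models KM \<Gamma>"
    show "models (ring_str {0..} ksets) \<Gamma>"
      unfolding models_def
    proof (intro ballI allI impI)
      fix p and f :: "nat \<Rightarrow> knum zint" and R :: "nat \<Rightarrow> knum zint set"
      assume p: "p \<in> \<Gamma>" and "\<forall>i. f i \<in> universe (ring_str {0..} ksets)" "\<forall>X. R X \<in> sets (ring_str {0..} ksets)"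
      then have fR: "\<forall>i. 0 \<le> f i" "\<forall>X. R X \<in> ksets" by simp_all
      obtain e where e: "\<forall>i. e i \<in> universe KM" "f = (\<lambda>i. kemb (e i))" using e[OF fR(1)] by blast
      obtain S where S: "\<forall>X. S X \<in> sets KM" "R = (\<lambda>X. kemb ` (S X \<inter> universe KM))" using S[OF fR(2)] by blast
      have "eval KM e S p" by (rule modelsD[OF * p]) (use e(1) S(1) in blast)+
      then show "eval (ring_str {0..} ksets) f R p" unfolding e(2) S(2) using eval_kemb[of e S p] e(1) by blast
    qed
  qed
qed

lemma no_counterexample: "\<not> counterexample M"
proof
  assume "counterexample M"
  then have "counterexample KM" by (rule counterexample_KM)
  then obtain \<psi> e S where KM: "models KM RCA0_star" "\<not> models KM RCA0" "sets KM \<noteq> {}"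
    "so_sentence \<psi>" "WKL0_star \<turnstile> Nat_sat \<psi>" "\<forall>i. e i \<in> universe KM" "\<forall>X. S X \<in> sets KM"
    "eval KM e S (Models_bij_Nat \<psi>)"
    unfolding counterexample_def wf_str_def by blast
  interpret rca ksets
  proof
    show "0 < x \<Longrightarrow> 1 \<le> x" for x :: "knum zint" by (rule zint_discrete)
    show "ksets \<noteq> {}" using KM(3) by (simp add: ksets_def)
    show "models (ring_str {0..} ksets) RCA0_star" using KM(1) by (simp add: models_kemb)
  qed
  have "models MM (induction sigma1)"
  proof (rule sigma1_induction[OF KM(4,5)])
    show "0 \<le> kemb (e i)" for i by (simp add: kemb_def emb_nonneg)
    show "kemb ` (S X \<inter> universe KM) \<in> ksets" for X using KM(7) by (simp add: ksets_def)
    show "eval MM (\<lambda>i. kemb (e i)) (\<lambda>X. kemb ` (S X \<inter> universe KM)) (Models_bij_Nat \<psi>)"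
      using eval_kemb KM(6,8) by simp
  qed
  then have "models KM (induction sigma1)" by (simp add: models_kemb)
  then have "models KM RCA0" using KM(1) unfolding models_def RCA0_def RCA0_star_def by blast
  then show False using KM(2) by blast
qed

lemma eval_ucl_independent:
  assumes "eval M e S (ucl p)" "\<forall>i. e i \<in> universe M" "\<forall>X. S X \<in> sets M"
    and "\<forall>i. f i \<in> universe M" "\<forall>X. R X \<in> sets M"
  shows "eval M f R (ucl p)"
proof -
  have "eval M e S (ucl p) \<longleftrightarrow>
    (\<forall>e S. (\<forall>i. e i \<in> universe M) \<longrightarrow> (\<forall>X. S X \<in> sets M) \<longrightarrow> eval M e S p)"
    using assms by (intro eval_ucl) simp_all
  moreover have "eval M f R (ucl p) \<longleftrightarrow>
    (\<forall>e S. (\<forall>i. e i \<in> universe M) \<longrightarrow> (\<forall>X. S X \<in> sets M) \<longrightarrow> eval M e S p)"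
    using assms by (intro eval_ucl) simp_all
  ultimately show ?thesis using assms(1) by blast
qed

text \<open>Completeness gives truth at one environment, whereas \<open>models\<close> asks for all
  of them. The axioms are closed: \<open>exp_axiom\<close> because it has no free index, the others
  because they are universal closures.\<close>

lemma RCA0_star_closed:
  assumes p: "p \<in> RCA0_star" and e: "eval M e S p" "\<forall>i. e i \<in> universe M" "\<forall>X. S X \<in> sets M"
    and f: "\<forall>i. f i \<in> universe M" "\<forall>X. R X \<in> sets M"
  shows "eval M f R p"
proof (cases "p = exp_axiom")
  case True
  have "boundN exp_axiom = 0" "boundS exp_axiom = 0"
    by (simp_all add: exp_axiom_def Power_def Beta_def Let_def tlift_def)
  then have "eval M e S exp_axiom \<longleftrightarrow> eval M f R exp_axiom" by (intro eval_cong) simp_all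
  then show ?thesis using True e(1) by simp
next
  case False
  then obtain q where "p = ucl q"
    using p unfolding RCA0_star_def basic_axioms_def delta1_comprehension_def induction_def by blast
  then show ?thesis using eval_ucl_independent e f by blast
qed

theorem theorem1:
  fixes \<psi> :: so_fm
  assumes "so_sentence \<psi>"
    and "WKL0_star \<turnstile> Nat_sat \<psi>"
  shows "\<forall>\<phi> \<in> RCA0. RCA0_star \<union> {Models_bij_Nat \<psi>} \<turnstile> \<phi>"
proof (rule ballI, rule ccontr)
  fix \<phi> assume \<phi>: "\<phi> \<in> RCA0" "\<not> RCA0_star \<union> {Models_bij_Nat \<psi>} \<turnstile> \<phi>"
  obtain M :: "nat str" and e S where M: "wf_str M" "\<forall>i. e i \<in> universe M" "\<forall>X. S X \<in> sets M"
    "\<forall>q. q \<in> RCA0_star \<union> {Models_bij_Nat \<psi>} \<longrightarrow> eval M e S q" "\<not> eval M e S \<phi>"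
    by (rule completeness[OF \<phi>(2)]) blast
  have "models M RCA0_star"
    unfolding models_def
  proof (intro ballI allI impI)
    fix p and f :: "nat \<Rightarrow> nat" and R :: "nat \<Rightarrow> nat set"
    assume p: "p \<in> RCA0_star" and f: "\<forall>i. f i \<in> universe M" "\<forall>X. R X \<in> sets M"
    have "eval M e S p" using M(4) p by blast
    then show "eval M f R p" by (rule RCA0_star_closed[OF p _ M(2,3) f])
  qed
  moreover have "\<not> models M RCA0" using \<phi>(1) M(2,3,5) unfolding models_def by blast
  moreover have "eval M e S (Models_bij_Nat \<psi>)" using M(4) by blast
  ultimately have "counterexample M" unfolding counterexample_def using M assms by blast
  then show False using no_counterexample by blast
qed

end
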